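(* Under the assumptions in the context, for every $\varepsilon>0$ the problem \[ M\Big(\iint_{\mathbb{R}^6}\frac{|u(x)-u(y)|^2}{|x-y|^{3+2s}}dxdy+\int_{\mathbb{R}^3}V(\varepsilon x)u^2dx\Big)\big[(-\Delta)^su+V(\varepsilon x)u\big]=g(\varepsilon x,u)\quad\text{in }\mathbb{R}^3 \] has a nonnegative ground state solution (a nonnegative nontrivial critical point of $\mathcal J_\varepsilon$).
   Context: Let $s\in(\frac34,1)$, $[u]^2=\iint_{\mathbb{R}^6}\frac{|u(x)-u(y)|^2}{|x-y|^{3+2s}}dxdy$, $H^s(\mathbb{R}^3)=\{u\in L^2(\mathbb{R}^3):[u]<\infty\}$. $M:[0,\infty)\to[0,\infty)$ continuous with $(M_1)$ $M(t)\ge m_0>0$ for all $t\ge0$; $(M_2)$ $M$ increasing; $(M_3)$ $\frac{M(t_1)}{t_1}-\frac{M(t_2)}{t_2}\le m_0(\frac1{t_1}-\frac1{t_2})$ for $t_1\ge t_2>0$; $\widehat M(t)=\int_0^tM$. $V\in C(\mathbb{R}^3,\mathbb{R})$ with $V_0:=\inf V>0$. $f:\mathbb{R}\to\mathbb{R}$ continuous, $f=0$ on $(-\infty,0)$, $F(t)=\int_0^tf$, with $(f_1)$ $f(t)/t^3\to0$ as $t\to0^+$; $(f_2)$ $f(t)/t^{q-1}\to0$ as $t\to\infty$ for some $q\in(4,\frac6{3-2s})$; $(f_3)$ $0<\vartheta F(t)\le f(t)t$ for $t>0$, some $\vartheta\in(4,\frac6{3-2s})$; $(f_4)$ $f(t)/t^3$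 nondecreasing on $(0,\infty)$. Fix a bounded Lipschitz domain $\Omega\subset\mathbb{R}^3$ with $V_0<\min_{\partial\Omega}V$ and $\{x\in\Omega:V(x)=V_0\}\ne\emptyset$. Fix $K>2/m_0$ and $a>0$ with $f(a)=\frac{V_0}{K}a$; let $\tilde f(t)=f(t)$ for $t\le a$, $\tilde f(t)=\frac{V_0}{K}t$ for $t>a$; $g(x,t)=\chi_\Omega(x)f(t)+(1-\chi_\Omega(x))\tilde f(t)$, $G(x,t)=\int_0^tg(x,\tau)d\tau$. For $\varepsilon>0$ let $\mathcal H_\varepsilon=\{u\in H^s(\mathbb{R}^3):\int V(\varepsilon x)u^2<\infty\}$ with norm $\|u\|_\varepsilon^2=[u]^2+\int_{\mathbb{R}^3}V(\varepsilon x)u^2dx$, and $\mathcal J_\varepsilon(u)=\frac12\widehat M(\|u\|_\varepsilon^2)-\int_{\mathbb{R}^3}G(\varepsilon x,u)dx$. A ground state is a nontrivial critical point of $\mathcal J_\varepsilon$ at the level $\inf_{\mathcal N_\varepsilon}\mathcal J_\varepsilon$, where $\mathcal N_\varepsilon=\{u\in\mathcal H_\varepsilon\setminus\{0\}:\langle\mathcal J_\varepsilon'(u),u\rangle=0\}$. *)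

theory Defs
  imports "HOL-Analysis.Analysis"
begin

type_synonym R3 = "real ^ 3"

definition lipschitz_domain :: "R3 set \<Rightarrow> bool" where
  "lipschitz_domain \<Omega> \<longleftrightarrow> open \<Omega> \<and> connected \<Omega> \<and> \<Omega> \<noteq> {} \<and>
     (\<forall>p \<in> frontier \<Omega>. \<exists>(T::R3 \<Rightarrow> R3) r h L (\<phi>::real \<Rightarrow> real \<Rightarrow> real).
        orthogonal_transformation T \<and> r > 0 \<and> h > 0 \<and>
        (\<forall>a b c d. \<bar>\<phi> a b - \<phi> c d\<bar> \<le> L * sqrt ((a - c)^2 + (b - d)^2)) \<and>
        (let C = {x. ((T (x - p))$1)^2 + ((T (x - p))$2)^2 < r^2 \<and> \<bar>(T (x - p))$3\<bar> < h}
         in \<Omega> \<inter> C = {x \<in> C. (T (x - p))$3 > \<phi> ((T (x - p))$1) ((T (x - p))$2)}))"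

definition gagliardo_ennreal :: "real \<Rightarrow> (R3 \<Rightarrow> real) \<Rightarrow> ennreal" where
  "gagliardo_ennreal s u =
     nn_integral (pair_measure lborel lborel)
       (\<lambda>z. ennreal ((u (fst z) - u (snd z))^2 / norm (fst z - snd z) powr (3 + 2 * s)))"

definition gagliardo :: "real \<Rightarrow> (R3 \<Rightarrow> real) \<Rightarrow> real" where
  "gagliardo s u = enn2real (gagliardo_ennreal s u)"

definition pot_ennreal :: "(R3 \<Rightarrow> real) \<Rightarrow> real \<Rightarrow> (R3 \<Rightarrow> real) \<Rightarrow> ennreal" where
  "pot_ennreal V \<epsilon> u = (\<integral>\<^sup>+ x. ennreal (V (\<epsilon> *\<^sub>R x) * (u x)^2) \<partial>lborel)"

text \<open>The space H_\<epsilon> (functions represented by Borel measurable representatives).\<close>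
definition H_eps :: "real \<Rightarrow> (R3 \<Rightarrow> real) \<Rightarrow> real \<Rightarrow> (R3 \<Rightarrow> real) set" where
  "H_eps s V \<epsilon> = {u. u \<in> borel_measurable borel \<and> integrable lborel (\<lambda>x. (u x)^2) \<and>
       gagliardo_ennreal s u < \<infinity> \<and> pot_ennreal V \<epsilon> u < \<infinity>}"

definition norm_eps_sq :: "real \<Rightarrow> (R3 \<Rightarrow> real) \<Rightarrow> real \<Rightarrow> (R3 \<Rightarrow> real) \<Rightarrow> real" where
  "norm_eps_sq s V \<epsilon> u = gagliardo s u + enn2real (pot_ennreal V \<epsilon> u)"

definition Mhat :: "(real \<Rightarrow> real) \<Rightarrow> real \<Rightarrow> real" where
  "Mhat M t = integral {0..t} M"

definition primitive :: "(real \<Rightarrow> real) \<Rightarrow> real \<Rightarrow> real" where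
  "primitive f t = integral {0..t} f"

definition f_tilde :: "(real \<Rightarrow> real) \<Rightarrow> real \<Rightarrow> real \<Rightarrow> real \<Rightarrow> real \<Rightarrow> real" where
  "f_tilde f V0 K a t = (if t \<le> a then f t else V0 / K * t)"

definition g_pen :: "R3 set \<Rightarrow> (real \<Rightarrow> real) \<Rightarrow> real \<Rightarrow> real \<Rightarrow> real \<Rightarrow> R3 \<Rightarrow> real \<Rightarrow> real" where
  "g_pen \<Omega> f V0 K a x t = (if x \<in> \<Omega> then f t else f_tilde f V0 K a t)"

definition G_pen :: "R3 set \<Rightarrow> (real \<Rightarrow> real) \<Rightarrow> real \<Rightarrow> real \<Rightarrow> real \<Rightarrow> R3 \<Rightarrow> real \<Rightarrow> real" where
  "G_pen \<Omega> f V0 K a x t = integral {0..t} (g_pen \<Omega> f V0 K a x)"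

definition J_eps :: "(real \<Rightarrow> real) \<Rightarrow> real \<Rightarrow> (R3 \<Rightarrow> real) \<Rightarrow> real \<Rightarrow> (R3 \<Rightarrow> real \<Rightarrow> real)
                     \<Rightarrow> (R3 \<Rightarrow> real) \<Rightarrow> real" where
  "J_eps M s V \<epsilon> G u = 1/2 * Mhat M (norm_eps_sq s V \<epsilon> u) - (\<integral>x. G (\<epsilon> *\<^sub>R x) (u x) \<partial>lborel)"

definition J_dir_deriv :: "((R3 \<Rightarrow> real) \<Rightarrow> real) \<Rightarrow> (R3 \<Rightarrow> real) \<Rightarrow> (R3 \<Rightarrow> real) \<Rightarrow> real \<Rightarrow> bool" where
  "J_dir_deriv J u v d \<longleftrightarrow> ((\<lambda>t::real. J (\<lambda>x. u x + t * v x)) has_real_derivative d) (at 0)"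

definition critical_point :: "(R3 \<Rightarrow> real) set \<Rightarrow> ((R3 \<Rightarrow> real) \<Rightarrow> real) \<Rightarrow> (R3 \<Rightarrow> real) \<Rightarrow> bool" where
  "critical_point H J u \<longleftrightarrow> u \<in> H \<and> (\<forall>v \<in> H. J_dir_deriv J u v 0)"

definition nontrivial :: "(R3 \<Rightarrow> real) \<Rightarrow> bool" where
  "nontrivial u \<longleftrightarrow> \<not> (AE x in lborel. u x = 0)"

definition nehari :: "(R3 \<Rightarrow> real) set \<Rightarrow> ((R3 \<Rightarrow> real) \<Rightarrow> real) \<Rightarrow> (R3 \<Rightarrow> real) set" where
  "nehari H J = {u \<in> H. nontrivial u \<and> J_dir_deriv J u u 0}"

definition ground_state :: "(R3 \<Rightarrow> real) set \<Rightarrow> ((R3 \<Rightarrow> real) \<Rightarrow> real) \<Rightarrow> (R3 \<Rightarrow> real) \<Rightarrow> bool" where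
  "ground_state H J u \<longleftrightarrow> critical_point H J u \<and> nontrivial u \<and> J u = Inf (J ` nehari H J)"

end

theory Submission
  imports Defs "HOL-Complex_Analysis.Great_Picard"
begin

text \<open>
  The ground state is a minimizer of the energy on the Nehari set, obtained without weak convergence.

  Comparing the superlevel sets of \<open>u\<close> at heights \<open>l\<close> and \<open>2 l\<close> in the Gagliardo integral bounds the
  measure of the second by a power of the measure of the first; iterating over dyadic heights gives a
  weak-type Sobolev inequality, hence uniformly small tails of \<open>\<bar>u\<bar> powr q\<close> on bounded sets of the
  energy space. Averaging over small cubes shows that bounded sequences have subsequences that
  converge almost everywhere.

  Along a ray \<open>t u\<close> the derivative of the energy divided by \<open>t\<^sup>3\<close> is strictly decreasing, so points of
  the Nehari set maximize the energy on their ray, and every \<open>u\<close> whose positive part does not vanish in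
  the scaled domain can be projected to the Nehari set. Let \<open>u\<^sub>n\<close> be a minimizing sequence with almost
  everywhere limit \<open>u\<close>. Inside the scaled domain the nonlinear terms converge, outside the penalized
  integrand together with the quadratic term is nonnegative, so Fatou's lemma gives
  \<open>J (t u) \<le> liminf J (t u\<^sub>n) \<le> inf J\<close> for all \<open>t > 0\<close>. Passing to the positive part of \<open>u\<close> only
  lowers the energy, and its projection is a nonnegative minimizer \<open>z\<close>.

  Neither the functional nor the Nehari set is smooth enough for Lagrange multipliers. If the
  derivative at \<open>z\<close> in a direction \<open>v\<close> were negative, then by the intermediate value theorem some
  \<open>\<alpha> z + \<beta> v\<close> near \<open>z\<close> would lie on the Nehari set with smaller energy.
\<close>

section \<open>Weak-type fractional Sobolev inequality\<close>

text \<open>The exponents fit together as follows: \<open>M3\<close> lets \<open>M\<close> grow at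
  most linearly, so the quadratic part contributes at most order \<open>t^3\<close> to the
  derivative along a ray. This is why \<open>f\<close> is compared with \<open>t^3\<close>, and
  \<open>s > 3/4\<close> means \<open>6 / (3 - 2 * s) > 4\<close>, which leaves room for such an
  \<open>f\<close>. \<open>V\<close> need not grow at infinity, so mass may escape there. The
  condition \<open>K > 2 / m0\<close> lets the penalized term outside the domain use up less than
  half of the coercive part \<open>m0 * N u\<close>; what remains forces every point of the Nehari
  set to carry a fixed amount of \<open>f (u x) * u x\<close> inside the domain, where it survives
  the limit. Therefore the limit is not zero. Almost everywhere convergence controls the norm from
  one side only, so the limit itself may miss the Nehari set. For this reason the energy is bounded
  for all positive multiples of the limit at once; the multiple that lies on the Nehari set is
  selected afterwards. Monotonicity of \<open>Mhat M t - m0 * t\<close> is what makes the nonlocal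
  coefficient compatible with a drop of the norm.\<close>

lemma emeasure_cube:
  fixes x :: R3
  assumes "0 \<le> r"
  shows "emeasure lborel (cbox (x - (\<chi> i. r)) (x + (\<chi> i. r))) = ennreal ((2 * r) ^ 3)"
proof -
  have "(\<Prod>b\<in>(Basis::R3 set). ((x + (\<chi> i. r)) - (x - (\<chi> i. r))) \<bullet> b) = (\<Prod>b\<in>(Basis::R3 set). 2 * r)"
    by (intro prod.cong) (auto simp: Basis_vec_def inner_axis)
  also have "\<dots> = (2 * r) ^ 3" by simp
  finally show ?thesis
    using assms by (subst emeasure_lborel_cbox_eq) (auto simp: Basis_vec_def inner_axis)
qed

text \<open>The sharp factor would be the square root of 3; 2 is a convenient upper bound for
  it.\<close>

lemma norm_le_of_components:
  fixes z :: R3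
  assumes "\<And>i. \<bar>z $ i\<bar> \<le> r"
  shows "norm z \<le> 2 * r"
proof -
  have r: "0 \<le> r" using assms[of 1] by simp
  have "(\<Sum>i\<in>UNIV. (z $ i)\<^sup>2) \<le> (\<Sum>i\<in>(UNIV::3 set). r\<^sup>2)"
    using assms by (intro sum_mono) (metis abs_le_square_iff abs_of_nonneg r)
  also have "\<dots> \<le> (2 * r)\<^sup>2" by (simp add: power2_eq_square)
  finally have "sqrt (\<Sum>i\<in>UNIV. (z $ i)\<^sup>2) \<le> 2 * r"
    using r by (simp add: real_le_lsqrt)
  then show ?thesis by (simp add: norm_vec_def L2_set_def)
qed

text \<open>A cube centred at \<open>x\<close> with volume \<open>2 * m\<close> has at least volume
  \<open>m\<close> outside \<open>E\<close>, and its points are so close to \<open>x\<close> that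
  the kernel there is at least \<open>1 / (2 * r) powr (3 + 2 * s)\<close>. Only the measure of
  \<open>E\<close> enters, not its shape.\<close>

lemma kernel_complement_lower_bound:
  fixes E :: "R3 set" and x :: R3
  assumes E [measurable]: "E \<in> sets borel" and Em: "emeasure lborel E = ennreal m"
    and m: "m > 0" and s: "s > 0"
  shows "ennreal (2 powr (-(1 + 2 * s/3)) * m powr (-(2 * s/3)))
     \<le> (\<integral>\<^sup>+ y. indicator (-E) y * ennreal (1 / norm (x - y) powr (3 + 2 * s)) \<partial>lborel)"
proof -
  define r where "r = (2*m) powr (1/3) / 2"
  have r: "r > 0" using m by (simp add: r_def)
  have r3: "(2*r)^3 = 2*m" using m
    by (simp add: r_def powr_powr flip: powr_numeral)
  define C where "C = cbox (x - (\<chi> i. r)) (x + (\<chi> i. r))"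
  \<comment> \<open>The point \<open>x\<close> is taken out because division by zero gives the
    kernel the value 0 there.\<close>
  define D where "D = C - E - {x}"
  have [measurable]: "C \<in> sets borel" "D \<in> sets borel" by (auto simp: C_def D_def)
  have eC: "emeasure lborel C = ennreal (2*m)"
    using emeasure_cube[of r x] r unfolding C_def r3 by simp
  have "emeasure lborel C \<le> emeasure lborel (D \<union> (E \<union> {x}))"
    by (rule emeasure_mono) (auto simp: D_def)
  also have "\<dots> \<le> emeasure lborel D + emeasure lborel (E \<union> {x})"
    by (rule emeasure_subadditive) auto
  also have "\<dots> \<le> emeasure lborel D + (emeasure lborel E + emeasure lborel {x})"
    by (intro add_left_mono emeasure_subadditive) auto
  finally have le: "ennreal (2*m) \<le> emeasure lborel D + ennreal m"
    by (simp add: eC Em)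
  have D: "ennreal m \<le> emeasure lborel D"
  proof -
    have "ennreal m + ennreal m = ennreal (2*m)" using m by (simp flip: ennreal_plus)
    then have "ennreal m + ennreal m \<le> ennreal m + emeasure lborel D" using le by (simp add: add.commute)
    then show ?thesis by (simp add: ennreal_add_left_cancel_le)
  qed
  have nb: "norm (x - y) \<le> 2 * r" if "y \<in> C" for y
  proof (rule norm_le_of_components)
    fix i
    have "(x - (\<chi> i. r)) $ i \<le> y $ i \<and> y $ i \<le> (x + (\<chi> i. r)) $ i"
      using that unfolding C_def mem_box_cart by blast
    then show "\<bar>(x - y) $ i\<bar> \<le> r" by auto
  qed
  let ?c = "1 / (2*r) powr (3 + 2 * s)"
  have "ennreal (2 powr (-(1 + 2 * s/3)) * m powr (-(2 * s/3))) = ennreal ?c * ennreal m"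
  proof -
    have "(2*r) powr (3 + 2 * s) = (2*m) powr (1 + 2 * s/3)"
      using m by (simp add: r_def powr_powr algebra_simps add_divide_distrib)
    also have "\<dots> = 2 powr (1 + 2 * s/3) * (m * m powr (2 * s/3))"
      using m by (simp add: powr_mult powr_add)
    finally have "?c * m = 2 powr (-(1 + 2 * s/3)) * m powr (-(2 * s/3))"
      using m by (simp only: powr_minus) (simp add: field_simps)
    then show ?thesis using m by (simp flip: ennreal_mult)
  qed
  also have "\<dots> \<le> ennreal ?c * emeasure lborel D" by (intro mult_left_mono D) auto
  also have "\<dots> = (\<integral>\<^sup>+ y. ennreal ?c * indicator D y \<partial>lborel)"
    by (simp add: nn_integral_cmult_indicator)
  also have "\<dots> \<le> (\<integral>\<^sup>+ y. indicator (-E) y * ennreal (1 / norm (x - y) powr (3 + 2 * s)) \<partial>lborel)"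
  proof (intro nn_integral_mono)
    fix y :: R3
    show "ennreal ?c * indicator D y \<le> indicator (-E) y * ennreal (1 / norm (x - y) powr (3 + 2 * s))"
    proof (cases "y \<in> D")
      case True
      then have y: "y \<in> C" "y \<notin> E" "y \<noteq> x" by (auto simp: D_def)
      have "norm (x - y) powr (3 + 2 * s) \<le> (2*r) powr (3 + 2 * s)"
        using nb[OF y(1)] s by (intro powr_mono2) auto
      then have "?c \<le> 1 / norm (x - y) powr (3 + 2 * s)"
        using y(3) by (intro divide_left_mono mult_pos_pos) (auto simp: r)
      then show ?thesis using True y by (simp add: ennreal_leI)
    qed simp
  qed
  finally show ?thesis .
qed

lemma gagliardo_integrand_measurable [measurable]:
  assumes [measurable]: "(u :: R3 \<Rightarrow> real) \<in> borel_measurable borel"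
  shows "(\<lambda>z. (u (fst z) - u (snd z))^2 / norm (fst z - snd z) powr (3 + 2 * s))
    \<in> borel_measurable (lborel \<Otimes>\<^sub>M lborel)"
  by measurable

lemma gagliardo_ennreal_iterated:
  assumes [measurable]: "u \<in> borel_measurable borel"
  shows "gagliardo_ennreal s u =
    (\<integral>\<^sup>+ x. \<integral>\<^sup>+ y. ennreal ((u x - u y)^2 / norm (x - y) powr (3 + 2 * s)) \<partial>lborel \<partial>lborel)"
  unfolding gagliardo_ennreal_def
  by (subst lborel.nn_integral_fst[symmetric]) auto

text \<open>Between a point of the level set at \<open>2 * l\<close> and a point outside the one at
  \<open>l\<close> the values differ by at least \<open>l\<close>. So the Gagliardo integral is at
  least \<open>l^2\<close> times the measure of the smaller set times the kernel mass outside the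
  larger one.\<close>

lemma level_set_recursion:
  fixes u :: "R3 \<Rightarrow> real"
  assumes [measurable]: "u \<in> borel_measurable borel" and l: "l > 0" and s: "s > 0"
    and G: "gagliardo_ennreal s u \<le> ennreal R" and R: "R \<ge> 0"
    and fin: "emeasure lborel {x. \<bar>u x\<bar> > l} < \<infinity>"
  shows "measure lborel {x. \<bar>u x\<bar> > 2*l}
     \<le> 2 powr (1 + 2 * s/3) * R / l^2 * measure lborel {x. \<bar>u x\<bar> > l} powr (2 * s/3)"
proof -
  define E where "E = {x. \<bar>u x\<bar> > l}"
  define E2 where "E2 = {x. \<bar>u x\<bar> > 2*l}"
  define m where "m = measure lborel E"
  have [measurable]: "E \<in> sets borel" "E2 \<in> sets borel" by (auto simp: E_def E2_def)
  have sub: "E2 \<subseteq> E" using l by (auto simp: E_def E2_def)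
  have Em: "emeasure lborel E = ennreal m"
    using fin by (simp add: m_def E_def emeasure_eq_ennreal_measure top.not_eq_extremum)
  have E2fin: "emeasure lborel E2 < \<infinity>"
    using emeasure_mono[OF sub, of lborel] fin by (auto simp: E_def[symmetric])
  have E2m: "emeasure lborel E2 = ennreal (measure lborel E2)"
    using E2fin by (simp add: emeasure_eq_ennreal_measure top.not_eq_extremum)
  show ?thesis
  proof (cases "m = 0")
    case True
    have "emeasure lborel E2 \<le> 0" using emeasure_mono[OF sub, of lborel] Em True by simp
    then have "measure lborel E2 = 0" by (simp add: measure_def)
    then show ?thesis using R l by (simp add: E2_def)
  next
    case False
    then have m: "m > 0" by (simp add: m_def zero_less_measure_iff)
    let ?c = "2 powr (-(1 + 2 * s/3)) * m powr (-(2 * s/3))"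
    have "ennreal (l^2 * ?c * measure lborel E2) = ennreal (l^2) * ennreal ?c * emeasure lborel E2"
      by (simp add: E2m ennreal_mult)
    also have "\<dots> = (\<integral>\<^sup>+ x. ennreal (l^2) * ennreal ?c * indicator E2 x \<partial>lborel)"
      by (simp add: nn_integral_cmult_indicator)
    also have "\<dots> \<le> (\<integral>\<^sup>+ x. \<integral>\<^sup>+ y. ennreal ((u x - u y)^2 / norm (x - y) powr (3 + 2 * s)) \<partial>lborel \<partial>lborel)"
    proof (intro nn_integral_mono)
      fix x :: R3
      show "ennreal (l^2) * ennreal ?c * indicator E2 x
        \<le> (\<integral>\<^sup>+ y. ennreal ((u x - u y)^2 / norm (x - y) powr (3 + 2 * s)) \<partial>lborel)"
      proof (cases "x \<in> E2")
        case True
        have "ennreal (l^2) * ennreal ?c \<le>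
           ennreal (l^2) * (\<integral>\<^sup>+ y. indicator (-E) y * ennreal (1 / norm (x - y) powr (3 + 2 * s)) \<partial>lborel)"
          using Em m s by (intro mult_left_mono kernel_complement_lower_bound) auto
        also have "\<dots> = (\<integral>\<^sup>+ y. ennreal (l^2) * (indicator (-E) y * ennreal (1 / norm (x - y) powr (3 + 2 * s))) \<partial>lborel)"
          by (subst nn_integral_cmult) auto
        also have "\<dots> \<le> (\<integral>\<^sup>+ y. ennreal ((u x - u y)^2 / norm (x - y) powr (3 + 2 * s)) \<partial>lborel)"
        proof (intro nn_integral_mono)
          fix y :: R3
          show "ennreal (l^2) * (indicator (-E) y * ennreal (1 / norm (x - y) powr (3 + 2 * s)))
             \<le> ennreal ((u x - u y)^2 / norm (x - y) powr (3 + 2 * s))"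
          proof (cases "y \<in> E")
            case False
            then have "l \<le> \<bar>u x - u y\<bar>" using True by (auto simp: E_def E2_def)
            then have "l^2 \<le> (u x - u y)^2" using l
              by (metis abs_of_pos abs_le_square_iff)
            then have "l^2 * (1 / norm (x - y) powr (3 + 2 * s)) \<le> (u x - u y)^2 / norm (x - y) powr (3 + 2 * s)"
              by (simp add: divide_right_mono)
            then show ?thesis using False by (simp add: ennreal_leI flip: ennreal_mult)
          qed simp
        qed
        finally show ?thesis using True by simp
      qed simp
    qed
    also have "\<dots> = gagliardo_ennreal s u" by (subst gagliardo_ennreal_iterated) auto
    also note G
    finally have "l^2 * ?c * measure lborel E2 \<le> R" using R by (simp add: ennreal_le_iff)
    then have "measure lborel E2 \<le> R / (l^2 * ?c)"
      using l m by (simp add: field_simps)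
    also have "\<dots> = 2 powr (1 + 2 * s/3) * R / l^2 * m powr (2 * s/3)"
      using m l by (simp only: powr_minus) (simp add: field_simps)
    finally show ?thesis by (simp add: E2_def m_def E_def)
  qed
qed

text \<open>Chebyshev's inequality; it starts the recursion over the levels and shows that the
  measures involved are finite.\<close>

lemma emeasure_level_set_le:
  fixes u :: "R3 \<Rightarrow> real"
  assumes [measurable]: "u \<in> borel_measurable borel" and l: "l > 0"
    and L2: "(\<integral>\<^sup>+ x. ennreal ((u x)^2) \<partial>lborel) \<le> ennreal R"
  shows "emeasure lborel {x. \<bar>u x\<bar> > l} \<le> ennreal (R / l^2)"
proof -
  have "ennreal (l^2) * emeasure lborel {x. \<bar>u x\<bar> > l} = (\<integral>\<^sup>+ x. ennreal (l^2) * indicator {x. \<bar>u x\<bar> > l} x \<partial>lborel)"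
    by (simp add: nn_integral_cmult_indicator)
  also have "\<dots> \<le> (\<integral>\<^sup>+ x. ennreal ((u x)^2) \<partial>lborel)"
  proof (intro nn_integral_mono)
    fix x
    have "l < \<bar>u x\<bar> \<Longrightarrow> l^2 \<le> (u x)^2" using l
      by (metis abs_of_pos abs_le_square_iff less_imp_le)
    then show "ennreal (l^2) * indicator {x. \<bar>u x\<bar> > l} x \<le> ennreal ((u x)^2)"
      by (auto simp: indicator_def ennreal_leI)
  qed
  also note L2
  finally have *: "ennreal (l^2) * emeasure lborel {x. \<bar>u x\<bar> > l} \<le> ennreal R" .
  have "emeasure lborel {x. \<bar>u x\<bar> > l} = ennreal (1/l^2) * (ennreal (l^2) * emeasure lborel {x. \<bar>u x\<bar> > l})"
    using l by (simp flip: mult.assoc ennreal_mult)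
  also have "\<dots> \<le> ennreal (1/l^2) * ennreal R" using * by (intro mult_left_mono) auto
  also have "\<dots> \<le> ennreal (R/l^2)"
    by (simp flip: ennreal_mult')
  finally show ?thesis .
qed

text \<open>The exponent is the fixed point of the recursion: \<open>p = 2 + (2 s / 3) p\<close>
  for \<open>p = 6 / (3 - 2 s)\<close>.\<close>

lemma weak_sobolev:
  assumes s: "0 < s" "s < 1" and R: "R > 0"
  obtains D where "D > 0"
    "\<And>(u :: R3 \<Rightarrow> real) k. u \<in> borel_measurable borel \<Longrightarrow>
       (\<integral>\<^sup>+ x. ennreal ((u x)^2) \<partial>lborel) \<le> ennreal R \<Longrightarrow> gagliardo_ennreal s u \<le> ennreal R \<Longrightarrow>
       emeasure lborel {x. \<bar>u x\<bar> > 2^k} \<le> ennreal (D * 2 powr (- real k * (6/(3-2 * s))))"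
proof -
  define p where "p = 6/(3-2 * s)"
  define \<sigma> where "\<sigma> = 2 * s/3"
  define C where "C = 2 powr (1+\<sigma>) * R"
  \<comment> \<open>The first entry covers level 0, where Chebyshev's inequality is used; the second
    is the value from which on the recursion reproduces its own bound,
    \<open>C * 2 powr p * D powr \<sigma> <= D\<close>.\<close>
  define D where "D = max R ((C * 2 powr p) powr (1/(1-\<sigma>)))"
  have sig: "0 < \<sigma>" "\<sigma> < 1" using s by (auto simp: \<sigma>_def)
  have p: "p = 2 + \<sigma> * p" using s by (simp add: p_def \<sigma>_def field_simps)
  have C: "C > 0" using R by (simp add: C_def)
  have D0: "D > 0" using R by (simp add: D_def)
  have D1: "C * 2 powr p * D powr \<sigma> \<le> D"
  proof -
    have "(C * 2 powr p) = ((C * 2 powr p) powr (1/(1-\<sigma>))) powr (1-\<sigma>)"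
      using sig C by (simp add: powr_powr)
    also have "\<dots> \<le> D powr (1-\<sigma>)" using sig by (intro powr_mono2) (auto simp: D_def)
    finally have "C * 2 powr p * D powr \<sigma> \<le> D powr (1-\<sigma>) * D powr \<sigma>"
      by (intro mult_right_mono) auto
    also have "\<dots> = D" using D0 by (simp flip: powr_add)
    finally show ?thesis .
  qed
  have main: "emeasure lborel {x. \<bar>u x\<bar> > 2^k} \<le> ennreal (D * 2 powr (- real k * p))"
    if u [measurable]: "u \<in> borel_measurable borel"
      and L2: "(\<integral>\<^sup>+ x. ennreal ((u x)^2) \<partial>lborel) \<le> ennreal R"
      and G: "gagliardo_ennreal s u \<le> ennreal R" for u :: "R3 \<Rightarrow> real" and k
  proof (induction k)
    case 0
    have "emeasure lborel {x. \<bar>u x\<bar> > 1} \<le> ennreal (R / 1^2)"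
      by (rule emeasure_level_set_le) (use L2 in auto)
    also have "\<dots> \<le> ennreal D" by (intro ennreal_leI) (simp add: D_def)
    finally show ?case by simp
  next
    case (Suc k)
    have fin: "emeasure lborel {x. \<bar>u x\<bar> > 2^k} < \<infinity>"
      using Suc.IH by (simp add: le_less_trans)
    have IH: "measure lborel {x. \<bar>u x\<bar> > 2^k} \<le> D * 2 powr (- real k * p)"
      using Suc.IH D0 by (simp add: measure_def enn2real_leI)
    have fin2: "emeasure lborel {x. \<bar>u x\<bar> > 2^Suc k} < \<infinity>"
      using emeasure_level_set_le[OF u _ L2, of "2^Suc k"] by (simp add: le_less_trans)
    have "measure lborel {x. \<bar>u x\<bar> > 2 * 2^k}
       \<le> C / (2^k)^2 * measure lborel {x. \<bar>u x\<bar> > 2^k} powr \<sigma>"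
      unfolding C_def \<sigma>_def using s G R fin by (intro level_set_recursion) auto
    also have "\<dots> \<le> C / (2^k)^2 * (D * 2 powr (- real k * p)) powr \<sigma>"
      using IH sig C by (intro mult_left_mono powr_mono2) auto
    also have "\<dots> = (C * 2 powr p * D powr \<sigma>) * 2 powr (- real (Suc k) * p)"
    proof -
      have "((2::real)^k)^2 = 2 powr (2 * real k)"
        by (metis mult.commute of_nat_mult of_nat_numeral power_mult powr_realpow zero_less_numeral)
      moreover have "(D * 2 powr (- real k * p)) powr \<sigma> = D powr \<sigma> * 2 powr (- real k * (\<sigma> * p))"
        using D0 by (simp add: powr_mult powr_powr algebra_simps)
      moreover have "2 powr (- real k * (\<sigma> * p)) / 2 powr (2 * real k) = 2 powr (- real k * p)"
        by (simp flip: powr_diff) (subst p, simp add: algebra_simps)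
      moreover have "2 powr p * 2 powr (- real (Suc k) * p) = 2 powr (- real k * p)"
        by (simp flip: powr_add add: algebra_simps)
      ultimately show ?thesis
        by (simp add: divide_inverse mult_ac)
    qed
    also have "\<dots> \<le> D * 2 powr (- real (Suc k) * p)" using D1 by (intro mult_right_mono) auto
    finally show ?case
      using fin2 by (simp add: emeasure_eq_ennreal_measure top.not_eq_extremum ennreal_leI)
  qed
  show ?thesis using that[OF D0] main unfolding p_def by blast
qed

section \<open>Uniform tails and convergence of subcritical integrals\<close>

text \<open>Extended integrals are used so that membership includes finiteness. The potential does
  not enter, so the compactness results are independent of \<open>V\<close>.\<close>

definition sobolev_ball :: "real \<Rightarrow> real \<Rightarrow> (R3 \<Rightarrow> real) set" where
  "sobolev_ball s R = {u. u \<in> borel_measurable borel \<and>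
     (\<integral>\<^sup>+ x. ennreal ((u x)^2) \<partial>lborel) \<le> ennreal R \<and> gagliardo_ennreal s u \<le> ennreal R}"

lemma sobolev_ball_measurable: "u \<in> sobolev_ball s R \<Longrightarrow> u \<in> borel_measurable borel"
  by (simp add: sobolev_ball_def)

lemma ex_dyadic_level:
  fixes t :: real
  assumes "t > 2^k"
  obtains j where "2^(j+k) < t" "t \<le> 2^(j+k+1)"
proof -
  obtain n where n: "t \<le> 2^n" using real_arch_pow[of 2 t] by (metis less_imp_le one_less_numeral_iff semiring_norm(76))
  define N where "N = (LEAST n. t \<le> 2^n)"
  have N: "t \<le> 2^N" unfolding N_def using n by (rule LeastI)
  have "k < N"
  proof (rule ccontr)
    assume "\<not> k < N"
    then have "(2::real)^N \<le> 2^k" by (intro power_increasing) auto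
    then show False using N assms by linarith
  qed
  then obtain j where j: "N = j + k + 1" by (metis add.commute less_imp_Suc_add Suc_eq_plus1)
  have "\<not> t \<le> 2^(j+k)" using not_less_Least[of "j+k" "\<lambda>n. t \<le> 2^n"] j by (simp add: N_def)
  then show ?thesis using that[of j] N j by auto
qed

lemma suminf_term: "(f :: nat \<Rightarrow> ennreal) j \<le> suminf f"
  using sum_le_suminf[of f "{j}"] by simp

text \<open>On the shell \<open>2^(j+k) < |u| <= 2^(j+k+1)\<close> the integrand is at most a
  constant times \<open>2 powr ((j+k) * q)\<close>, while the weak inequality bounds the measure by
  a multiple of \<open>2 powr (-(j+k) * p)\<close>. For \<open>q < p\<close> this is a geometric
  series, uniformly in \<open>u\<close>, whose first term tends to 0 as \<open>k\<close>
  grows.\<close>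

lemma sobolev_ball_uniform_tail:
  assumes s: "0 < s" "s < 1" and R: "R > 0" and q: "0 < q" "q < 6/(3 - 2 * s)" and e: "e > 0"
  obtains k :: nat where
    "\<And>u. u \<in> sobolev_ball s R \<Longrightarrow>
       (\<integral>\<^sup>+ x. ennreal (\<bar>u x\<bar> powr q) * indicator {x. \<bar>u x\<bar> > 2^k} x \<partial>lborel) \<le> ennreal e"
proof -
  define p where "p = 6/(3 - 2 * s)"
  define y where "y = 2 powr (q - p)"
  have y: "0 < y" "y < 1" using q powr_less_mono[of "q - p" 0 2] by (auto simp: y_def p_def)
  obtain D where D: "D > 0"
    and Dle: "\<And>(u :: R3 \<Rightarrow> real) k. u \<in> borel_measurable borel \<Longrightarrow>
       (\<integral>\<^sup>+ x. ennreal ((u x)^2) \<partial>lborel) \<le> ennreal R \<Longrightarrow> gagliardo_ennreal s u \<le> ennreal R \<Longrightarrow>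
       emeasure lborel {x. \<bar>u x\<bar> > 2^k} \<le> ennreal (D * 2 powr (- real k * p))"
    using weak_sobolev[OF s R] unfolding p_def by blast
  define c where "c = 2 powr q * D / (1 - y)"
  have c: "c > 0" using D y by (simp add: c_def)
  obtain k where k: "y ^ k < e / c" using real_arch_pow_inv[of "e/c" y] y c e by auto
  have "(\<integral>\<^sup>+ x. ennreal (\<bar>u x\<bar> powr q) * indicator {x. \<bar>u x\<bar> > 2^k} x \<partial>lborel) \<le> ennreal e"
    if u: "u \<in> sobolev_ball s R" for u
  proof -
    have [measurable]: "u \<in> borel_measurable borel" using u by (simp add: sobolev_ball_def)
    let ?f = "\<lambda>j x. ennreal (2 powr (real (j+k+1) * q)) * indicator {x. \<bar>u x\<bar> > 2^(j+k)} x"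
    have "(\<integral>\<^sup>+ x. ennreal (\<bar>u x\<bar> powr q) * indicator {x. \<bar>u x\<bar> > 2^k} x \<partial>lborel)
       \<le> (\<integral>\<^sup>+ x. (\<Sum>j. ?f j x) \<partial>lborel)"
    proof (intro nn_integral_mono)
      fix x :: R3
      show "ennreal (\<bar>u x\<bar> powr q) * indicator {x. \<bar>u x\<bar> > 2^k} x \<le> (\<Sum>j. ?f j x)"
      proof (cases "\<bar>u x\<bar> > 2^k")
        case True
        then obtain j where j: "2^(j+k) < \<bar>u x\<bar>" "\<bar>u x\<bar> \<le> 2^(j+k+1)" using ex_dyadic_level by blast
        have "\<bar>u x\<bar> powr q \<le> (2 ^ (j+k+1)) powr q" using j q by (intro powr_mono2) auto
        also have "\<dots> = 2 powr (real (j+k+1) * q)"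
          by (simp only: powr_realpow[symmetric] powr_powr zero_less_numeral)
        finally have "ennreal (\<bar>u x\<bar> powr q) * indicator {x. \<bar>u x\<bar> > 2^k} x \<le> ?f j x"
          using True j by (simp add: ennreal_leI)
        also have "\<dots> \<le> (\<Sum>j. ?f j x)"
          using suminf_term[of "\<lambda>j. ?f j x" j] .
        finally show ?thesis .
      qed simp
    qed
    also have "\<dots> = (\<Sum>j. \<integral>\<^sup>+ x. ?f j x \<partial>lborel)"
      by (rule nn_integral_suminf) auto
    also have "\<dots> = (\<Sum>j. ennreal (2 powr (real (j+k+1) * q)) * emeasure lborel {x. \<bar>u x\<bar> > 2^(j+k)})"
      by (simp add: nn_integral_cmult_indicator)
    also have "\<dots> \<le> (\<Sum>j. ennreal ((2 powr q * D * y^k) * y ^ j))"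
    proof (intro suminf_le summableI)
      fix j
      have "ennreal (2 powr (real (j+k+1) * q)) * emeasure lborel {x. \<bar>u x\<bar> > 2^(j+k)}
        \<le> ennreal (2 powr (real (j+k+1) * q)) * ennreal (D * 2 powr (- real (j+k) * p))"
        using u by (intro mult_left_mono Dle) (auto simp: sobolev_ball_def)
      also have "\<dots> = ennreal ((2 powr q * D * y^k) * y ^ j)"
      proof -
        have "y^k * y^j = 2 powr (real (j+k) * (q - p))"
          by (simp add: y_def powr_power powr_add[symmetric] algebra_simps)
        then have "(2 powr q * D * y^k) * y ^ j = 2 powr q * D * 2 powr (real (j+k) * (q - p))" by simp
        also have "\<dots> = 2 powr (real (j+k+1) * q) * (D * 2 powr (- real (j+k) * p))"
          by (simp add: algebra_simps powr_add powr_diff powr_minus_divide)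
        finally show ?thesis using D by (simp only:) (simp add: ennreal_mult)
      qed
      finally show "ennreal (2 powr (real (j+k+1) * q)) * emeasure lborel {x. \<bar>u x\<bar> > 2^(j+k)} \<le> \<dots>" .
    qed
    also have "\<dots> = ennreal (2 powr q * D * y^k * (1 / (1 - y)))"
    proof -
      have "(\<lambda>j. (2 powr q * D * y^k) * y ^ j) sums (2 powr q * D * y^k * (1 / (1 - y)))"
        using y by (intro sums_mult geometric_sums) auto
      then show ?thesis using D y by (intro suminf_ennreal_eq) auto
    qed
    also have "\<dots> = ennreal (c * y ^ k)" by (simp add: c_def mult_ac)
    also have "\<dots> \<le> ennreal e" using k c by (intro ennreal_leI) (simp add: field_simps)
    finally show ?thesis .
  qed
  then show ?thesis using that by blast
qed

text \<open>Above a fixed level the tail estimate applies, and below it \<open>|u| powr q\<close> is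
  at most a multiple of \<open>u^2\<close>.\<close>

lemma sobolev_ball_powr_bound:
  assumes s: "0 < s" "s < 1" and R: "R > 0" and q: "2 \<le> q" "q < 6/(3 - 2 * s)"
  obtains C where "C > 0"
    "\<And>u. u \<in> sobolev_ball s R \<Longrightarrow> (\<integral>\<^sup>+ x. ennreal (\<bar>u x\<bar> powr q) \<partial>lborel) \<le> ennreal C"
proof -
  obtain k where k: "\<And>u. u \<in> sobolev_ball s R \<Longrightarrow>
       (\<integral>\<^sup>+ x. ennreal (\<bar>u x\<bar> powr q) * indicator {x. \<bar>u x\<bar> > 2^k} x \<partial>lborel) \<le> ennreal 1"
    using sobolev_ball_uniform_tail[OF s R _ q(2), of 1] q by auto
  define c where "c = (2 ^ k :: real) powr (q - 2)"
  have "(\<integral>\<^sup>+ x. ennreal (\<bar>u x\<bar> powr q) \<partial>lborel) \<le> ennreal (c * R + 1)" if u: "u \<in> sobolev_ball s R" for u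
  proof -
    have [measurable]: "u \<in> borel_measurable borel" using u by (simp add: sobolev_ball_def)
    have "(\<integral>\<^sup>+ x. ennreal (\<bar>u x\<bar> powr q) \<partial>lborel) \<le>
      (\<integral>\<^sup>+ x. ennreal c * ennreal ((u x)^2) + ennreal (\<bar>u x\<bar> powr q) * indicator {x. \<bar>u x\<bar> > 2^k} x \<partial>lborel)"
    proof (intro nn_integral_mono)
      fix x
      show "ennreal (\<bar>u x\<bar> powr q) \<le>
        ennreal c * ennreal ((u x)^2) + ennreal (\<bar>u x\<bar> powr q) * indicator {x. \<bar>u x\<bar> > 2^k} x"
      proof (cases "\<bar>u x\<bar> > 2^k \<or> u x = 0")
        case False
        then have ux: "\<bar>u x\<bar> \<le> 2^k" "\<bar>u x\<bar> > 0" by auto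
        have "\<bar>u x\<bar> powr q = \<bar>u x\<bar> powr (q-2) * \<bar>u x\<bar> powr 2" by (simp only: powr_add[symmetric]) simp
        also have "\<dots> \<le> c * \<bar>u x\<bar> powr 2"
          unfolding c_def using ux q by (intro mult_right_mono powr_mono2) auto
        also have "\<dots> = c * (u x)^2" using ux by simp
        finally have "ennreal (\<bar>u x\<bar> powr q) \<le> ennreal c * ennreal ((u x)^2)"
          by (simp add: c_def ennreal_leI flip: ennreal_mult)
        then show ?thesis using False by simp
      qed auto
    qed
    also have "\<dots> = ennreal c * (\<integral>\<^sup>+ x. ennreal ((u x)^2) \<partial>lborel) +
       (\<integral>\<^sup>+ x. ennreal (\<bar>u x\<bar> powr q) * indicator {x. \<bar>u x\<bar> > 2^k} x \<partial>lborel)"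
      by (simp add: nn_integral_add nn_integral_cmult)
    also have "\<dots> \<le> ennreal c * ennreal R + ennreal 1"
      using u k[OF u] by (intro add_mono mult_left_mono) (auto simp: sobolev_ball_def)
    also have "\<dots> = ennreal (c * R + 1)" using R by (subst ennreal_plus) (auto simp: c_def ennreal_mult)
    finally show ?thesis .
  qed
  moreover have "c * R + 1 > 0" using R by (simp add: c_def add_nonneg_pos)
  ultimately show ?thesis using that by blast
qed

lemma sobolev_ball_integrable:
  assumes s: "0 < s" "s < 1" and R: "R > 0" and q: "2 \<le> q" "q < 6/(3 - 2 * s)"
    and u: "u \<in> sobolev_ball s R"
  shows "integrable lborel (\<lambda>x. \<bar>u x\<bar> powr q)"
proof -
  have [measurable]: "u \<in> borel_measurable borel" using u by (simp add: sobolev_ball_def)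
  obtain C where "(\<integral>\<^sup>+ x. ennreal (\<bar>u x\<bar> powr q) \<partial>lborel) \<le> ennreal C"
    using sobolev_ball_powr_bound[OF s R q] u by metis
  then show ?thesis by (intro integrableI_nonneg) (auto simp: le_less_trans)
qed

text \<open>The uniform tails act as equi-integrability: cutting the functions off at height
  \<open>2^k\<close> changes each integral by at most \<open>e / 4\<close>, and the cut-off
  integrals converge by dominated convergence because \<open>B\<close> has finite measure.\<close>

lemma subcritical_integral_convergence:
  fixes \<Psi> :: "real \<Rightarrow> real" and v :: "nat \<Rightarrow> R3 \<Rightarrow> real"
  assumes s: "0 < s" "s < 1" and R: "R > 0" and q: "2 \<le> q" "q < 6/(3 - 2 * s)"
    and B [measurable]: "B \<in> sets borel" and Bfin: "emeasure lborel B < \<infinity>"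
    and cont: "continuous_on UNIV \<Psi>" and gr: "\<And>t. \<bar>\<Psi> t\<bar> \<le> C * (1 + \<bar>t\<bar> powr q)"
    and v: "\<And>n. v n \<in> sobolev_ball s R" and w: "w \<in> sobolev_ball s R"
    and conv: "AE x in lborel. (\<lambda>n. v n x) \<longlonglongrightarrow> w x"
  shows "(\<lambda>n. LBINT x. indicator B x * \<Psi> (v n x)) \<longlonglongrightarrow> (LBINT x. indicator B x * \<Psi> (w x))"
proof (rule LIMSEQ_I)
  fix e :: real assume e: "e > 0"
  have [measurable]: "\<Psi> \<in> borel_measurable borel" using cont by (rule borel_measurable_continuous_onI)
  have C0: "C \<ge> 0" using gr[of 0] by auto
  define C' where "C' = C + 1"
  have C': "C' > 0" "C \<le> C'" using C0 by (auto simp: C'_def)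
  \<comment> \<open>On the tail the two values of \<open>\<Psi>\<close> differ by at most
    \<open>4 * C' * |u| powr q\<close>, so this tail size yields the error \<open>e / 4\<close>.
    \<open>C'\<close> exceeds \<open>C\<close> in order to be positive.\<close>
  define e' where "e' = e / (16 * C')"
  have e': "e' > 0" using e C' by (simp add: e'_def)
  obtain k where k: "\<And>u. u \<in> sobolev_ball s R \<Longrightarrow>
       (\<integral>\<^sup>+ x. ennreal (\<bar>u x\<bar> powr q) * indicator {x. \<bar>u x\<bar> > 2^k} x \<partial>lborel) \<le> ennreal e'"
    using sobolev_ball_uniform_tail[OF s R _ q(2) e'] q by auto
  define T :: "real \<Rightarrow> real" where "T t = max (-(2^k)) (min (2^k) t)" for t
  have Tcont: "continuous_on UNIV T" unfolding T_def by (intro continuous_intros)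
  have [measurable]: "T \<in> borel_measurable borel" using Tcont by (rule borel_measurable_continuous_onI)
  have intB: "integrable lborel (indicator B :: R3 \<Rightarrow> real)" using Bfin by (simp add: integrable_indicator_iff)
  have k1: "(1::real) \<le> 2^k" by simp
  have intPsi: "integrable lborel (\<lambda>x. indicator B x * \<Psi> (u x))" if u: "u \<in> sobolev_ball s R" for u
  proof (rule Bochner_Integration.integrable_bound)
    show "integrable lborel (\<lambda>x. C * (indicator B x + \<bar>u x\<bar> powr q))"
      using intB sobolev_ball_integrable[OF s R q u] by auto
    have [measurable]: "u \<in> borel_measurable borel" using u by (simp add: sobolev_ball_def)
    show "(\<lambda>x. indicator B x * \<Psi> (u x)) \<in> borel_measurable lborel" by measurable
    show "AE x in lborel. norm (indicator B x * \<Psi> (u x)) \<le> norm (C * (indicator B x + \<bar>u x\<bar> powr q))"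
      using gr C0 by (intro AE_I2) (auto simp: indicator_def abs_mult)
  qed
  define Cb where "Cb = C * (1 + (2^k) powr q)"
  have PsiT: "\<bar>\<Psi> (T t)\<bar> \<le> Cb" for t
  proof -
    have "\<bar>T t\<bar> \<le> 2^k"
      by (cases "t \<le> 2^k"; cases "-(2^k) \<le> t") (use k1 in \<open>auto simp: T_def\<close>)
    then have "\<bar>T t\<bar> powr q \<le> (2^k) powr q" using q by (intro powr_mono2) auto
    then have "C * (1 + \<bar>T t\<bar> powr q) \<le> Cb" unfolding Cb_def using C0 by (intro mult_left_mono) auto
    then show ?thesis using gr[of "T t"] by linarith
  qed
  have Cb0: "Cb \<ge> 0" using PsiT[of 0] by auto
  have intPsiT: "integrable lborel (\<lambda>x. indicator B x * \<Psi> (T (u x)))"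
    if [measurable]: "u \<in> borel_measurable borel" for u
  proof (rule Bochner_Integration.integrable_bound)
    show "integrable lborel (\<lambda>x. Cb * indicator B x)" using intB by auto
    show "(\<lambda>x. indicator B x * \<Psi> (T (u x))) \<in> borel_measurable lborel" by measurable
    show "AE x in lborel. norm (indicator B x * \<Psi> (T (u x))) \<le> norm (Cb * indicator B x)"
      using PsiT Cb0 by (intro AE_I2) (auto simp: indicator_def abs_mult)
  qed
  have trunc: "\<bar>(LBINT x. indicator B x * \<Psi> (u x)) - (LBINT x. indicator B x * \<Psi> (T (u x)))\<bar> \<le> e/4"
    if u: "u \<in> sobolev_ball s R" for u
  proof -
    have um [measurable]: "u \<in> borel_measurable borel" using u by (simp add: sobolev_ball_def)
    let ?t = "\<lambda>x. \<bar>u x\<bar> powr q * indicator {x. \<bar>u x\<bar> > 2^k} x"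
    have "integrable lborel ?t"
      by (rule Bochner_Integration.integrable_bound[OF sobolev_ball_integrable[OF s R q u]])
         (auto intro!: AE_I2 simp: indicator_def)
    have "(\<integral>\<^sup>+ x. ennreal (?t x) \<partial>lborel) = (\<integral>\<^sup>+ x. ennreal (\<bar>u x\<bar> powr q) * indicator {x. \<bar>u x\<bar> > 2^k} x \<partial>lborel)"
      by (intro nn_integral_cong) (auto simp: indicator_def)
    then have tle: "(LBINT x. ?t x) \<le> e'"
      using k[OF u] e' by (subst integral_eq_nn_integral) (auto intro!: enn2real_leI)
    have pw: "norm (indicator B x * \<Psi> (u x) - indicator B x * \<Psi> (T (u x))) \<le> 4 * C' * ?t x" for x
    proof (cases "\<bar>u x\<bar> > 2^k")
      case False
      then have "T (u x) = u x" by (auto simp: T_def)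
      then show ?thesis using False by simp
    next
      case True
      then have Tu: "\<bar>T (u x)\<bar> = 2^k"
        by (cases "u x \<le> 2^k"; cases "-(2^k) \<le> u x") (use k1 in \<open>auto simp: T_def\<close>)
      have u1: "\<bar>u x\<bar> \<ge> 1" using True k1 by linarith
      have one: "1 \<le> \<bar>u x\<bar> powr q" using u1 q by (intro ge_one_powr_ge_zero) auto
      have two: "(2^k) powr q \<le> \<bar>u x\<bar> powr q" using True q by (intro powr_mono2) auto
      have "\<bar>\<Psi> (u x)\<bar> \<le> C * (1 + \<bar>u x\<bar> powr q)" by (rule gr)
      also have "\<dots> \<le> C' * (2 * \<bar>u x\<bar> powr q)" using C' C0 one by (intro mult_mono) auto
      finally have a: "\<bar>\<Psi> (u x)\<bar> \<le> 2 * C' * \<bar>u x\<bar> powr q" by simp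
      have "\<bar>\<Psi> (T (u x))\<bar> \<le> C * (1 + \<bar>T (u x)\<bar> powr q)" by (rule gr)
      also have "\<dots> \<le> C' * (2 * \<bar>u x\<bar> powr q)" using C' C0 one two Tu by (intro mult_mono) auto
      finally have b: "\<bar>\<Psi> (T (u x))\<bar> \<le> 2 * C' * \<bar>u x\<bar> powr q" by simp
      have "norm (indicator B x * \<Psi> (u x) - indicator B x * \<Psi> (T (u x))) \<le> \<bar>\<Psi> (u x)\<bar> + \<bar>\<Psi> (T (u x))\<bar>"
        by (auto simp: indicator_def)
      then show ?thesis using a b True by simp
    qed
    have "norm (LBINT x. indicator B x * \<Psi> (u x) - indicator B x * \<Psi> (T (u x))) \<le> (LBINT x. 4 * C' * ?t x)"
      using \<open>integrable lborel ?t\<close> intPsi[OF u] intPsiT[OF um] pw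
      by (intro Bochner_Integration.integral_norm_bound_integral) auto
    also have "\<dots> = 4 * C' * (LBINT x. ?t x)" by simp
    also have "\<dots> \<le> 4 * C' * e'" using tle C' by (intro mult_left_mono) auto
    also have "\<dots> = e/4" using C' by (simp add: e'_def)
    finally show ?thesis using intPsi[OF u] intPsiT[OF um] by simp
  qed
  have "(\<lambda>n. LBINT x. indicator B x * \<Psi> (T (v n x))) \<longlonglongrightarrow> (LBINT x. indicator B x * \<Psi> (T (w x)))"
  proof (rule integral_dominated_convergence[where w = "\<lambda>x. Cb * indicator B x"])
    have [measurable]: "v n \<in> borel_measurable borel" for n using v by (simp add: sobolev_ball_def)
    have [measurable]: "w \<in> borel_measurable borel" using w by (simp add: sobolev_ball_def)
    show "(\<lambda>x. indicator B x * \<Psi> (T (w x))) \<in> borel_measurable lborel" by measurable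
    show "(\<lambda>x. indicator B x * \<Psi> (T (v n x))) \<in> borel_measurable lborel" for n by measurable
    show "integrable lborel (\<lambda>x. Cb * indicator B x)" using intB by auto
    show "AE x in lborel. norm (indicator B x * \<Psi> (T (v n x))) \<le> Cb * indicator B x" for n
      using PsiT Cb0 by (intro AE_I2) (auto simp: indicator_def abs_mult)
    have "continuous_on UNIV (\<lambda>t. \<Psi> (T t))"
      using continuous_on_compose[OF Tcont continuous_on_subset[OF cont]] by (simp add: o_def)
    then have iC: "isCont (\<lambda>t. \<Psi> (T t)) y" for y by (simp add: continuous_on_eq_continuous_at)
    show "AE x in lborel. (\<lambda>n. indicator B x * \<Psi> (T (v n x))) \<longlonglongrightarrow> indicator B x * \<Psi> (T (w x))"
      using conv by eventually_elim (intro tendsto_mult_left isCont_tendsto_compose[OF iC])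
  qed
  from LIMSEQ_D[OF this, of "e/4"] e
  obtain N where N: "\<forall>n\<ge>N. norm ((LBINT x. indicator B x * \<Psi> (T (v n x))) - (LBINT x. indicator B x * \<Psi> (T (w x)))) < e/4"
    by auto
  show "\<exists>N. \<forall>n\<ge>N. norm ((LBINT x. indicator B x * \<Psi> (v n x)) - (LBINT x. indicator B x * \<Psi> (w x))) < e"
  proof (intro exI[of _ N] allI impI)
    fix n assume "n \<ge> N"
    then have "\<bar>(LBINT x. indicator B x * \<Psi> (T (v n x))) - (LBINT x. indicator B x * \<Psi> (T (w x)))\<bar> < e/4"
      using N by auto
    then show "norm ((LBINT x. indicator B x * \<Psi> (v n x)) - (LBINT x. indicator B x * \<Psi> (w x))) < e"
      using trunc[OF v[of n]] trunc[OF w] e unfolding real_norm_def by argo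
  qed
qed

section \<open>Fatou's lemma along almost everywhere convergence\<close>

lemma nn_integral_fatou_le:
  fixes f :: "'a \<Rightarrow> real" and g :: "nat \<Rightarrow> 'a \<Rightarrow> real"
  assumes [measurable]: "\<And>n. g n \<in> borel_measurable M"
    and conv: "AE x in M. (\<lambda>n. g n x) \<longlonglongrightarrow> f x"
    and le: "\<And>n. (\<integral>\<^sup>+ x. ennreal (g n x) \<partial>M) \<le> ennreal (c n)" and c: "c \<longlonglongrightarrow> d"
  shows "(\<integral>\<^sup>+ x. ennreal (f x) \<partial>M) \<le> ennreal d"
proof -
  have "(\<integral>\<^sup>+ x. ennreal (f x) \<partial>M) = (\<integral>\<^sup>+ x. liminf (\<lambda>n. ennreal (g n x)) \<partial>M)"
  proof (rule nn_integral_cong_AE, use conv in eventually_elim)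
    fix x assume "(\<lambda>n. g n x) \<longlonglongrightarrow> f x"
    then show "ennreal (f x) = liminf (\<lambda>n. ennreal (g n x))"
      using lim_imp_Liminf[OF sequentially_bot tendsto_ennrealI] by metis
  qed
  also have "\<dots> \<le> liminf (\<lambda>n. \<integral>\<^sup>+ x. ennreal (g n x) \<partial>M)" by (rule nn_integral_liminf) auto
  also have "\<dots> \<le> liminf (\<lambda>n. ennreal (c n))" by (intro Liminf_mono always_eventually allI le)
  also have "\<dots> = ennreal d" using c by (intro lim_imp_Liminf tendsto_ennrealI) auto
  finally show ?thesis .
qed

text \<open>The exceptional set need not be measurable, so it is first enclosed in a measurable null
  set \<open>N\<close>; the bad pairs lie in the union of the two strips over
  \<open>N\<close>.\<close>

lemma AE_lborel_pair:
  fixes P :: "R3 \<Rightarrow> bool"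
  assumes "AE x in lborel. P x"
  shows "AE z in lborel \<Otimes>\<^sub>M lborel. P (fst z) \<and> P (snd z)"
proof -
  obtain N where N: "{x \<in> space lborel. \<not> P x} \<subseteq> N" "emeasure lborel N = 0" "N \<in> sets lborel"
    using assms by (rule AE_E)
  have N0: "AE x in lborel. x \<notin> N" using N by (intro AE_not_in) auto
  have [measurable]: "N \<in> sets borel" using N by simp
  have "AE z in lborel \<Otimes>\<^sub>M lborel. fst z \<notin> N \<and> snd z \<notin> N"
  proof (rule lborel_pair.AE_pair_measure)
    show "{z \<in> space (lborel \<Otimes>\<^sub>M lborel). fst z \<notin> N \<and> snd z \<notin> N} \<in> sets (lborel \<Otimes>\<^sub>M lborel)"
      by measurable
    show "AE x in lborel. AE y in lborel. fst (x, y) \<notin> N \<and> snd (x, y) \<notin> N"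
      using N0
    proof eventually_elim
      case (elim x)
      show ?case using N0 by eventually_elim (use elim in auto)
    qed
  qed
  then show ?thesis by eventually_elim (use N in auto)
qed

lemma gagliardo_fatou:
  fixes v :: "nat \<Rightarrow> R3 \<Rightarrow> real"
  assumes [measurable]: "\<And>n. v n \<in> borel_measurable borel"
    and conv: "AE x in lborel. (\<lambda>n. v n x) \<longlonglongrightarrow> w x"
    and le: "\<And>n. gagliardo_ennreal s (v n) \<le> ennreal (c n)" and c: "c \<longlonglongrightarrow> d"
  shows "gagliardo_ennreal s w \<le> ennreal d"
  unfolding gagliardo_ennreal_def
proof (rule nn_integral_fatou_le[OF _ _ _ c])
  show "AE z in lborel \<Otimes>\<^sub>M lborel. (\<lambda>n. (v n (fst z) - v n (snd z))\<^sup>2 / norm (fst z - snd z) powr (3 + 2 * s))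
     \<longlonglongrightarrow> (w (fst z) - w (snd z))\<^sup>2 / norm (fst z - snd z) powr (3 + 2 * s)"
    using AE_lborel_pair[OF conv]
    by eventually_elim (simp only: divide_inverse, intro tendsto_intros, auto)
qed (use le in \<open>auto simp: gagliardo_ennreal_def\<close>)

section \<open>Compactness\<close>

text \<open>A half-open cube of the grid of width \<open>1 / (k + 1)\<close>, named by any of its
  points. Distinct cells of one grid are disjoint, and the cells of all grids together are countable
  in number.\<close>

definition cell :: "nat \<Rightarrow> R3 \<Rightarrow> R3 set" where
  "cell k x = {y. \<forall>i. \<lfloor>real (Suc k) * y $ i\<rfloor> = \<lfloor>real (Suc k) * x $ i\<rfloor>}"

definition cell_mean :: "nat \<Rightarrow> (R3 \<Rightarrow> real) \<Rightarrow> R3 \<Rightarrow> real" where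
  "cell_mean k u x = real (Suc k) ^ 3 * (LBINT y. indicator (cell k x) y * u y)"

lemma cell_pair_measurable: "{z :: R3 \<times> R3. snd z \<in> cell k (fst z)} \<in> sets (borel \<Otimes>\<^sub>M borel)"
proof -
  have nth: "(\<lambda>x :: R3. x $ i) \<in> borel_measurable borel" for i
    by (intro borel_measurable_continuous_onI continuous_intros)
  have [measurable]: "(\<lambda>z :: R3 \<times> R3. fst z $ i) \<in> borel_measurable (borel \<Otimes>\<^sub>M borel)"
     "(\<lambda>z :: R3 \<times> R3. snd z $ i) \<in> borel_measurable (borel \<Otimes>\<^sub>M borel)" for i
    by (rule measurable_compose[OF measurable_fst nth] measurable_compose[OF measurable_snd nth])+
  have "{z \<in> space (borel \<Otimes>\<^sub>M borel). \<forall>i. \<lfloor>real (Suc k) * (snd z :: R3) $ i\<rfloor> = \<lfloor>real (Suc k) * (fst z :: R3) $ i\<rfloor>}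
     \<in> sets (borel \<Otimes>\<^sub>M borel)"
    by measurable
  then show ?thesis by (simp add: cell_def space_pair_measure)
qed

lemma cell_measurable [measurable]: "cell k x \<in> sets borel"
proof -
  have "{y \<in> space borel. \<forall>i. \<lfloor>real (Suc k) * (y :: R3) $ i\<rfloor> = \<lfloor>real (Suc k) * x $ i\<rfloor>} \<in> sets borel"
    by measurable
  then show ?thesis by (simp add: cell_def)
qed

text \<open>The half-open cube lies between the open and the closed box with the same corners, whose
  volumes agree.\<close>

lemma emeasure_cell: "emeasure lborel (cell k x) = ennreal (1 / real (Suc k) ^ 3)"
proof -
  define r where "r = 1 / real (Suc k)"
  have r: "r > 0" "r * real (Suc k) = 1" by (auto simp: r_def)
  define l :: R3 where "l = (\<chi> i. r * of_int \<lfloor>real (Suc k) * x $ i\<rfloor>)"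
  define h :: R3 where "h = l + (\<chi> i. r)"
  have iff: "\<lfloor>real (Suc k) * t\<rfloor> = n \<longleftrightarrow> r * of_int n \<le> t \<and> t < r * of_int n + r" for t n
  proof -
    have "\<lfloor>real (Suc k) * t\<rfloor> = n \<longleftrightarrow> of_int n \<le> real (Suc k) * t \<and> real (Suc k) * t < of_int n + 1"
      by (rule floor_eq_iff)
    also have "\<dots> \<longleftrightarrow> r * of_int n \<le> t \<and> t < r * of_int n + r"
      by (simp add: r_def field_simps)
    finally show ?thesis .
  qed
  have cell_eq: "y \<in> cell k x \<longleftrightarrow> (\<forall>i. l $ i \<le> y $ i \<and> y $ i < h $ i)" for y
    unfolding cell_def mem_Collect_eq iff l_def h_def by simp
  have "(\<Prod>b\<in>(Basis::R3 set). (h - l) \<bullet> b) = (\<Prod>b\<in>(Basis::R3 set). r)"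
    by (intro prod.cong) (auto simp: Basis_vec_def inner_axis h_def)
  then have pr: "(\<Prod>b\<in>(Basis::R3 set). (h - l) \<bullet> b) = r ^ 3" by simp
  have pos: "\<forall>b\<in>Basis. l \<bullet> b \<le> h \<bullet> b" using r by (auto simp: Basis_vec_def inner_axis h_def)
  have "emeasure lborel (cell k x) \<le> emeasure lborel (cbox l h)"
    by (rule emeasure_mono) (auto simp: mem_box_cart cell_eq less_imp_le)
  moreover have "emeasure lborel (box l h) \<le> emeasure lborel (cell k x)"
    by (rule emeasure_mono) (auto simp: mem_box_cart cell_eq less_imp_le)
  ultimately have "emeasure lborel (cell k x) = ennreal (r ^ 3)"
    using pos pr by (simp add: emeasure_lborel_cbox_eq emeasure_lborel_box_eq)
  then show ?thesis by (simp add: r_def power_divide)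
qed

lemma norm_diff_cell_le:
  assumes "y \<in> cell k x"
  shows "norm (x - y) \<le> 2 * (1 / real (Suc k))"
proof (rule norm_le_of_components)
  fix i
  have "\<lfloor>real (Suc k) * y $ i\<rfloor> = \<lfloor>real (Suc k) * x $ i\<rfloor>" using assms by (auto simp: cell_def)
  then have "\<bar>real (Suc k) * x $ i - real (Suc k) * y $ i\<bar> < 1" by linarith
  also have "real (Suc k) * x $ i - real (Suc k) * y $ i = real (Suc k) * (x - y) $ i"
    by (simp add: algebra_simps)
  finally have "real (Suc k) * \<bar>(x - y) $ i\<bar> \<le> 1" unfolding abs_mult by simp
  then show "\<bar>(x - y) $ i\<bar> \<le> 1 / real (Suc k)"
    by (simp add: pos_le_divide_eq mult.commute del: of_nat_Suc)
qed

text \<open>Each cell is determined by \<open>k\<close> and three integers. Countability is what the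
  diagonal choice of a subsequence requires.\<close>

lemma countable_cells: "countable (range (\<lambda>(k, x). cell k x))"
proof (rule countable_subset)
  let ?c = "\<lambda>(k, a, b, c). {y :: R3. \<lfloor>real (Suc k) * y $ 1\<rfloor> = a \<and> \<lfloor>real (Suc k) * y $ 2\<rfloor> = b \<and> \<lfloor>real (Suc k) * y $ 3\<rfloor> = c}"
  show "range (\<lambda>(k, x). cell k x) \<subseteq> range ?c"
  proof
    fix A assume "A \<in> range (\<lambda>(k, x). cell k x)"
    then obtain k x where A: "A = cell k x" by auto
    have "cell k x = ?c (k, \<lfloor>real (Suc k) * x $ 1\<rfloor>, \<lfloor>real (Suc k) * x $ 2\<rfloor>, \<lfloor>real (Suc k) * x $ 3\<rfloor>)"
      by (simp add: cell_def forall_3)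
    then show "A \<in> range ?c" unfolding A by blast
  qed
  show "countable (range ?c)" by simp
qed

lemma abs_le_one_plus_square: "\<bar>t\<bar> \<le> 1 + t\<^sup>2" for t :: real
proof -
  have "0 \<le> (\<bar>t\<bar> - 1)\<^sup>2" by simp
  then have "2 * \<bar>t\<bar> \<le> 1 + t\<^sup>2" by (simp add: power2_diff)
  then show ?thesis by linarith
qed

lemma sobolev_ball_square_integrable:
  assumes u: "u \<in> sobolev_ball s R" and R: "R \<ge> 0"
  shows "integrable lborel (\<lambda>x. (u x)\<^sup>2)" "(LBINT x. (u x)\<^sup>2) \<le> R"
proof -
  have [measurable]: "u \<in> borel_measurable borel" using u by (simp add: sobolev_ball_def)
  have *: "(\<integral>\<^sup>+ x. ennreal ((u x)\<^sup>2) \<partial>lborel) \<le> ennreal R" using u by (simp add: sobolev_ball_def)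
  then show "integrable lborel (\<lambda>x. (u x)\<^sup>2)"
    by (intro integrableI_nonneg) (auto simp: le_less_trans)
  show "(LBINT x. (u x)\<^sup>2) \<le> R"
    using * R by (subst integral_eq_nn_integral) (auto intro!: enn2real_leI)
qed

text \<open>The bound depends neither on the cell nor on \<open>u\<close>, since cells have volume
  at most 1 and \<open>|t| <= 1 + t^2\<close>; this uniformity feeds the diagonal argument.\<close>

lemma cell_integral:
  assumes u: "u \<in> sobolev_ball s R" and R: "R \<ge> 0"
  shows "integrable lborel (\<lambda>y. indicator (cell k x) y * u y)"
    and "\<bar>LBINT y. indicator (cell k x) y * u y\<bar> \<le> 1 + R"
proof -
  have [measurable]: "u \<in> borel_measurable borel" using u by (simp add: sobolev_ball_def)
  have ic: "integrable lborel (indicator (cell k x) :: R3 \<Rightarrow> real)"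
    by (simp add: integrable_indicator_iff emeasure_cell)
  have i2: "integrable lborel (\<lambda>y. indicator (cell k x) y + (u y)\<^sup>2)"
    using ic sobolev_ball_square_integrable[OF u R] by auto
  have pw: "norm (indicator (cell k x) y * u y) \<le> indicator (cell k x) y + (u y)\<^sup>2" for y
    using abs_le_one_plus_square[of "u y"] by (auto simp: indicator_def)
  show int: "integrable lborel (\<lambda>y. indicator (cell k x) y * u y)"
  proof (rule Bochner_Integration.integrable_bound[OF i2])
    show "AE y in lborel. norm (indicator (cell k x) y * u y) \<le> norm (indicator (cell k x) y + (u y)\<^sup>2)"
      using pw by (intro AE_I2) (metis abs_ge_self order_trans real_norm_def)
  qed measurable
  have "norm (LBINT y. indicator (cell k x) y * u y) \<le> (LBINT y. indicator (cell k x) y + (u y)\<^sup>2)"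
    using int i2 pw by (intro Bochner_Integration.integral_norm_bound_integral) auto
  also have "\<dots> = measure lborel (cell k x) + (LBINT y. (u y)\<^sup>2)"
    using ic sobolev_ball_square_integrable[OF u R] by simp
  also have "\<dots> \<le> 1 + R"
  proof -
    have "1 \<le> real (Suc k) ^ 3" by (intro one_le_power) simp
    then have "1 / real (Suc k) ^ 3 \<le> 1" by simp
    then have "measure lborel (cell k x) \<le> 1" by (simp add: measure_def emeasure_cell)
    then show ?thesis using sobolev_ball_square_integrable[OF u R] by simp
  qed
  finally show "\<bar>LBINT y. indicator (cell k x) y * u y\<bar> \<le> 1 + R" by simp
qed

lemma cell_mean_measurable [measurable]:
  assumes [measurable]: "u \<in> borel_measurable borel"
  shows "cell_mean k u \<in> borel_measurable borel"
proof -
  note cell_pair_measurable [measurable]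
  have "(\<lambda>z. indicator {z. snd z \<in> cell k (fst z)} z * u (snd z)) \<in> borel_measurable (borel \<Otimes>\<^sub>M borel)"
    by measurable
  then have "(\<lambda>(x, y). indicator (cell k x) y * u y) \<in> borel_measurable (borel \<Otimes>\<^sub>M lborel)"
    by (auto simp: indicator_def case_prod_beta cong: measurable_cong_sets)
  then have "(\<lambda>x. LBINT y. indicator (cell k x) y * u y) \<in> borel_measurable borel"
    by (rule lborel.borel_measurable_lebesgue_integral)
  then show ?thesis unfolding cell_mean_def[abs_def] by measurable
qed

text \<open>Young's inequality in place of Cauchy-Schwarz keeps the estimate in \<open>L\<^sup>1\<close>.\<close>

lemma weighted_cell_mean_error:
  fixes w :: "R3 \<Rightarrow> real"
  assumes u: "u \<in> sobolev_ball s R" and R: "R \<ge> 0" and s: "s > 0" and \<eta>: "\<eta> > 0"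
    and [measurable]: "w \<in> borel_measurable borel" and w: "\<And>x. 0 \<le> w x" "\<And>x. w x \<le> 1"
    and wint: "integrable lborel w"
  shows "(\<integral>\<^sup>+ x. ennreal (w x * \<bar>u x - cell_mean k u x\<bar>) \<partial>lborel)
    \<le> ennreal (\<eta> * (LBINT x. w x) + 2 powr (3 + 2 * s) * (1 / real (Suc k)) powr (2 * s) / \<eta> * R)"
proof -
  have [measurable]: "u \<in> borel_measurable borel" using u by (simp add: sobolev_ball_def)
  define r where "r = 1 / real (Suc k)"
  define n where "n = real (Suc k) ^ 3"
  \<comment> \<open>Two points of a cell are at distance at most \<open>2 * r\<close>, so with this
    \<open>c\<close> the quantity \<open>(u x - u y)^2 / \<eta>\<close> is at most \<open>c\<close>
    times the Gagliardo integrand.\<close>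
  define c where "c = (2 * r) powr (3 + 2 * s) / \<eta>"
  have r: "r > 0" by (simp add: r_def)
  have n: "n > 0" by (simp add: n_def)
  have c: "c > 0" using r \<eta> by (simp add: c_def)
  have em: "ennreal n * emeasure lborel (cell k x) = 1" for x
    by (simp add: n_def emeasure_cell flip: ennreal_mult)
  let ?\<kappa> = "\<lambda>x y. (u x - u y)\<^sup>2 / norm (x - y) powr (3 + 2 * s)"
  have young: "\<bar>u x - u y\<bar> \<le> \<eta> + c * ?\<kappa> x y" if y: "y \<in> cell k x" for x y
  proof (cases "x = y")
    case False
    have "norm (x - y) powr (3 + 2 * s) \<le> (2 * r) powr (3 + 2 * s)"
      using norm_diff_cell_le[OF y] s by (intro powr_mono2) (auto simp: r_def)
    then have "1 \<le> (2 * r) powr (3 + 2 * s) / norm (x - y) powr (3 + 2 * s)"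
      using False by simp
    then have "(u x - u y)\<^sup>2 / \<eta> * 1 \<le> (u x - u y)\<^sup>2 / \<eta> * ((2 * r) powr (3 + 2 * s) / norm (x - y) powr (3 + 2 * s))"
      using \<eta> by (intro mult_left_mono) auto
    then have 1: "(u x - u y)\<^sup>2 / \<eta> \<le> c * ?\<kappa> x y" by (simp add: c_def mult_ac)
    have "0 \<le> (\<bar>u x - u y\<bar> - \<eta>)\<^sup>2" by simp
    then have "2 * \<eta> * \<bar>u x - u y\<bar> \<le> \<eta> * \<eta> + (u x - u y)\<^sup>2"
      by (simp add: power2_diff power2_eq_square algebra_simps)
    then have "2 * \<bar>u x - u y\<bar> \<le> \<eta> + (u x - u y)\<^sup>2 / \<eta>"
      using \<eta> by (simp add: field_simps)
    then show ?thesis using 1 by (simp add: abs_if split: if_splits)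
  qed (use \<eta> in simp)
  have pw: "ennreal \<bar>u x - cell_mean k u x\<bar> \<le> ennreal \<eta> + ennreal (n * c) * (\<integral>\<^sup>+ y. ennreal (?\<kappa> x y) \<partial>lborel)" for x
  proof -
    have ic: "integrable lborel (\<lambda>y. indicator (cell k x) y * u x)"
      by (intro integrable_mult_left) (simp add: integrable_indicator_iff emeasure_cell)
    have "n * (LBINT y. indicator (cell k x) y * u x) = n * measure lborel (cell k x) * u x" by simp
    also have "\<dots> = u x" using n by (simp add: measure_def emeasure_cell n_def)
    finally have "u x - cell_mean k u x = n * (LBINT y. indicator (cell k x) y * u x - indicator (cell k x) y * u y)"
      using ic cell_integral(1)[OF u R] by (simp add: cell_mean_def n_def algebra_simps)
    then have "ennreal \<bar>u x - cell_mean k u x\<bar> =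
        ennreal n * ennreal (norm (LBINT y. indicator (cell k x) y * u x - indicator (cell k x) y * u y))"
      using n by (simp add: abs_mult ennreal_mult)
    also have "\<dots> \<le> ennreal n * (\<integral>\<^sup>+ y. ennreal (norm (indicator (cell k x) y * u x - indicator (cell k x) y * u y)) \<partial>lborel)"
      using ic cell_integral(1)[OF u R] by (intro mult_left_mono integral_norm_bound_ennreal) auto
    also have "\<dots> \<le> ennreal n * (\<integral>\<^sup>+ y. ennreal \<eta> * indicator (cell k x) y + ennreal c * ennreal (?\<kappa> x y) \<partial>lborel)"
    proof (intro mult_left_mono nn_integral_mono)
      fix y
      show "ennreal (norm (indicator (cell k x) y * u x - indicator (cell k x) y * u y))
        \<le> ennreal \<eta> * indicator (cell k x) y + ennreal c * ennreal (?\<kappa> x y)"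
      proof (cases "y \<in> cell k x")
        case True
        then have "ennreal \<bar>u x - u y\<bar> \<le> ennreal (\<eta> + c * ?\<kappa> x y)" by (intro ennreal_leI young)
        also have "\<dots> = ennreal \<eta> + ennreal c * ennreal (?\<kappa> x y)"
          using \<eta> c by (subst ennreal_plus) (auto simp flip: ennreal_mult)
        finally show ?thesis using True by simp
      qed simp
    qed simp
    also have "\<dots> = ennreal n * (ennreal \<eta> * emeasure lborel (cell k x) + ennreal c * (\<integral>\<^sup>+ y. ennreal (?\<kappa> x y) \<partial>lborel))"
      by (subst nn_integral_add) (auto simp: nn_integral_cmult_indicator nn_integral_cmult)
    also have "\<dots> = ennreal \<eta> * (ennreal n * emeasure lborel (cell k x)) + ennreal (n * c) * (\<integral>\<^sup>+ y. ennreal (?\<kappa> x y) \<partial>lborel)"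
      using n c by (simp add: distrib_left ennreal_mult mult_ac)
    finally show ?thesis by (simp add: em)
  qed
  have "(\<integral>\<^sup>+ x. ennreal (w x * \<bar>u x - cell_mean k u x\<bar>) \<partial>lborel)
    \<le> (\<integral>\<^sup>+ x. ennreal \<eta> * ennreal (w x) + ennreal (n * c) * (\<integral>\<^sup>+ y. ennreal (?\<kappa> x y) \<partial>lborel) \<partial>lborel)"
  proof (intro nn_integral_mono)
    fix x
    have "ennreal (w x * \<bar>u x - cell_mean k u x\<bar>) = ennreal (w x) * ennreal \<bar>u x - cell_mean k u x\<bar>"
      using w by (simp add: ennreal_mult)
    also have "\<dots> \<le> ennreal (w x) * (ennreal \<eta> + ennreal (n * c) * (\<integral>\<^sup>+ y. ennreal (?\<kappa> x y) \<partial>lborel))"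
      by (intro mult_left_mono pw) auto
    also have "\<dots> = ennreal \<eta> * ennreal (w x) + ennreal (w x) * (ennreal (n * c) * (\<integral>\<^sup>+ y. ennreal (?\<kappa> x y) \<partial>lborel))"
      by (simp add: distrib_left mult_ac)
    also have "\<dots> \<le> ennreal \<eta> * ennreal (w x) + 1 * (ennreal (n * c) * (\<integral>\<^sup>+ y. ennreal (?\<kappa> x y) \<partial>lborel))"
      using w by (intro add_left_mono mult_right_mono) (auto simp: ennreal_le_1)
    finally show "ennreal (w x * \<bar>u x - cell_mean k u x\<bar>) \<le> ennreal \<eta> * ennreal (w x) + ennreal (n * c) * (\<integral>\<^sup>+ y. ennreal (?\<kappa> x y) \<partial>lborel)"
      by simp
  qed
  also have "\<dots> = ennreal \<eta> * (\<integral>\<^sup>+ x. ennreal (w x) \<partial>lborel) + ennreal (n * c) * gagliardo_ennreal s u"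
    by (subst gagliardo_ennreal_iterated, simp, subst nn_integral_add)
       (auto simp: nn_integral_cmult lborel.borel_measurable_nn_integral)
  also have "\<dots> \<le> ennreal \<eta> * ennreal (LBINT x. w x) + ennreal (n * c) * ennreal R"
    using u wint w by (intro add_mono mult_left_mono) (auto simp: sobolev_ball_def nn_integral_eq_integral)
  also have "\<dots> = ennreal (\<eta> * (LBINT x. w x) + n * c * R)"
    using \<eta> n c R w by (subst ennreal_plus) (auto simp: ennreal_mult intro!: integral_nonneg)
  \<comment> \<open>A factor \<open>r powr 3\<close> cancels against the normalization of the mean.
    The remaining \<open>r powr (2 * s)\<close> tends to 0 as the grid is refined.\<close>
  also have "n * c = 2 powr (3 + 2 * s) * r powr (2 * s) / \<eta>"
  proof -
    have "(2 * r) powr (3 + 2 * s) = 2 powr (3 + 2 * s) * (r powr 3 * r powr (2 * s))"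
      using r by (simp add: powr_mult powr_add)
    moreover have "n * r powr 3 = 1" using r by (simp add: n_def r_def power_divide)
    ultimately show ?thesis by (simp add: c_def)
  qed
  finally show ?thesis by (simp add: r_def)
qed

text \<open>Cell averages settle convergence at a fixed scale, and the averaging error is small
  uniformly along the sequence. Together they make the sequence Cauchy in a weighted
  \<open>L1\<close> space, so that a further subsequence is Cauchy almost everywhere.\<close>

lemma sobolev_ball_ae_compact:
  fixes v :: "nat \<Rightarrow> R3 \<Rightarrow> real"
  assumes s: "s > 0" and R: "R > 0" and v: "\<And>n. v n \<in> sobolev_ball s R"
  obtains \<rho> w where "strict_mono (\<rho> :: nat \<Rightarrow> nat)" "w \<in> sobolev_ball s R"
    "AE x in lborel. (\<lambda>n. v (\<rho> n) x) \<longlonglongrightarrow> w x"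
proof -
  have R0: "R \<ge> 0" using R by simp
  \<comment> \<open>A positive integrable weight turns the whole space into a finite measure space,
    so that one extraction handles all of it without an exhaustion by balls. Its positivity allows
    dividing it out at the end.\<close>
  obtain \<omega> :: "R3 \<Rightarrow> real" where \<omega>m0: "\<omega> \<in> borel_measurable lborel" and \<omega>pos: "\<And>x. \<omega> x > 0"
    and \<omega>1: "\<And>x. \<omega> x \<le> 1" and \<omega>int: "integrable lborel \<omega>"
    using sigma_finite_measure.obtain_positive_integrable_function[OF sigma_finite_lborel] by blast
  have \<omega>m [measurable]: "\<omega> \<in> borel_measurable borel" using \<omega>m0 by simp
  have \<omega>0: "0 \<le> \<omega> x" for x using \<omega>pos[of x] by simp
  \<comment> \<open>Diagonal choice: one subsequence along which the integrals over all countably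
    many cells converge.\<close>
  obtain \<phi> where \<phi>: "strict_mono \<phi>"
    and lim: "\<And>A. A \<in> range (\<lambda>(k, x). cell k x) \<Longrightarrow> \<exists>l. (\<lambda>n. LBINT y. indicator A y * v (\<phi> n) y) \<longlonglongrightarrow> l"
  proof (rule function_convergent_subsequence[OF countable_cells, of "\<lambda>n A. LBINT y. indicator A y * v n y" "1 + R"])
    fix n A assume "A \<in> range (\<lambda>(k, x). cell k x)"
    then obtain k x where "A = cell k x" by auto
    then show "norm (LBINT y. indicator A y * v n y) \<le> 1 + R"
      using cell_integral(2)[OF v R0] by simp
  qed blast
  define u where "u n = v (\<phi> n)" for n
  have uB: "u n \<in> sobolev_ball s R" for n using v by (simp add: u_def)
  have um [measurable]: "u n \<in> borel_measurable borel" for n by (rule sobolev_ball_measurable[OF uB])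
  define A where "A k x = lim (\<lambda>n. cell_mean k (u n) x)" for k x
  have meanlim: "(\<lambda>n. cell_mean k (u n) x) \<longlonglongrightarrow> A k x" for k x
  proof -
    obtain l where "(\<lambda>n. LBINT y. indicator (cell k x) y * u n y) \<longlonglongrightarrow> l"
      using lim[of "cell k x"] by (auto simp: u_def)
    then have "(\<lambda>n. cell_mean k (u n) x) \<longlonglongrightarrow> real (Suc k) ^ 3 * l"
      unfolding cell_mean_def by (intro tendsto_intros)
    then show ?thesis unfolding A_def by (metis limI)
  qed
  have Am [measurable]: "A k \<in> borel_measurable borel" for k
    unfolding A_def by (rule borel_measurable_lim_metric) auto
  define b where "b k = real (Suc k) ^ 3 * (1 + R)" for k
  have mb: "\<bar>cell_mean k (u n) x\<bar> \<le> b k" for k n x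
    using cell_integral(2)[OF uB R0] by (simp add: cell_mean_def b_def abs_mult mult_left_mono)
  have Ab: "\<bar>A k x\<bar> \<le> b k" for k x
    using tendsto_upperbound[OF tendsto_rabs[OF meanlim] always_eventually] mb by auto
  have b0: "b k \<ge> 0" for k using mb[of k 0 0] by auto
  have meanL1: "(\<lambda>n. LBINT x. \<omega> x * \<bar>cell_mean k (u n) x - A k x\<bar>) \<longlonglongrightarrow> 0" for k
  proof -
    have "(\<lambda>n. LBINT x. \<omega> x * \<bar>cell_mean k (u n) x - A k x\<bar>) \<longlonglongrightarrow> (\<integral>x. 0 \<partial>(lborel :: R3 measure))"
    proof (rule integral_dominated_convergence[where w = "\<lambda>x. 2 * b k * \<omega> x"])
      show "AE x in lborel. (\<lambda>n. \<omega> x * \<bar>cell_mean k (u n) x - A k x\<bar>) \<longlonglongrightarrow> 0"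
      proof (intro AE_I2)
        fix x
        have "(\<lambda>n. \<omega> x * \<bar>cell_mean k (u n) x - A k x\<bar>) \<longlonglongrightarrow> \<omega> x * \<bar>A k x - A k x\<bar>"
          by (intro tendsto_intros meanlim)
        then show "(\<lambda>n. \<omega> x * \<bar>cell_mean k (u n) x - A k x\<bar>) \<longlonglongrightarrow> 0" by simp
      qed
      show "AE x in lborel. norm (\<omega> x * \<bar>cell_mean k (u n) x - A k x\<bar>) \<le> 2 * b k * \<omega> x" for n
      proof (intro AE_I2)
        fix x
        have "\<bar>cell_mean k (u n) x - A k x\<bar> \<le> 2 * b k" using mb[of k n x] Ab[of k x] by linarith
        then have "\<omega> x * \<bar>cell_mean k (u n) x - A k x\<bar> \<le> \<omega> x * (2 * b k)" using \<omega>0 by (intro mult_left_mono)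
        then show "norm (\<omega> x * \<bar>cell_mean k (u n) x - A k x\<bar>) \<le> 2 * b k * \<omega> x"
          using \<omega>0[of x] by (simp add: abs_mult mult_ac)
      qed
    qed (use \<omega>int in auto)
    then show ?thesis by simp
  qed
  have meanInt: "integrable lborel (\<lambda>x. \<omega> x * \<bar>cell_mean k (u n) x - A k x\<bar>)" for k n
  proof (rule Bochner_Integration.integrable_bound[of _ "\<lambda>x. 2 * b k * \<omega> x"])
    show "AE x in lborel. norm (\<omega> x * \<bar>cell_mean k (u n) x - A k x\<bar>) \<le> norm (2 * b k * \<omega> x)"
    proof (intro AE_I2)
      fix x
      have "\<bar>cell_mean k (u n) x - A k x\<bar> \<le> 2 * b k" using mb[of k n x] Ab[of k x] by linarith
      then have "\<omega> x * \<bar>cell_mean k (u n) x - A k x\<bar> \<le> \<omega> x * (2 * b k)" using \<omega>0 by (intro mult_left_mono)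
      then show "norm (\<omega> x * \<bar>cell_mean k (u n) x - A k x\<bar>) \<le> norm (2 * b k * \<omega> x)"
        using \<omega>0[of x] b0[of k] by (simp add: abs_mult mult_ac)
    qed
  qed (use \<omega>int in auto)
  have wuint: "integrable lborel (\<lambda>x. \<omega> x * u n x)" for n
  proof (rule Bochner_Integration.integrable_bound[of _ "\<lambda>x. \<omega> x + (u n x)\<^sup>2"])
    show "integrable lborel (\<lambda>x. \<omega> x + (u n x)\<^sup>2)"
      using \<omega>int sobolev_ball_square_integrable(1)[OF uB R0] by auto
    show "AE x in lborel. norm (\<omega> x * u n x) \<le> norm (\<omega> x + (u n x)\<^sup>2)"
    proof (intro AE_I2)
      fix x
      have "norm (\<omega> x * u n x) \<le> \<omega> x * (1 + (u n x)\<^sup>2)"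
        using \<omega>0[of x] abs_le_one_plus_square[of "u n x"] by (simp add: abs_mult mult_left_mono)
      also have "\<dots> \<le> \<omega> x + 1 * (u n x)\<^sup>2"
        using \<omega>1[of x] mult_right_mono[of "\<omega> x" 1 "(u n x)\<^sup>2"] by (simp add: algebra_simps)
      finally show "norm (\<omega> x * u n x) \<le> norm (\<omega> x + (u n x)\<^sup>2)" by simp
    qed
  qed auto
  have cauchy: "\<exists>N. \<forall>i\<ge>N. \<forall>j\<ge>N. (LBINT x. norm (\<omega> x * u i x - \<omega> x * u j x)) < e" if e: "e > 0" for e
  proof -
    define I0 where "I0 = (LBINT x. \<omega> x)"
    have I0: "I0 \<ge> 0" unfolding I0_def using \<omega>0 by (intro Bochner_Integration.integral_nonneg) auto
    \<comment> \<open>The order of the choices matters: \<open>\<eta>\<close> depends on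
      \<open>e\<close> and the weight only, then \<open>k\<close> is taken large for this
      \<open>\<eta>\<close>, then \<open>N\<close> for this \<open>k\<close>. The four errors add up
      to at most \<open>e / 4 + e / 8 + e / 4 + e / 8 < e\<close>.\<close>
    define \<eta> where "\<eta> = e / (8 * (I0 + 1))"
    have \<eta>: "\<eta> > 0" using e I0 by (simp add: \<eta>_def)
    have \<eta>I: "\<eta> * I0 \<le> e/8" using e I0 by (simp add: \<eta>_def field_simps)
    have "(\<lambda>k. 2 powr (3 + 2 * s) * (1 / real (Suc k)) powr (2 * s) / \<eta> * R) \<longlonglongrightarrow> 2 powr (3 + 2 * s) * (0 powr (2 * s)) / \<eta> * R"
      using s LIMSEQ_inverse_real_of_nat \<eta>
      by (intro tendsto_intros tendsto_powr2) (auto simp: inverse_eq_divide)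
    then have "(\<lambda>k. 2 powr (3 + 2 * s) * (1 / real (Suc k)) powr (2 * s) / \<eta> * R) \<longlonglongrightarrow> 0" by simp
    from LIMSEQ_D[OF this, of "e/8"] e obtain k
      where "norm (2 powr (3 + 2 * s) * (1 / real (Suc k)) powr (2 * s) / \<eta> * R - 0) < e/8" by auto
    then have k: "2 powr (3 + 2 * s) * (1 / real (Suc k)) powr (2 * s) / \<eta> * R \<le> e/8" unfolding real_norm_def by linarith
    have nnerr: "(\<integral>\<^sup>+ x. ennreal (\<omega> x * \<bar>u n x - cell_mean k (u n) x\<bar>) \<partial>lborel) \<le> ennreal (e/4)" for n
    proof -
      have "(\<integral>\<^sup>+ x. ennreal (\<omega> x * \<bar>u n x - cell_mean k (u n) x\<bar>) \<partial>lborel)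
         \<le> ennreal (\<eta> * I0 + 2 powr (3 + 2 * s) * (1 / real (Suc k)) powr (2 * s) / \<eta> * R)"
        unfolding I0_def by (rule weighted_cell_mean_error[OF uB R0 s \<eta> \<omega>m \<omega>0 \<omega>1 \<omega>int])
      also have "\<dots> \<le> ennreal (e/4)" using \<eta>I k by (intro ennreal_leI) linarith
      finally show ?thesis .
    qed
    have errint: "integrable lborel (\<lambda>x. \<omega> x * \<bar>u n x - cell_mean k (u n) x\<bar>)" for n
      using nnerr[of n] \<omega>0 by (intro integrableI_nonneg) (auto simp: le_less_trans)
    have err: "(LBINT x. \<omega> x * \<bar>u n x - cell_mean k (u n) x\<bar>) \<le> e/4" for n
    proof -
      have "(LBINT x. \<omega> x * \<bar>u n x - cell_mean k (u n) x\<bar>)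
         = enn2real (\<integral>\<^sup>+ x. ennreal (\<omega> x * \<bar>u n x - cell_mean k (u n) x\<bar>) \<partial>lborel)"
        using \<omega>0 by (intro integral_eq_nn_integral) auto
      also have "\<dots> \<le> e/4" using nnerr[of n] e by (intro enn2real_leI) auto
      finally show ?thesis .
    qed
    from LIMSEQ_D[OF meanL1[of k], of "e/8"] e obtain N
      where "\<forall>n\<ge>N. norm ((LBINT x. \<omega> x * \<bar>cell_mean k (u n) x - A k x\<bar>) - 0) < e/8" by auto
    then have N: "(LBINT x. \<omega> x * \<bar>cell_mean k (u n) x - A k x\<bar>) < e/8" if "n \<ge> N" for n
      using that by (auto simp: abs_less_iff)
    show ?thesis
    proof (intro exI[of _ N] allI impI)
      fix i j assume ij: "i \<ge> N" "j \<ge> N"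
      let ?E = "\<lambda>n x. \<omega> x * \<bar>u n x - cell_mean k (u n) x\<bar>"
      let ?M = "\<lambda>n x. \<omega> x * \<bar>cell_mean k (u n) x - A k x\<bar>"
      have "(LBINT x. norm (\<omega> x * u i x - \<omega> x * u j x)) \<le> (LBINT x. (?E i x + ?M i x) + (?E j x + ?M j x))"
      proof (rule Bochner_Integration.integral_mono)
        fix x
        have "\<bar>u i x - u j x\<bar> \<le> (\<bar>u i x - cell_mean k (u i) x\<bar> + \<bar>cell_mean k (u i) x - A k x\<bar>)
            + (\<bar>u j x - cell_mean k (u j) x\<bar> + \<bar>cell_mean k (u j) x - A k x\<bar>)" by linarith
        from mult_left_mono[OF this \<omega>0[of x]]
        show "norm (\<omega> x * u i x - \<omega> x * u j x) \<le> (?E i x + ?M i x) + (?E j x + ?M j x)"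
          using \<omega>0[of x] by (simp add: abs_mult distrib_left flip: right_diff_distrib)
      qed (use wuint errint meanInt in auto)
      also have "\<dots> = ((LBINT x. ?E i x) + (LBINT x. ?M i x)) + ((LBINT x. ?E j x) + (LBINT x. ?M j x))"
        using errint meanInt by simp
      also have "\<dots> < e" using e err[of i] err[of j] N[OF ij(1)] N[OF ij(2)] by linarith
      finally show "(LBINT x. norm (\<omega> x * u i x - \<omega> x * u j x)) < e" .
    qed
  qed
  obtain r where r: "strict_mono r" and ae: "AE x in lborel. Cauchy (\<lambda>i. \<omega> x * u (r i) x)"
    using cauchy_L1_AE_cauchy_subseq[OF wuint cauchy] by blast
  define w where "w x = lim (\<lambda>i. u (r i) x)" for x
  have wm: "w \<in> borel_measurable borel" unfolding w_def by (rule borel_measurable_lim_metric) auto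
  have conv: "AE x in lborel. (\<lambda>n. u (r n) x) \<longlonglongrightarrow> w x"
    using ae
  proof eventually_elim
    fix x assume "Cauchy (\<lambda>i. \<omega> x * u (r i) x)"
    then obtain l where "(\<lambda>i. \<omega> x * u (r i) x) \<longlonglongrightarrow> l" using Cauchy_convergent convergent_def by blast
    then have "(\<lambda>i. (1 / \<omega> x) * (\<omega> x * u (r i) x)) \<longlonglongrightarrow> (1 / \<omega> x) * l" by (intro tendsto_intros)
    then have "(\<lambda>i. u (r i) x) \<longlonglongrightarrow> l / \<omega> x" using \<omega>pos[of x] by simp
    then show "(\<lambda>n. u (r n) x) \<longlonglongrightarrow> w x" unfolding w_def by (metis limI)
  qed
  have "gagliardo_ennreal s w \<le> ennreal R"
    using uB by (intro gagliardo_fatou[OF _ conv, of s "\<lambda>_. R"]) (auto simp: sobolev_ball_def)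
  moreover have "(\<integral>\<^sup>+ x. ennreal ((w x)\<^sup>2) \<partial>lborel) \<le> ennreal R"
  proof (rule nn_integral_fatou_le[of "\<lambda>n x. (u (r n) x)\<^sup>2" _ _ "\<lambda>_. R"])
    show "AE x in lborel. (\<lambda>n. (u (r n) x)\<^sup>2) \<longlonglongrightarrow> (w x)\<^sup>2"
      using conv by eventually_elim (intro tendsto_intros)
    show "(\<integral>\<^sup>+ x. ennreal ((u (r n) x)\<^sup>2) \<partial>lborel) \<le> ennreal R" for n
      using uB[of "r n"] by (simp add: sobolev_ball_def)
  qed auto
  ultimately have "w \<in> sobolev_ball s R" using wm by (simp add: sobolev_ball_def)
  moreover have "AE x in lborel. (\<lambda>n. v ((\<phi> \<circ> r) n) x) \<longlonglongrightarrow> w x" using conv by (simp add: u_def)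
  moreover have "strict_mono (\<phi> \<circ> r)" using \<phi> r by (rule strict_mono_o)
  ultimately show ?thesis using that by blast
qed

section \<open>A test function\<close>

lemma emeasure_norm_le:
  fixes x :: R3
  assumes "r \<ge> 0"
  shows "emeasure lborel {y. norm (x - y) \<le> r} \<le> ennreal ((2 * r) ^ 3)"
proof -
  have "emeasure lborel {y. norm (x - y) \<le> r} \<le> emeasure lborel (cbox (x - (\<chi> i. r)) (x + (\<chi> i. r)))"
  proof (rule emeasure_mono)
    show "{y. norm (x - y) \<le> r} \<subseteq> cbox (x - (\<chi> i. r)) (x + (\<chi> i. r))"
    proof clarify
      fix y assume "norm (x - y) \<le> r"
      then have "\<bar>(x - y) $ i\<bar> \<le> r" for i using component_le_norm_cart order_trans by blast
      then have "\<bar>x $ i - y $ i\<bar> \<le> r" for i by simp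
      then show "y \<in> cbox (x - (\<chi> i. r)) (x + (\<chi> i. r))"
        unfolding mem_box_cart by (auto simp: abs_le_iff algebra_simps)
    qed
  qed simp
  then show ?thesis using emeasure_cube[OF assms] by simp
qed

text \<open>The constant is \<open>64 = (2 * 2)^3\<close>: the radii in use are
  \<open>2 * 2 powr (-j)\<close> and \<open>2 * 2 powr j\<close>, and the remaining powers of 2 go
  into \<open>y ^ j\<close>.\<close>

lemma nn_integral_shells_le:
  fixes x :: R3
  assumes y: "0 < y" "y < 1" and r: "\<And>j. r j \<ge> 0" and c: "\<And>j. c j \<ge> 0"
    and le: "\<And>j. c j * (2 * r j) ^ 3 \<le> 64 * y ^ j"
  shows "(\<integral>\<^sup>+ z. (\<Sum>j. ennreal (c j) * indicator {z. norm (x - z) \<le> r j} z) \<partial>lborel) \<le> ennreal (64 / (1 - y))"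
proof -
  have "(\<integral>\<^sup>+ z. (\<Sum>j. ennreal (c j) * indicator {z. norm (x - z) \<le> r j} z) \<partial>lborel)
     = (\<Sum>j. ennreal (c j) * emeasure lborel {z. norm (x - z) \<le> r j})"
    by (subst nn_integral_suminf) (auto simp: nn_integral_cmult_indicator)
  also have "\<dots> \<le> (\<Sum>j. ennreal (64 * y ^ j))"
  proof (intro suminf_le summableI)
    fix j
    have "ennreal (c j) * emeasure lborel {z. norm (x - z) \<le> r j} \<le> ennreal (c j) * ennreal ((2 * r j) ^ 3)"
      by (intro mult_left_mono emeasure_norm_le r) auto
    also have "\<dots> = ennreal (c j * (2 * r j) ^ 3)" using c r by (simp add: ennreal_mult)
    also have "\<dots> \<le> ennreal (64 * y ^ j)" by (intro ennreal_leI le)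
    finally show "ennreal (c j) * emeasure lborel {z. norm (x - z) \<le> r j} \<le> ennreal (64 * y ^ j)" .
  qed
  also have "\<dots> = ennreal (64 / (1 - y))"
  proof -
    have "(\<lambda>j. 64 * y ^ j) sums (64 * (1 / (1 - y)))" using y by (intro sums_mult geometric_sums) auto
    then show ?thesis using y by (subst suminf_ennreal_eq) auto
  qed
  finally show ?thesis .
qed

text \<open>Dyadic shells around \<open>x\<close>, with \<open>h\<close> the distance: near
  \<open>x\<close> the integrand is \<open>1 / h powr (1 + 2 * s)\<close>, summable because
  \<open>s < 1\<close>; far away it is \<open>1 / h powr (3 + 2 * s)\<close>, summable because
  \<open>s > 0\<close>. The ratios of the two series are \<open>y1\<close> and
  \<open>y2\<close>.\<close>

lemma truncated_kernel_bound:
  assumes s: "0 < s" "s < 1"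
  obtains C where "C \<ge> 0" "\<And>x :: R3. (\<integral>\<^sup>+ z. ennreal (min 1 ((norm (x - z))\<^sup>2) / norm (x - z) powr (3 + 2 * s)) \<partial>lborel) \<le> ennreal C"
proof -
  define y1 where "y1 = 2 powr (2 * s - 2)"
  define y2 where "y2 = 2 powr (- (2 * s))"
  have y1: "0 < y1" "y1 < 1" using s powr_less_mono[of "2 * s - 2" 0 2] by (auto simp: y1_def)
  have y2: "0 < y2" "y2 < 1" using s powr_less_mono[of "- (2 * s)" 0 2] by (auto simp: y2_def)
  define c1 r1 c2 r2 where "c1 j = 2 powr (real j * (1 + 2 * s))" and "r1 j = 2 * 2 powr (- real j)"
    and "c2 j = 2 powr (- real j * (3 + 2 * s))" and "r2 j = 2 * 2 powr (real j)" for j :: nat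
  have le1: "c1 j * (2 * r1 j) ^ 3 \<le> 64 * y1 ^ j" for j
  proof -
    have "(2 * r1 j) ^ 3 = 64 * 2 powr (- 3 * real j)"
      by (simp add: r1_def power_mult_distrib powr_power mult_ac)
    then have "c1 j * (2 * r1 j) ^ 3 = 64 * (2 powr (real j * (1 + 2 * s)) * 2 powr (- 3 * real j))"
      by (simp add: c1_def)
    also have "2 powr (real j * (1 + 2 * s)) * 2 powr (- 3 * real j) = y1 ^ j"
      by (simp add: y1_def powr_power powr_add[symmetric] algebra_simps)
    finally show ?thesis by simp
  qed
  have le2: "c2 j * (2 * r2 j) ^ 3 \<le> 64 * y2 ^ j" for j
  proof -
    have "(2 * r2 j) ^ 3 = 64 * 2 powr (3 * real j)"
      by (simp add: r2_def power_mult_distrib powr_power mult_ac)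
    then have "c2 j * (2 * r2 j) ^ 3 = 64 * (2 powr (- real j * (3 + 2 * s)) * 2 powr (3 * real j))"
      by (simp add: c2_def)
    also have "2 powr (- real j * (3 + 2 * s)) * 2 powr (3 * real j) = y2 ^ j"
      by (simp add: y2_def powr_power powr_add[symmetric] algebra_simps)
    finally show ?thesis by simp
  qed
  have "(\<integral>\<^sup>+ z. ennreal (min 1 ((norm (x - z))\<^sup>2) / norm (x - z) powr (3 + 2 * s)) \<partial>lborel)
      \<le> ennreal (64 / (1 - y1) + 64 / (1 - y2))" for x :: R3
  proof -
    let ?f1 = "\<lambda>z j. ennreal (c1 j) * indicator {z. norm (x - z) \<le> r1 j} z"
    let ?f2 = "\<lambda>z j. ennreal (c2 j) * indicator {z. norm (x - z) \<le> r2 j} z"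
    have "(\<integral>\<^sup>+ z. ennreal (min 1 ((norm (x - z))\<^sup>2) / norm (x - z) powr (3 + 2 * s)) \<partial>lborel)
      \<le> (\<integral>\<^sup>+ z. (\<Sum>j. ?f1 z j) + (\<Sum>j. ?f2 z j) \<partial>lborel)"
    proof (intro nn_integral_mono)
      fix z :: R3
      define h where "h = norm (x - z)"
      consider "h = 0" | "0 < h" "h \<le> 1" | "1 < h" using norm_ge_zero[of "x - z"] unfolding h_def by linarith
      then have "ennreal (min 1 (h\<^sup>2) / h powr (3 + 2 * s)) \<le> (\<Sum>j. ?f1 z j) + (\<Sum>j. ?f2 z j)"
      proof cases
        case 2
        \<comment> \<open>The dyadic level of \<open>2 / h\<close> is used since
          \<open>1 / h\<close> fails to exceed 1 strictly when \<open>h = 1\<close>.\<close>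
        have "2 / h > 2 ^ 0" using 2 by simp
        then obtain j where j: "2 ^ (j + 0) < 2 / h" "2 / h \<le> 2 ^ (j + 0 + 1)" using ex_dyadic_level by blast
        have hj: "h \<le> r1 j"
          using j(1) 2 by (simp add: r1_def powr_minus powr_realpow field_simps)
        have hi: "1 / h \<le> 2 powr real j" using j(2) 2 by (simp add: powr_realpow field_simps)
        have "h\<^sup>2 \<le> 1" using 2 by (simp add: power_le_one)
        then have "min 1 (h\<^sup>2) / h powr (3 + 2 * s) = h powr 2 / h powr (3 + 2 * s)" using 2 by simp
        also have "\<dots> = h powr (2 - (3 + 2 * s))" by (simp only: powr_diff)
        also have "2 - (3 + 2 * s) = - (1 + 2 * s)" by simp
        also have "h powr (- (1 + 2 * s)) = (1 / h) powr (1 + 2 * s)"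
          using 2 by (simp only: powr_minus) (simp add: powr_divide inverse_eq_divide)
        also have "\<dots> \<le> (2 powr real j) powr (1 + 2 * s)" using hi 2 s by (intro powr_mono2) auto
        also have "\<dots> = c1 j" by (simp add: c1_def powr_powr)
        finally have "ennreal (min 1 (h\<^sup>2) / h powr (3 + 2 * s)) \<le> ?f1 z j"
          using hj by (simp add: h_def ennreal_leI)
        also have "\<dots> \<le> (\<Sum>j. ?f1 z j)" by (rule suminf_term)
        finally show ?thesis by (simp add: add_increasing2)
      next
        case 3
        then obtain j where j: "2 ^ (j + 0) < h" "h \<le> 2 ^ (j + 0 + 1)" using ex_dyadic_level[of 0 h] by auto
        have hj: "h \<le> r2 j" using j(2) by (simp add: r2_def powr_realpow)
        have "min 1 (h\<^sup>2) / h powr (3 + 2 * s) \<le> 1 / h powr (3 + 2 * s)"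
          by (intro divide_right_mono) auto
        also have "\<dots> \<le> 1 / (2 powr real j) powr (3 + 2 * s)"
          using j(1) 3 s by (intro divide_left_mono powr_mono2 mult_pos_pos) (auto simp: powr_realpow)
        also have "\<dots> = c2 j" by (simp add: c2_def powr_powr powr_minus_divide)
        finally have "ennreal (min 1 (h\<^sup>2) / h powr (3 + 2 * s)) \<le> ?f2 z j"
          using hj by (simp add: h_def ennreal_leI)
        also have "\<dots> \<le> (\<Sum>j. ?f2 z j)" by (rule suminf_term)
        finally show ?thesis by (simp add: add_increasing)
      qed simp
      then show "ennreal (min 1 ((norm (x - z))\<^sup>2) / norm (x - z) powr (3 + 2 * s)) \<le> (\<Sum>j. ?f1 z j) + (\<Sum>j. ?f2 z j)"
        by (simp add: h_def)
    qed
    also have "\<dots> = (\<integral>\<^sup>+ z. (\<Sum>j. ?f1 z j) \<partial>lborel) + (\<integral>\<^sup>+ z. (\<Sum>j. ?f2 z j) \<partial>lborel)"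
      by (intro nn_integral_add) auto
    also have "\<dots> \<le> ennreal (64 / (1 - y1)) + ennreal (64 / (1 - y2))"
      by (intro add_mono nn_integral_shells_le y1 y2 le1 le2) (auto simp: c1_def c2_def r1_def r2_def)
    also have "\<dots> = ennreal (64 / (1 - y1) + 64 / (1 - y2))" using y1 y2 by (subst ennreal_plus) auto
    finally show ?thesis .
  qed
  then show ?thesis using that[of "64 / (1 - y1) + 64 / (1 - y2)"] y1 y2 by auto
qed

text \<open>The bump is 1-Lipschitz with values in \<open>[0, 1]\<close>, so its squared differences
  are bounded by the numerator of the truncated kernel. They vanish unless one of the two points
  lies in the unit ball \<open>S\<close>, and by symmetry of the kernel both cases have the same
  bound.\<close>

lemma gagliardo_bump_finite:
  fixes x0 :: R3
  assumes s: "0 < s" "s < 1"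
  shows "gagliardo_ennreal s (\<lambda>x. max 0 (1 - norm (x - x0))) < \<infinity>"
proof -
  define u where "u = (\<lambda>x. max 0 (1 - norm (x - x0)))"
  define S where "S = cball x0 1"
  have [measurable]: "u \<in> borel_measurable borel" "S \<in> sets borel" unfolding u_def S_def by auto
  obtain C where C: "C \<ge> 0" "\<And>x :: R3. (\<integral>\<^sup>+ z. ennreal (min 1 ((norm (x - z))\<^sup>2) / norm (x - z) powr (3 + 2 * s)) \<partial>lborel) \<le> ennreal C"
    using truncated_kernel_bound[OF s] by blast
  let ?k = "\<lambda>x z :: R3. ennreal (min 1 ((norm (x - z))\<^sup>2) / norm (x - z) powr (3 + 2 * s))"
  have pw: "(u x - u z)\<^sup>2 \<le> min 1 ((norm (x - z))\<^sup>2)" for x z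
  proof -
    have "\<bar>u x - u z\<bar> \<le> \<bar>norm (x - x0) - norm (z - x0)\<bar>" unfolding u_def by linarith
    also have "\<dots> \<le> norm (x - z)" using norm_triangle_ineq3[of "x - x0" "z - x0"] by simp
    finally have "(u x - u z)\<^sup>2 \<le> (norm (x - z))\<^sup>2" by (simp add: abs_le_square_iff[symmetric])
    moreover have "\<bar>u x - u z\<bar> \<le> 1" using norm_ge_zero[of "x - x0"] norm_ge_zero[of "z - x0"]
      unfolding u_def by linarith
    then have "(u x - u z)\<^sup>2 \<le> 1" by (simp add: abs_square_le_1)
    ultimately show ?thesis by simp
  qed
  have supp: "u x = 0" if "x \<notin> S" for x using that by (simp add: u_def S_def dist_norm norm_minus_commute)
  have Sfin: "emeasure lborel S < \<infinity>" unfolding S_def by (rule emeasure_lborel_cball_finite)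
  have a: "(\<integral>\<^sup>+ x. \<integral>\<^sup>+ z. indicator S x * ?k x z \<partial>lborel \<partial>lborel) \<le> ennreal C * emeasure lborel S"
  proof -
    have "(\<integral>\<^sup>+ x. \<integral>\<^sup>+ z. indicator S x * ?k x z \<partial>lborel \<partial>lborel) = (\<integral>\<^sup>+ x. indicator S x * (\<integral>\<^sup>+ z. ?k x z \<partial>lborel) \<partial>lborel)"
      by (intro nn_integral_cong nn_integral_cmult) auto
    also have "\<dots> \<le> (\<integral>\<^sup>+ x. ennreal C * indicator S x \<partial>lborel)"
      using C(2) by (intro nn_integral_mono) (auto simp: indicator_def)
    also have "\<dots> = ennreal C * emeasure lborel S" by (simp add: nn_integral_cmult_indicator)
    finally show ?thesis .
  qed
  have b: "(\<integral>\<^sup>+ x. \<integral>\<^sup>+ z. indicator S z * ?k x z \<partial>lborel \<partial>lborel) \<le> ennreal C * emeasure lborel S"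
  proof -
    have "(\<integral>\<^sup>+ x. \<integral>\<^sup>+ z. indicator S z * ?k x z \<partial>lborel \<partial>lborel) = (\<integral>\<^sup>+ z. \<integral>\<^sup>+ x. indicator S z * ?k x z \<partial>lborel \<partial>lborel)"
      by (rule lborel_pair.Fubini') measurable
    also have "\<dots> = (\<integral>\<^sup>+ x. \<integral>\<^sup>+ z. indicator S x * ?k x z \<partial>lborel \<partial>lborel)"
      by (simp add: norm_minus_commute)
    finally show ?thesis using a by simp
  qed
  have "gagliardo_ennreal s u \<le> (\<integral>\<^sup>+ x. \<integral>\<^sup>+ z. indicator S x * ?k x z + indicator S z * ?k x z \<partial>lborel \<partial>lborel)"
    unfolding gagliardo_ennreal_iterated[OF \<open>u \<in> borel_measurable borel\<close>]
  proof (intro nn_integral_mono)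
    fix x z
    show "ennreal ((u x - u z)\<^sup>2 / norm (x - z) powr (3 + 2 * s)) \<le> indicator S x * ?k x z + indicator S z * ?k x z"
    proof (cases "x \<in> S \<or> z \<in> S")
      case True
      have "ennreal ((u x - u z)\<^sup>2 / norm (x - z) powr (3 + 2 * s)) \<le> ?k x z"
        using pw by (intro ennreal_leI divide_right_mono) auto
      then show ?thesis using True by (auto simp: indicator_def add_increasing add_increasing2)
    next
      case False
      then show ?thesis using supp[of x] supp[of z] by simp
    qed
  qed
  also have "\<dots> = (\<integral>\<^sup>+ x. \<integral>\<^sup>+ z. indicator S x * ?k x z \<partial>lborel \<partial>lborel) + (\<integral>\<^sup>+ x. \<integral>\<^sup>+ z. indicator S z * ?k x z \<partial>lborel \<partial>lborel)"
    by (subst nn_integral_add[symmetric]) (auto intro!: nn_integral_cong nn_integral_add)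
  also have "\<dots> \<le> ennreal C * emeasure lborel S + ennreal C * emeasure lborel S" using a b by (rule add_mono)
  also have "\<dots> < \<infinity>" using Sfin by (simp add: ennreal_mult_less_top)
  finally show ?thesis by (simp add: u_def)
qed

section \<open>The weighted fractional space\<close>

definition frac_kernel :: "real \<Rightarrow> R3 \<times> R3 \<Rightarrow> real" where
  "frac_kernel s z = inverse (norm (fst z - snd z) powr (3 + 2 * s))"

lemma frac_kernel_nonneg: "frac_kernel s z \<ge> 0"
  by (simp add: frac_kernel_def)

lemma frac_kernel_measurable [measurable]: "frac_kernel s \<in> borel_measurable (lborel \<Otimes>\<^sub>M lborel)"
  unfolding frac_kernel_def[abs_def] by measurable

lemma gagliardo_ennreal_eq:
  "gagliardo_ennreal s u = (\<integral>\<^sup>+ z. ennreal (frac_kernel s z * (u (fst z) - u (snd z))\<^sup>2) \<partial>(lborel \<Otimes>\<^sub>M lborel))"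
  by (simp add: gagliardo_ennreal_def frac_kernel_def divide_inverse mult.commute)

text \<open>\<open>2 |f g| <= f^2 + g^2\<close> takes the place of the Cauchy-Schwarz inequality.
  With weight \<open>frac_kernel\<close> on pairs and weight \<open>W\<close> on points it makes
  both parts of \<open>inner_eps\<close> finite.\<close>

lemma integrable_weighted_product:
  fixes k f g :: "'a \<Rightarrow> real"
  assumes [measurable]: "k \<in> borel_measurable M" "f \<in> borel_measurable M" "g \<in> borel_measurable M"
    and k: "\<And>x. k x \<ge> 0"
    and f: "integrable M (\<lambda>x. k x * (f x)\<^sup>2)" and g: "integrable M (\<lambda>x. k x * (g x)\<^sup>2)"
  shows "integrable M (\<lambda>x. k x * f x * g x)"
proof (rule Bochner_Integration.integrable_bound)
  show "integrable M (\<lambda>x. k x * (f x)\<^sup>2 + k x * (g x)\<^sup>2)" using f g by auto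
  show "AE x in M. norm (k x * f x * g x) \<le> norm (k x * (f x)\<^sup>2 + k x * (g x)\<^sup>2)"
  proof (intro AE_I2)
    fix x
    have "0 \<le> (\<bar>f x\<bar> - \<bar>g x\<bar>)\<^sup>2" by simp
    then have "2 * (\<bar>f x\<bar> * \<bar>g x\<bar>) \<le> (f x)\<^sup>2 + (g x)\<^sup>2" by (simp add: power2_diff mult.assoc)
    moreover have "0 \<le> \<bar>f x\<bar> * \<bar>g x\<bar>" by simp
    ultimately have "\<bar>f x\<bar> * \<bar>g x\<bar> \<le> (f x)\<^sup>2 + (g x)\<^sup>2" by linarith
    from mult_left_mono[OF this k[of x]] show "norm (k x * f x * g x) \<le> norm (k x * (f x)\<^sup>2 + k x * (g x)\<^sup>2)"
      using k[of x] by (simp add: abs_mult distrib_left mult.assoc)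
  qed
qed measurable

locale weighted_space =
  fixes s :: real and V :: "R3 \<Rightarrow> real" and \<epsilon> V0 :: real
  assumes s0: "0 < s" and s1: "s < 1" and V_continuous: "continuous_on UNIV V"
    and V0: "V0 > 0" and V_ge: "V0 \<le> V x"
begin

abbreviation "W x \<equiv> V (\<epsilon> *\<^sub>R x)"
abbreviation "H \<equiv> H_eps s V \<epsilon>"
abbreviation "N \<equiv> norm_eps_sq s V \<epsilon>"

definition pot :: "(R3 \<Rightarrow> real) \<Rightarrow> real" where
  "pot u = enn2real (pot_ennreal V \<epsilon> u)"

text \<open>The symmetric bilinear form behind \<open>N\<close>; the energy has to be differentiated
  in directions \<open>v\<close> and expanded on planes spanned by two functions.\<close>

definition inner_eps :: "(R3 \<Rightarrow> real) \<Rightarrow> (R3 \<Rightarrow> real) \<Rightarrow> real" where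
  "inner_eps u v = (\<integral>z. frac_kernel s z * (u (fst z) - u (snd z)) * (v (fst z) - v (snd z)) \<partial>(lborel \<Otimes>\<^sub>M lborel))
     + (LBINT x. W x * u x * v x)"

lemma W_pos: "W x > 0" using V0 V_ge[of "\<epsilon> *\<^sub>R x"] by linarith

lemma W_nonneg: "0 \<le> W x" using W_pos[of x] by simp

lemma W_continuous: "continuous_on UNIV (\<lambda>x. W x)"
proof -
  have "continuous_on UNIV (\<lambda>x :: R3. \<epsilon> *\<^sub>R x)" by (intro continuous_intros)
  from continuous_on_compose2[OF V_continuous this] show ?thesis by simp
qed

lemma W_measurable [measurable]: "(\<lambda>x. W x) \<in> borel_measurable borel"
  using W_continuous by (rule borel_measurable_continuous_onI)

lemma square_integrable_of_pot:
  assumes [measurable]: "u \<in> borel_measurable borel" and "integrable lborel (\<lambda>x. W x * (u x)\<^sup>2)"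
  shows "integrable lborel (\<lambda>x. (u x)\<^sup>2)"
proof (rule Bochner_Integration.integrable_bound)
  show "integrable lborel (\<lambda>x. 1 / V0 * (W x * (u x)\<^sup>2))" using assms by auto
  have "(u x)\<^sup>2 \<le> 1 / V0 * (W x * (u x)\<^sup>2)" for x
    using V0 mult_right_mono[OF V_ge[of "\<epsilon> *\<^sub>R x"], of "(u x)\<^sup>2"] by (simp add: field_simps)
  then show "AE x in lborel. norm ((u x)\<^sup>2) \<le> norm (1 / V0 * (W x * (u x)\<^sup>2))"
    by (intro AE_I2) (metis abs_of_nonneg norm_ge_zero order_trans real_norm_def zero_le_power2 abs_ge_self)
qed measurable

text \<open>Passes from finite extended integrals to Bochner integrability, the form in which sums
  and products can be split. Integrability of \<open>u^2\<close> is recovered from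
  \<open>V0 <= W x\<close>.\<close>

lemma H_iff:
  "u \<in> H \<longleftrightarrow> u \<in> borel_measurable borel \<and>
     integrable (lborel \<Otimes>\<^sub>M lborel) (\<lambda>z. frac_kernel s z * (u (fst z) - u (snd z))\<^sup>2) \<and>
     integrable lborel (\<lambda>x. W x * (u x)\<^sup>2)"
proof (cases "u \<in> borel_measurable borel")
  case True
  note [measurable] = True
  have "integrable (lborel \<Otimes>\<^sub>M lborel) (\<lambda>z. frac_kernel s z * (u (fst z) - u (snd z))\<^sup>2)
     \<longleftrightarrow> gagliardo_ennreal s u < \<infinity>"
    unfolding gagliardo_ennreal_eq
    by (subst integrable_iff_bounded) (auto simp: frac_kernel_nonneg abs_mult)
  moreover have "integrable lborel (\<lambda>x. W x * (u x)\<^sup>2) \<longleftrightarrow> pot_ennreal V \<epsilon> u < \<infinity>"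
    unfolding pot_ennreal_def
    by (subst integrable_iff_bounded) (auto simp: W_nonneg abs_mult)
  ultimately show ?thesis using True square_integrable_of_pot by (auto simp: H_eps_def)
qed (auto simp: H_eps_def)

lemma H_D:
  assumes "u \<in> H"
  shows H_measurable: "u \<in> borel_measurable borel"
    and H_gagliardo: "integrable (lborel \<Otimes>\<^sub>M lborel) (\<lambda>z. frac_kernel s z * (u (fst z) - u (snd z))\<^sup>2)"
    and H_pot: "integrable lborel (\<lambda>x. W x * (u x)\<^sup>2)"
    and H_square: "integrable lborel (\<lambda>x. (u x)\<^sup>2)"
  using assms square_integrable_of_pot by (auto simp: H_iff)

lemma H_pair_measurable:
  assumes "u \<in> H"
  shows "(\<lambda>z. u (fst z) - u (snd z)) \<in> borel_measurable (lborel \<Otimes>\<^sub>M lborel)"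
proof -
  have [measurable]: "u \<in> borel_measurable borel" using assms by (rule H_measurable)
  show ?thesis by measurable
qed

lemma H_gagliardo_product:
  assumes "u \<in> H" "v \<in> H"
  shows "integrable (lborel \<Otimes>\<^sub>M lborel) (\<lambda>z. frac_kernel s z * (u (fst z) - u (snd z)) * (v (fst z) - v (snd z)))"
  by (intro integrable_weighted_product H_gagliardo assms frac_kernel_nonneg H_pair_measurable frac_kernel_measurable)

lemma H_pot_product:
  assumes "u \<in> H" "v \<in> H"
  shows "integrable lborel (\<lambda>x. W x * u x * v x)"
  using assms H_measurable W_measurable
  by (intro integrable_weighted_product H_pot W_nonneg) auto

lemma gagliardo_eq:
  assumes "u \<in> H"
  shows "gagliardo s u = (\<integral>z. frac_kernel s z * (u (fst z) - u (snd z))\<^sup>2 \<partial>(lborel \<Otimes>\<^sub>M lborel))"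
    and "gagliardo_ennreal s u = ennreal (gagliardo s u)"
proof -
  have *: "gagliardo_ennreal s u = ennreal (\<integral>z. frac_kernel s z * (u (fst z) - u (snd z))\<^sup>2 \<partial>(lborel \<Otimes>\<^sub>M lborel))"
    unfolding gagliardo_ennreal_eq
    by (rule nn_integral_eq_integral[OF H_gagliardo[OF assms]]) (simp add: frac_kernel_nonneg)
  then show 1: "gagliardo s u = (\<integral>z. frac_kernel s z * (u (fst z) - u (snd z))\<^sup>2 \<partial>(lborel \<Otimes>\<^sub>M lborel))"
    unfolding gagliardo_def by (simp add: Bochner_Integration.integral_nonneg frac_kernel_nonneg)
  show "gagliardo_ennreal s u = ennreal (gagliardo s u)" using * 1 by simp
qed

lemma pot_eq:
  assumes "u \<in> H"
  shows "pot u = (LBINT x. W x * (u x)\<^sup>2)" and "pot_ennreal V \<epsilon> u = ennreal (pot u)"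
proof -
  have *: "pot_ennreal V \<epsilon> u = ennreal (LBINT x. W x * (u x)\<^sup>2)"
    unfolding pot_ennreal_def
    by (rule nn_integral_eq_integral[OF H_pot[OF assms]]) (simp add: W_nonneg)
  then show 1: "pot u = (LBINT x. W x * (u x)\<^sup>2)"
    unfolding pot_def by (simp add: Bochner_Integration.integral_nonneg W_nonneg)
  show "pot_ennreal V \<epsilon> u = ennreal (pot u)" using * 1 by simp
qed

lemma gagliardo_nonneg: "0 \<le> gagliardo s u"
  by (simp add: gagliardo_def)

lemma pot_nonneg: "0 \<le> pot u"
  by (simp add: pot_def)

lemma N_eq: "N u = gagliardo s u + pot u"
  by (simp add: norm_eps_sq_def pot_def)

lemma N_nonneg: "0 \<le> N u"
  using gagliardo_nonneg[of u] pot_nonneg[of u] by (simp add: N_eq)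

lemma N_inner: "u \<in> H \<Longrightarrow> N u = inner_eps u u"
  by (simp add: N_eq gagliardo_eq(1) pot_eq(1) inner_eps_def power2_eq_square mult.assoc)

lemma inner_commute: "inner_eps u v = inner_eps v u"
  by (simp add: inner_eps_def mult.commute mult.left_commute)

lemma H_linear:
  assumes u: "u \<in> H" and v: "v \<in> H"
  shows "(\<lambda>x. \<alpha> * u x + \<beta> * v x) \<in> H"
proof -
  note [measurable] = H_measurable[OF u] H_measurable[OF v]
  have 1: "frac_kernel s z * ((\<alpha> * u (fst z) + \<beta> * v (fst z)) - (\<alpha> * u (snd z) + \<beta> * v (snd z)))\<^sup>2
     = \<alpha>\<^sup>2 * (frac_kernel s z * (u (fst z) - u (snd z))\<^sup>2)
       + 2 * \<alpha> * \<beta> * (frac_kernel s z * (u (fst z) - u (snd z)) * (v (fst z) - v (snd z)))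
       + \<beta>\<^sup>2 * (frac_kernel s z * (v (fst z) - v (snd z))\<^sup>2)" for z
    by (simp add: power2_eq_square algebra_simps)
  have 2: "W x * (\<alpha> * u x + \<beta> * v x)\<^sup>2 = \<alpha>\<^sup>2 * (W x * (u x)\<^sup>2) + 2 * \<alpha> * \<beta> * (W x * u x * v x) + \<beta>\<^sup>2 * (W x * (v x)\<^sup>2)" for x
    by (simp add: power2_eq_square algebra_simps)
  show ?thesis unfolding H_iff 1 2
    using H_gagliardo[OF u] H_gagliardo[OF v] H_gagliardo_product[OF u v] H_pot[OF u] H_pot[OF v] H_pot_product[OF u v]
    by auto
qed

lemma H_scale: "u \<in> H \<Longrightarrow> (\<lambda>x. t * u x) \<in> H"
  using H_linear[of u u t 0] by simp

lemma H_add_scale: "u \<in> H \<Longrightarrow> v \<in> H \<Longrightarrow> (\<lambda>x. u x + t * v x) \<in> H"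
  using H_linear[of u v 1 t] by simp

lemma inner_linear:
  assumes u: "u \<in> H" and v: "v \<in> H" and w: "w \<in> H"
  shows "inner_eps (\<lambda>x. \<alpha> * u x + \<beta> * v x) w = \<alpha> * inner_eps u w + \<beta> * inner_eps v w"
proof -
  have 1: "frac_kernel s z * ((\<alpha> * u (fst z) + \<beta> * v (fst z)) - (\<alpha> * u (snd z) + \<beta> * v (snd z))) * (w (fst z) - w (snd z))
     = \<alpha> * (frac_kernel s z * (u (fst z) - u (snd z)) * (w (fst z) - w (snd z)))
       + \<beta> * (frac_kernel s z * (v (fst z) - v (snd z)) * (w (fst z) - w (snd z)))" for z
    by (simp add: algebra_simps)
  have 2: "W x * (\<alpha> * u x + \<beta> * v x) * w x = \<alpha> * (W x * u x * w x) + \<beta> * (W x * v x * w x)" for x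
    by (simp add: algebra_simps)
  show ?thesis unfolding inner_eps_def 1 2
    using H_gagliardo_product[OF u w] H_gagliardo_product[OF v w] H_pot_product[OF u w] H_pot_product[OF v w]
    by (simp add: distrib_left)
qed

lemma N_linear:
  assumes u: "u \<in> H" and v: "v \<in> H"
  shows "N (\<lambda>x. \<alpha> * u x + \<beta> * v x) = \<alpha>\<^sup>2 * N u + 2 * \<alpha> * \<beta> * inner_eps u v + \<beta>\<^sup>2 * N v"
proof -
  note H = H_linear[OF u v, of \<alpha> \<beta>]
  have "N (\<lambda>x. \<alpha> * u x + \<beta> * v x) = \<alpha> * inner_eps u (\<lambda>x. \<alpha> * u x + \<beta> * v x) + \<beta> * inner_eps v (\<lambda>x. \<alpha> * u x + \<beta> * v x)"
    unfolding N_inner[OF H] by (rule inner_linear[OF u v H])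
  also have "\<dots> = \<alpha> * (\<alpha> * inner_eps u u + \<beta> * inner_eps v u) + \<beta> * (\<alpha> * inner_eps u v + \<beta> * inner_eps v v)"
    by (simp only: inner_commute[of u "\<lambda>x. \<alpha> * u x + \<beta> * v x"] inner_commute[of v "\<lambda>x. \<alpha> * u x + \<beta> * v x"]
        inner_linear[OF u v u] inner_linear[OF u v v])
  finally show ?thesis
    by (simp add: N_inner[OF u] N_inner[OF v] inner_commute[of v u] power2_eq_square algebra_simps)
qed

lemma N_scale: "u \<in> H \<Longrightarrow> N (\<lambda>x. t * u x) = t\<^sup>2 * N u"
  using N_linear[of u u t 0] by simp

lemma gagliardo_scale: "u \<in> H \<Longrightarrow> gagliardo s (\<lambda>x. t * u x) = t\<^sup>2 * gagliardo s u"
proof -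
  assume u: "u \<in> H"
  have "frac_kernel s z * (t * u (fst z) - t * u (snd z))\<^sup>2 = t\<^sup>2 * (frac_kernel s z * (u (fst z) - u (snd z))\<^sup>2)" for z
    by (simp add: power2_eq_square algebra_simps)
  then show ?thesis unfolding gagliardo_eq(1)[OF u] gagliardo_eq(1)[OF H_scale[OF u]] by (simp only:) simp
qed

lemma square_le_pot:
  assumes "u \<in> H"
  shows "V0 * (LBINT x. (u x)\<^sup>2) \<le> pot u"
proof -
  have "(LBINT x. V0 * (u x)\<^sup>2) \<le> (LBINT x. W x * (u x)\<^sup>2)"
    using H_square[OF assms] H_pot[OF assms] V_ge
    by (intro Bochner_Integration.integral_mono) (auto intro!: mult_right_mono)
  then show ?thesis by (simp add: pot_eq(1)[OF assms])
qed

text \<open>\<open>R\<close> bounds the Gagliardo part and \<open>R / V0\<close> the square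
  integral, so their sum bounds both.\<close>

lemma H_sobolev_ball:
  assumes u: "u \<in> H" and R: "N u \<le> R"
  shows "u \<in> sobolev_ball s (R + R / V0)"
proof -
  have R0: "0 \<le> R" using R N_nonneg[of u] by linarith
  have "gagliardo_ennreal s u \<le> ennreal (R + R / V0)"
    unfolding gagliardo_eq(2)[OF u] using R N_eq[of u] pot_nonneg[of u] R0 V0
    by (intro ennreal_leI) (simp add: add_increasing2)
  moreover have "(\<integral>\<^sup>+ x. ennreal ((u x)\<^sup>2) \<partial>lborel) \<le> ennreal (R + R / V0)"
  proof -
    have "(\<integral>\<^sup>+ x. ennreal ((u x)\<^sup>2) \<partial>lborel) = ennreal (LBINT x. (u x)\<^sup>2)"
      by (rule nn_integral_eq_integral[OF H_square[OF u]]) simp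
    also have "\<dots> \<le> ennreal (R + R / V0)"
    proof (rule ennreal_leI)
      have "V0 * (LBINT x. (u x)\<^sup>2) \<le> R"
        using square_le_pot[OF u] R N_eq[of u] gagliardo_nonneg[of u] by linarith
      then have "(LBINT x. (u x)\<^sup>2) \<le> R / V0" using V0 by (simp add: field_simps)
      then show "(LBINT x. (u x)\<^sup>2) \<le> R + R / V0" using R0 by linarith
    qed
    finally show ?thesis .
  qed
  ultimately show ?thesis using H_measurable[OF u] by (simp add: sobolev_ball_def)
qed

lemma H_powr_integrable:
  assumes u: "u \<in> H" and q: "2 \<le> q" "q < 6 / (3 - 2 * s)"
  shows "integrable lborel (\<lambda>x. \<bar>u x\<bar> powr q)"
proof (rule sobolev_ball_integrable[OF s0 s1 _ q])
  show "u \<in> sobolev_ball s ((N u + 1) + (N u + 1) / V0)" by (rule H_sobolev_ball[OF u]) simp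
  show "0 < (N u + 1) + (N u + 1) / V0" 
    using N_nonneg[of u] V0 by (simp add: add_nonneg_pos add_pos_nonneg)
qed

text \<open>A 1-Lipschitz map that fixes 0 increases neither integrand at any point. It is applied
  to the absolute value and to the positive part.\<close>

lemma H_contraction:
  assumes u: "u \<in> H" and T: "\<And>a b. \<bar>T a - T b\<bar> \<le> \<bar>a - b\<bar>" and T0: "T 0 = 0"
  shows "(\<lambda>x. T (u x)) \<in> H" and "N (\<lambda>x. T (u x)) \<le> N u"
proof -
  have "continuous_on UNIV T"
  proof (rule continuous_on_iff[THEN iffD2], intro ballI allI impI)
    fix x e :: real assume "e > 0"
    then show "\<exists>d>0. \<forall>x'\<in>UNIV. dist x' x < d \<longrightarrow> dist (T x') (T x) < e"
      using T by (intro exI[of _ e]) (auto simp: dist_real_def intro: le_less_trans)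
  qed
  then have Tm [measurable]: "T \<in> borel_measurable borel" by (rule borel_measurable_continuous_onI)
  note [measurable] = H_measurable[OF u]
  have g: "frac_kernel s z * (T (u (fst z)) - T (u (snd z)))\<^sup>2 \<le> frac_kernel s z * (u (fst z) - u (snd z))\<^sup>2" for z
    using T by (intro mult_left_mono) (auto simp: abs_le_square_iff[symmetric] frac_kernel_nonneg)
  have p: "W x * (T (u x))\<^sup>2 \<le> W x * (u x)\<^sup>2" for x
    using T[of "u x" 0] T0 by (intro mult_left_mono) (auto simp: abs_le_square_iff[symmetric] W_nonneg)
  have gi: "integrable (lborel \<Otimes>\<^sub>M lborel) (\<lambda>z. frac_kernel s z * (T (u (fst z)) - T (u (snd z)))\<^sup>2)"
    using g by (intro Bochner_Integration.integrable_bound[OF H_gagliardo[OF u]])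
      (auto simp: frac_kernel_nonneg abs_mult)
  have pi: "integrable lborel (\<lambda>x. W x * (T (u x))\<^sup>2)"
    using p by (intro Bochner_Integration.integrable_bound[OF H_pot[OF u]])
      (auto simp: W_nonneg abs_mult)
  show H: "(\<lambda>x. T (u x)) \<in> H" unfolding H_iff using gi pi by auto
  show "N (\<lambda>x. T (u x)) \<le> N u"
    unfolding N_eq gagliardo_eq(1)[OF H] gagliardo_eq(1)[OF u] pot_eq(1)[OF H] pot_eq(1)[OF u]
    using g p gi pi H_gagliardo[OF u] H_pot[OF u] by (intro add_mono Bochner_Integration.integral_mono) auto
qed

text \<open>Replaces the almost everywhere condition by positivity of \<open>N\<close>, which is
  also what keeps \<open>Mhat M\<close> away from the endpoint 0 when the energy is
  differentiated.\<close>

lemma nontrivial_iff: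
  assumes u: "u \<in> H"
  shows "nontrivial u \<longleftrightarrow> N u > 0"
proof
  assume "nontrivial u"
  show "N u > 0"
  proof (rule ccontr)
    assume "\<not> N u > 0"
    then have "V0 * (LBINT x. (u x)\<^sup>2) \<le> 0"
      using square_le_pot[OF u] N_eq[of u] gagliardo_nonneg[of u] by linarith
    then have "(LBINT x. (u x)\<^sup>2) \<le> 0" using V0 by (simp add: mult_le_0_iff)
    moreover have "(LBINT x. (u x)\<^sup>2) \<ge> 0" by (intro Bochner_Integration.integral_nonneg) auto
    ultimately have "AE x in lborel. (u x)\<^sup>2 = 0"
      using integral_nonneg_eq_0_iff_AE[OF H_square[OF u]] by auto
    then show False using \<open>nontrivial u\<close> by (simp add: nontrivial_def)
  qed
next
  assume N: "N u > 0"
  show "nontrivial u" unfolding nontrivial_def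
  proof
    assume ae: "AE x in lborel. u x = 0"
    have "AE z in lborel \<Otimes>\<^sub>M lborel. frac_kernel s z * (u (fst z) - u (snd z))\<^sup>2 = 0"
      using AE_lborel_pair[OF ae] by eventually_elim auto
    then have "gagliardo s u = 0" unfolding gagliardo_eq(1)[OF u] by (rule integral_eq_zero_AE)
    moreover have "AE x in lborel. W x * (u x)\<^sup>2 = 0" using ae by eventually_elim auto
    then have "pot u = 0" unfolding pot_eq(1)[OF u] by (rule integral_eq_zero_AE)
    ultimately show False using N by (simp add: N_eq)
  qed
qed

text \<open>The two parts of the norm get separate limits: later the potential part is joined to the
  nonlinear term before Fatou's lemma is applied, while the Gagliardo part stands alone.\<close>

lemma H_fatou:
  assumes v: "\<And>n. v n \<in> H" and wm: "w \<in> borel_measurable borel"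
    and conv: "AE x in lborel. (\<lambda>n. v n x) \<longlonglongrightarrow> w x"
    and g: "(\<lambda>n. gagliardo s (v n)) \<longlonglongrightarrow> g" and p: "(\<lambda>n. pot (v n)) \<longlonglongrightarrow> p"
  shows "w \<in> H" "gagliardo s w \<le> g" "pot w \<le> p"
proof -
  have vm [measurable]: "v n \<in> borel_measurable borel" for n by (rule H_measurable[OF v])
  have g0: "0 \<le> g" using g gagliardo_nonneg by (intro LIMSEQ_le_const) auto
  have p0: "0 \<le> p" using p pot_nonneg by (intro LIMSEQ_le_const) auto
  have G: "gagliardo_ennreal s w \<le> ennreal g"
    by (rule gagliardo_fatou[OF vm conv _ g]) (simp add: gagliardo_eq(2)[OF v])
  have P: "pot_ennreal V \<epsilon> w \<le> ennreal p"
    unfolding pot_ennreal_def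
  proof (rule nn_integral_fatou_le[of "\<lambda>n x. W x * (v n x)\<^sup>2", OF _ _ _ p])
    show "AE x in lborel. (\<lambda>n. W x * (v n x)\<^sup>2) \<longlonglongrightarrow> W x * (w x)\<^sup>2"
      using conv by eventually_elim (intro tendsto_intros)
    show "(\<integral>\<^sup>+ x. ennreal (W x * (v n x)\<^sup>2) \<partial>lborel) \<le> ennreal (pot (v n))" for n
      using pot_eq(2)[OF v[of n]] by (simp add: pot_ennreal_def)
  qed measurable
  show "gagliardo s w \<le> g" unfolding gagliardo_def using G g0 by (rule enn2real_leI[rotated])
  show "pot w \<le> p" unfolding pot_def using P p0 by (rule enn2real_leI[rotated])
  note [measurable] = wm
  have "integrable (lborel \<Otimes>\<^sub>M lborel) (\<lambda>z. frac_kernel s z * (w (fst z) - w (snd z))\<^sup>2)"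
    using G by (intro integrableI_nonneg) (auto simp: frac_kernel_nonneg gagliardo_ennreal_eq le_less_trans)
  moreover have "integrable lborel (\<lambda>x. W x * (w x)\<^sup>2)"
    using P by (intro integrableI_nonneg) (auto simp: W_nonneg pot_ennreal_def le_less_trans)
  ultimately show "w \<in> H" by (simp add: H_iff wm)
qed

lemma H_bump:
  "(\<lambda>x. max 0 (1 - norm (x - x0))) \<in> H"
proof -
  define u where "u = (\<lambda>x :: R3. max 0 (1 - norm (x - x0)))"
  have um [measurable]: "u \<in> borel_measurable borel" unfolding u_def by auto
  have "integrable (lborel \<Otimes>\<^sub>M lborel) (\<lambda>z. frac_kernel s z * (u (fst z) - u (snd z))\<^sup>2)"
    using gagliardo_bump_finite[OF s0 s1, of x0]
    by (intro integrableI_nonneg) (auto simp: frac_kernel_nonneg gagliardo_ennreal_eq u_def)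
  moreover have "integrable lborel (\<lambda>x. W x * (u x)\<^sup>2)"
  proof -
    have "compact ((\<lambda>x. W x) ` cball x0 1)"
      using continuous_on_subset[OF W_continuous] by (intro compact_continuous_image) auto
    then obtain C where C: "\<And>x. x \<in> cball x0 1 \<Longrightarrow> \<bar>W x\<bar> \<le> C"
      using compact_imp_bounded bounded_iff by (metis (no_types, lifting) imageI real_norm_def)
    show ?thesis
    proof (rule Bochner_Integration.integrable_bound)
      show "integrable lborel (\<lambda>x. C * indicator (cball x0 1) x)"
        using emeasure_lborel_cball_finite[of x0 1] by (simp add: integrable_indicator_iff)
      show "AE x in lborel. norm (W x * (u x)\<^sup>2) \<le> norm (C * indicator (cball x0 1) x)"
      proof (intro AE_I2)
        fix x
        show "norm (W x * (u x)\<^sup>2) \<le> norm (C * indicator (cball x0 1) x)"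
        proof (cases "x \<in> cball x0 1")
          case True
          have "0 \<le> u x" "u x \<le> 1" by (auto simp: u_def)
          then have "(u x)\<^sup>2 \<le> 1" by (simp add: power_le_one)
          then have "\<bar>W x\<bar> * (u x)\<^sup>2 \<le> C * 1" using C[OF True] by (intro mult_mono) auto
          then show ?thesis using True by (simp add: abs_mult)
        next
          case False
          then have "u x = 0" by (simp add: u_def dist_norm norm_minus_commute)
          then show ?thesis by simp
        qed
      qed
    qed measurable
  qed
  ultimately show ?thesis using um by (simp add: H_iff u_def)
qed

end

section \<open>The nonlinearities\<close>

text \<open>\<open>{0..t}\<close> is empty for \<open>t < 0\<close>, so the integral is 0 there. For
  the nonlinearities, which vanish on negative numbers, this agrees with the oriented
  integral.\<close>

lemma primitive_nonpos: "t \<le> 0 \<Longrightarrow> primitive h t = 0"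
  by (cases "t = 0") (auto simp: primitive_def)

lemma has_real_derivative_primitive:
  assumes cont: "continuous_on UNIV h" and h0: "\<And>t. t \<le> 0 \<Longrightarrow> h t = 0"
  shows "(primitive h has_real_derivative h t) (at t)"
proof (cases "t < 0")
  case True
  have "((\<lambda>_. 0) has_real_derivative h t) (at t)" using True h0[of t] by simp
  moreover have "eventually (\<lambda>x. 0 = primitive h x) (nhds t)"
    using eventually_nhds_in_open[of "{..<0}" t] True by (auto elim!: eventually_mono simp: primitive_nonpos)
  ultimately show ?thesis using True by (subst DERIV_cong_ev[OF refl _ refl, symmetric])
next
  case False
  \<comment> \<open>With base point -1 the point \<open>t = 0\<close> becomes interior, and a
    two-sided derivative results; the piece below 0 contributes nothing because \<open>h\<close>
    vanishes there.\<close>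
  define l where "l = (-1 :: real)"
  have c: "continuous_on {l..t+1} h" using cont continuous_on_subset by blast
  have eq: "primitive h x = integral {l..x} h" if "x \<in> {l<..<t+1}" for x
  proof (cases "x \<le> 0")
    case True
    have "integral {l..x} h = integral {l..x} (\<lambda>_. 0 :: real)"
      using True h0 by (intro Henstock_Kurzweil_Integration.integral_cong) auto
    then show ?thesis using True by (simp add: primitive_nonpos)
  next
    case False
    have "integral {l..0} h + integral {0..x} h = integral {l..x} h"
      using False that c continuous_on_subset[OF c, of "{l..x}"]
      by (intro Henstock_Kurzweil_Integration.integral_combine integrable_continuous_real) (auto simp: l_def)
    moreover have "integral {l..0} h = integral {l..0} (\<lambda>_. 0 :: real)"
      using h0 by (intro Henstock_Kurzweil_Integration.integral_cong) auto
    ultimately show ?thesis by (simp add: primitive_def)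
  qed
  have t: "t \<in> {l<..<t+1}" using False by (auto simp: l_def)
  have "((\<lambda>x. integral {l..x} h) has_real_derivative h t) (at t within {l..t+1})"
    using t by (intro integral_has_real_derivative c) auto
  then have "((\<lambda>x. integral {l..x} h) has_real_derivative h t) (at t)"
    using t by (subst (asm) at_within_interior) (auto simp: interior_atLeastAtMost_real)
  moreover have "eventually (\<lambda>x. integral {l..x} h = primitive h x) (nhds t)"
    using eventually_nhds_in_open[of "{l<..<t+1}" t] t by (auto elim!: eventually_mono simp: eq)
  ultimately show ?thesis by (subst DERIV_cong_ev[OF refl _ refl, symmetric])
qed

locale nonlinearity =
  fixes f :: "real \<Rightarrow> real" and q \<theta> V0 K a :: real
  assumes f_cont: "continuous_on UNIV f"
    and f_neg: "\<And>t. t < 0 \<Longrightarrow> f t = 0"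
    and f1: "((\<lambda>t. f t / t ^ 3) \<longlongrightarrow> 0) (at_right 0)"
    and q4: "4 < q" and f2: "((\<lambda>t. f t / t powr (q - 1)) \<longlongrightarrow> 0) at_top"
    and \<theta>4: "4 < \<theta>"
    and f3: "\<And>t. t > 0 \<Longrightarrow> 0 < \<theta> * primitive f t" "\<And>t. t > 0 \<Longrightarrow> \<theta> * primitive f t \<le> f t * t"
    and f4: "mono_on {0<..} (\<lambda>t. f t / t ^ 3)"
    and V0_pos: "V0 > 0" and K_pos: "K > 0"
    and a_pos: "a > 0" and f_a: "f a = V0 / K * a"
begin

abbreviation "ft \<equiv> f_tilde f V0 K a"

lemma f_nonpos_zero: "t \<le> 0 \<Longrightarrow> f t = 0"
proof (cases "t = 0")
  case True
  have "isCont f 0" using f_cont by (simp add: continuous_on_eq_continuous_at)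
  then have "(f \<longlongrightarrow> f 0) (at_left 0)" by (simp add: isCont_def tendsto_within_subset filterlim_at_split)
  moreover have "(f \<longlongrightarrow> 0) (at_left 0)"
    by (rule tendsto_eventually) (auto simp: eventually_at_filter f_neg)
  ultimately have "f 0 = 0" using tendsto_unique trivial_limit_at_left_real by blast
  then show ?thesis using True by simp
qed (use f_neg in auto)

lemma f_pos: "t > 0 \<Longrightarrow> f t > 0"
  using f3[of t] by (metis less_le_trans zero_less_mult_pos2)

lemma f_nonneg: "0 \<le> f t"
  using f_pos[of t] f_nonpos_zero[of t] by (cases "t > 0") auto

lemma f_cube_mono: "0 < t1 \<Longrightarrow> t1 \<le> t2 \<Longrightarrow> f t1 / t1 ^ 3 \<le> f t2 / t2 ^ 3"
  using f4 by (auto simp: mono_on_def)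

lemma f_ratio_mono:
  assumes "0 < t1" "t1 \<le> t2"
  shows "f t1 / t1 \<le> f t2 / t2"
proof -
  have "f t1 / t1 = f t1 / t1 ^ 3 * t1\<^sup>2" using assms by (simp add: power2_eq_square power3_eq_cube)
  also have "\<dots> \<le> f t2 / t2 ^ 3 * t2\<^sup>2"
    using assms f_nonneg by (intro mult_mono f_cube_mono power_mono) auto
  also have "\<dots> = f t2 / t2" using assms by (simp add: power2_eq_square power3_eq_cube)
  finally show ?thesis .
qed

lemma f_mono:
  assumes "0 < t1" "t1 \<le> t2"
  shows "f t1 \<le> f t2"
proof -
  have "f t1 = f t1 / t1 * t1" using assms by simp
  also have "\<dots> \<le> f t2 / t2 * t2" using assms f_nonneg by (intro mult_mono f_ratio_mono) auto
  also have "\<dots> = f t2" using assms by simp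
  finally show ?thesis .
qed

text \<open>\<open>f t / t\<close> is nondecreasing and equals \<open>V0 / K\<close> at
  \<open>a\<close>; hence \<open>ft t\<close> is the minimum of \<open>f t\<close> and
  \<open>V0 / K * t\<close> for \<open>t >= 0\<close>.\<close>

lemma f_le_linear: "0 \<le> t \<Longrightarrow> t \<le> a \<Longrightarrow> f t \<le> V0 / K * t"
  using f_ratio_mono[of t a] f_a a_pos f_nonpos_zero[of 0] by (cases "t = 0") (auto simp: field_simps)

lemma f_ge_linear: "a \<le> t \<Longrightarrow> V0 / K * t \<le> f t"
  using f_ratio_mono[of a t] f_a a_pos by (auto simp: field_simps)

lemma ft_cont: "continuous_on UNIV ft"
proof -
  have "continuous_on ({..a} \<union> {a..}) (\<lambda>t. if t \<le> a then f t else V0 / K * t)"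
    using f_a by (intro continuous_on_If continuous_intros continuous_on_subset[OF f_cont]) auto
  moreover have "{..a} \<union> {a..} = UNIV" by auto
  ultimately show ?thesis by (simp add: f_tilde_def[abs_def])
qed

lemma ft_nonpos_zero: "t \<le> 0 \<Longrightarrow> ft t = 0"
  using a_pos by (simp add: f_tilde_def f_nonpos_zero)

lemma ft_nonneg: "0 \<le> ft t"
  using a_pos V0_pos K_pos by (simp add: f_tilde_def f_nonneg)

lemma ft_le_linear: "0 \<le> t \<Longrightarrow> ft t \<le> V0 / K * t"
  using f_le_linear[of t] by (simp add: f_tilde_def)

lemma ft_le_f: "ft t \<le> f t"
  using f_ge_linear[of t] by (simp add: f_tilde_def)

text \<open>\<open>f1\<close> gives the linear term near 0, as \<open>t^3 <= t\<close> there, and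
  \<open>f2\<close> gives the power at infinity. On the range between, \<open>f t <= f T\<close> is
  at most a multiple of the power because \<open>t\<close> stays above \<open>t0\<close>.\<close>

lemma f_growth:
  assumes \<delta>: "\<delta> > 0"
  obtains C where "C > 0" "\<And>t. 0 \<le> t \<Longrightarrow> f t \<le> \<delta> * t + C * t powr (q - 1)"
proof -
  have "eventually (\<lambda>t. f t / t ^ 3 < \<delta>) (at_right 0)" using order_tendstoD(2)[OF f1 \<delta>] .
  then obtain b where b: "b > 0" "\<And>t. 0 < t \<Longrightarrow> t < b \<Longrightarrow> f t / t ^ 3 < \<delta>"
    unfolding eventually_at_right_field by auto
  define t0 where "t0 = min b 1"
  have t0: "t0 > 0" "t0 \<le> 1" using b by (auto simp: t0_def)
  have "eventually (\<lambda>t. f t / t powr (q - 1) < 1) at_top" using order_tendstoD(2)[OF f2, of 1] by simp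
  then obtain T0 where T0: "\<And>t. t \<ge> T0 \<Longrightarrow> f t / t powr (q - 1) < 1"
    unfolding eventually_at_top_linorder by auto
  define T where "T = max T0 1"
  define C where "C = 1 + f T / t0 powr (q - 1)"
  have C: "C \<ge> 1" using f_nonneg by (simp add: C_def)
  have "f t \<le> \<delta> * t + C * t powr (q - 1)" if t: "0 \<le> t" for t
  proof -
    consider "t = 0" | "0 < t" "t < t0" | "t0 \<le> t" "t \<le> T" | "T < t" using t by linarith
    then show ?thesis
    proof cases
      case 2
      then have "f t / t ^ 3 < \<delta>" by (intro b(2)) (auto simp: t0_def)
      then have "f t \<le> \<delta> * t ^ 3" using 2 by (simp add: field_simps)
      also have "\<dots> \<le> \<delta> * t ^ 1"
        using 2 t0 \<delta> by (intro mult_left_mono power_decreasing) auto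
      finally show ?thesis using C by (simp add: add_increasing2)
    next
      case 3
      have "f t \<le> f T" using 3 t0 by (intro f_mono) auto
      also have "\<dots> = f T / t0 powr (q - 1) * t0 powr (q - 1)" using t0 by simp
      also have "\<dots> \<le> C * t powr (q - 1)"
        using 3 t0 q4 f_nonneg by (intro mult_mono powr_mono2) (auto simp: C_def)
      finally show ?thesis using \<delta> t by (simp add: add_increasing)
    next
      case 4
      have "f t / t powr (q - 1) < 1" using 4 by (intro T0) (auto simp: T_def)
      moreover have "t > 0" using 4 by (auto simp: T_def)
      ultimately have "f t \<le> 1 * t powr (q - 1)" by (simp add: field_simps)
      also have "\<dots> \<le> C * t powr (q - 1)" using C by (intro mult_right_mono) auto
      finally show ?thesis using \<delta> t by (simp add: add_increasing)
    qed (simp add: f_nonpos_zero)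
  qed
  then show ?thesis using that C by (metis less_le_trans zero_less_one)
qed

lemma primitive_f_nonneg: "0 \<le> primitive f t"
proof (cases "t > 0")
  case True
  then have "0 < \<theta> * primitive f t" by (rule f3)
  then show ?thesis using \<theta>4 by (simp add: zero_less_mult_iff)
qed (simp add: primitive_nonpos)

lemma primitive_f_le: "4 * primitive f t \<le> f t * t"
proof (cases "t > 0")
  case True
  have "4 * primitive f t \<le> \<theta> * primitive f t" using \<theta>4 primitive_f_nonneg by (intro mult_right_mono) auto
  then show ?thesis using f3(2)[OF True] by linarith
qed (simp add: primitive_nonpos f_nonpos_zero)

lemma primitive_f_deriv: "(primitive f has_real_derivative f t) (at t)"
  by (rule has_real_derivative_primitive[OF f_cont f_nonpos_zero])

lemma primitive_ft_deriv: "(primitive ft has_real_derivative ft t) (at t)"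
  by (rule has_real_derivative_primitive[OF ft_cont ft_nonpos_zero])

lemma primitive_ft_nonneg: "0 \<le> primitive ft t"
  unfolding primitive_def by (cases "0 \<le> t")
    (auto intro!: Henstock_Kurzweil_Integration.integral_nonneg integrable_continuous_real
      continuous_on_subset[OF ft_cont] ft_nonneg)

lemma primitive_ft_le: "primitive ft t \<le> V0 / (2 * K) * t\<^sup>2"
proof (cases "t \<le> 0")
  case True
  then show ?thesis using V0_pos K_pos by (simp add: primitive_nonpos)
next
  case False
  have d: "((\<lambda>t. V0 / (2 * K) * t\<^sup>2 - primitive ft t) has_real_derivative V0 / K * x - ft x) (at x)" for x
    using primitive_ft_deriv[of x] K_pos by (auto intro!: derivative_eq_intros)
  have "(\<lambda>t. V0 / (2 * K) * t\<^sup>2 - primitive ft t) 0 \<le> (\<lambda>t. V0 / (2 * K) * t\<^sup>2 - primitive ft t) t"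
  proof (rule DERIV_nonneg_imp_nondecreasing[where f = "\<lambda>t. V0 / (2 * K) * t\<^sup>2 - primitive ft t"])
    show "0 \<le> t" using False by simp
    fix x assume "0 \<le> x" "x \<le> t"
    then show "\<exists>y. ((\<lambda>t. V0 / (2 * K) * t\<^sup>2 - primitive ft t) has_real_derivative y) (at x) \<and> 0 \<le> y"
      using d ft_le_linear[of x] by (intro exI[of _ "V0 / K * x - ft x"]) auto
  qed
  then show ?thesis by (simp add: primitive_nonpos)
qed

lemma primitive_ft_quarter: "primitive ft t - ft t * t / 4 \<le> V0 / (2 * K) * t\<^sup>2"
proof -
  have "0 \<le> ft t * t" using ft_nonneg[of t] ft_nonpos_zero[of t] by (cases "t \<le> 0") auto
  then show ?thesis using primitive_ft_le[of t] by linarith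
qed

text \<open>By \<open>f3\<close> the function \<open>primitive f t * t powr (- \<theta>)\<close> is
  nondecreasing, so the primitive dominates a multiple of \<open>t powr \<theta>\<close> for
  \<open>t >= 1\<close>. One more use of \<open>f3\<close> gives
  \<open>f t / t^3 >= c * t powr (\<theta> - 4)\<close>, and \<open>\<theta> > 4\<close>.\<close>

lemma f_superlinear:
  obtains T where "T > 0" "\<And>t. t \<ge> T \<Longrightarrow> f t / t ^ 3 \<ge> L"
proof -
  define c where "c = \<theta> * primitive f 1"
  have c: "c > 0" unfolding c_def by (rule f3) simp
  define T where "T = max 1 ((\<bar>L\<bar> / c) powr (1 / (\<theta> - 4)))"
  have "f t / t ^ 3 \<ge> L" if t: "t \<ge> T" for t
  proof -
    have t1: "t \<ge> 1" using t by (simp add: T_def)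
    let ?g = "\<lambda>t. primitive f t * t powr (- \<theta>)"
    have "?g 1 \<le> ?g t"
    proof (rule DERIV_nonneg_imp_nondecreasing[OF t1])
      fix x assume x: "1 \<le> x" "x \<le> t"
      have "(?g has_real_derivative (f x * x powr (- \<theta>) + primitive f x * (- \<theta> * x powr (- \<theta> - 1)))) (at x)"
        using x primitive_f_deriv[of x] by (auto intro!: derivative_eq_intros)
      moreover have "f x * x powr (- \<theta>) + primitive f x * (- \<theta> * x powr (- \<theta> - 1)) = x powr (- \<theta> - 1) * (f x * x - \<theta> * primitive f x)"
      proof -
        have "x powr (- \<theta>) = x powr (- \<theta> - 1) * x" using x by (simp add: powr_diff)
        then show ?thesis by (simp add: algebra_simps)
      qed
      moreover have "0 \<le> x powr (- \<theta> - 1) * (f x * x - \<theta> * primitive f x)" using f3(2)[of x] x by auto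
      ultimately show "\<exists>y. (?g has_real_derivative y) (at x) \<and> 0 \<le> y" by auto
    qed
    then have "c \<le> \<theta> * (primitive f t * t powr (- \<theta>))" using \<theta>4 by (simp add: c_def)
    then have "c * t powr \<theta> \<le> \<theta> * (primitive f t * t powr (- \<theta>)) * t powr \<theta>" by (intro mult_right_mono) auto
    also have "\<dots> = \<theta> * primitive f t" using t1 by (simp add: powr_minus field_simps)
    also have "\<dots> \<le> f t * t" using t1 by (intro f3) auto
    finally have "c * t powr \<theta> / t ^ 4 \<le> f t * t / t ^ 4" using t1 by (intro divide_right_mono) auto
    also have "\<dots> = f t / t ^ 3" using t1 by (simp add: power_eq_if)
    also have "c * t powr \<theta> / t ^ 4 = c * t powr (\<theta> - 4)" using t1 by (simp add: powr_diff)
    finally have 1: "c * t powr (\<theta> - 4) \<le> f t / t ^ 3" .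
    have "\<bar>L\<bar> / c = ((\<bar>L\<bar> / c) powr (1 / (\<theta> - 4))) powr (\<theta> - 4)" using \<theta>4 c by (simp add: powr_powr)
    also have "\<dots> \<le> t powr (\<theta> - 4)" using t \<theta>4 by (intro powr_mono2) (auto simp: T_def)
    finally have "\<bar>L\<bar> \<le> c * t powr (\<theta> - 4)" using c by (simp add: field_simps)
    then show ?thesis using 1 by linarith
  qed
  moreover have "T > 0" by (simp add: T_def)
  ultimately show ?thesis using that by blast
qed

text \<open>For \<open>y > 0\<close> the expression is \<open>f (t * y) / (t * y)^3\<close> times
  the constant \<open>y^4\<close>, so this is \<open>f4\<close> along a ray.\<close>

lemma f_ray_mono:
  assumes t: "0 < t1" "t1 \<le> t2"
  shows "f (t1 * y) * y / t1 ^ 3 \<le> f (t2 * y) * y / t2 ^ 3"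
proof (cases "y > 0")
  case True
  have eq: "f (t * y) * y / t ^ 3 = f (t * y) / (t * y) ^ 3 * y ^ 4" if "t > 0" for t
    using True that by (simp add: power_mult_distrib power_eq_if)
  have "f (t1 * y) / (t1 * y) ^ 3 * y ^ 4 \<le> f (t2 * y) / (t2 * y) ^ 3 * y ^ 4"
    using t True by (intro mult_right_mono f_cube_mono) auto
  then show ?thesis using t eq[of t1] eq[of t2] by simp
next
  case False
  then have "t1 * y \<le> 0" "t2 * y \<le> 0" using t by (auto simp: mult_le_0_iff)
  then show ?thesis by (simp add: f_nonpos_zero)
qed

text \<open>The quadratic part absorbs the failure of \<open>ft (t y) y / t\<^sup>3\<close> to be monotone beyond \<open>a\<close>.\<close>

lemma ft_ray_mono:
  assumes t: "0 < t1" "t1 \<le> t2" and w: "V0 \<le> w"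
  shows "w * y\<^sup>2 / (K * t2\<^sup>2) - ft (t2 * y) * y / t2 ^ 3 \<le> w * y\<^sup>2 / (K * t1\<^sup>2) - ft (t1 * y) * y / t1 ^ 3"
proof -
  have dec: "c * y\<^sup>2 / (K * t2\<^sup>2) \<le> c * y\<^sup>2 / (K * t1\<^sup>2)" if "0 \<le> c" for c
    using t that K_pos by (intro divide_left_mono mult_left_mono power_mono) auto
  \<comment> \<open>Beyond \<open>a\<close> the nonlinear term cancels exactly the share
    \<open>V0\<close> of the quadratic one; what is left is
    \<open>(w - V0) * y^2 / (K * t^2)\<close>, which does not increase in \<open>t\<close>.\<close>
  have lin: "ft (t * y) * y / t ^ 3 = V0 * y\<^sup>2 / (K * t\<^sup>2)" if "t * y > a" "t > 0" for t
    using that K_pos by (simp add: f_tilde_def field_simps power2_eq_square power3_eq_cube)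
  have split: "w * y\<^sup>2 / (K * t\<^sup>2) - V0 * y\<^sup>2 / (K * t\<^sup>2) = (w - V0) * y\<^sup>2 / (K * t\<^sup>2)" for t
    by (simp add: diff_divide_distrib left_diff_distrib)
  consider "t2 * y \<le> a" | "t1 * y > a" | "t1 * y \<le> a" "t2 * y > a" by linarith
  then show ?thesis
  proof cases
    case 1
    have "t1 * y \<le> a"
    proof (cases "y > 0")
      case True
      then have "t1 * y \<le> t2 * y" using t by simp
      then show ?thesis using 1 by simp
    next
      case False
      then have "t1 * y \<le> 0" using t by (simp add: mult_le_0_iff)
      then show ?thesis using a_pos by simp
    qed
    then show ?thesis using 1 f_ray_mono[OF t, of y] dec[of w] w V0_pos by (simp add: f_tilde_def)
  next
    case 2
    then have "y > 0" using a_pos t by (smt (verit) mult_nonneg_nonpos)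
    then have "t2 * y > a" using 2 t mult_right_mono[of t1 t2 y] by linarith
    then show ?thesis using 2 lin[of t1] lin[of t2] t split[of t1] split[of t2] dec[of "w - V0"] w by simp
  next
    case 3
    then have y: "y > 0" using a_pos t by (smt (verit) mult_nonneg_nonpos)
    have "ft (t1 * y) \<le> V0 / K * (t1 * y)" using t y by (intro ft_le_linear) auto
    then have "ft (t1 * y) * y / t1 ^ 3 \<le> V0 / K * (t1 * y) * y / t1 ^ 3"
      using t y by (intro divide_right_mono mult_right_mono) auto
    also have "\<dots> = V0 * y\<^sup>2 / (K * t1\<^sup>2)"
      using t K_pos by (simp add: field_simps power2_eq_square power3_eq_cube)
    finally have "ft (t1 * y) * y / t1 ^ 3 \<le> V0 * y\<^sup>2 / (K * t1\<^sup>2)" .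
    then show ?thesis using 3 lin[of t2] t split[of t1] split[of t2] dec[of "w - V0"] w by simp
  qed
qed

end

section \<open>The Kirchhoff coefficient\<close>

locale kirchhoff_function =
  fixes M :: "real \<Rightarrow> real" and m0 :: real
  assumes M_cont: "continuous_on {0..} M" and m0_pos: "m0 > 0" and M_ge: "\<And>t. t \<ge> 0 \<Longrightarrow> M t \<ge> m0"
    and M3: "\<And>t1 t2. t1 \<ge> t2 \<Longrightarrow> t2 > 0 \<Longrightarrow> M t1 / t1 - M t2 / t2 \<le> m0 * (1/t1 - 1/t2)"
begin

text \<open>\<open>M3\<close> rearranged. That \<open>(M t - m0) / t\<close> is nonincreasing yields
  both the linear growth of \<open>M\<close> and its lower bound by segments starting at
  \<open>(0, m0)\<close>.\<close>

lemma M_ratio: "0 < t2 \<Longrightarrow> t2 \<le> t1 \<Longrightarrow> (M t1 - m0) / t1 \<le> (M t2 - m0) / t2"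
  using M3[of t2 t1] by (simp add: diff_divide_distrib algebra_simps)

lemma M_cont_on: "continuous_on {0..t} M"
  using M_cont by (rule continuous_on_subset) auto

lemma Mhat_deriv:
  assumes "t > 0"
  shows "(Mhat M has_real_derivative M t) (at t)"
proof -
  have "((\<lambda>x. integral {0..x} M) has_real_derivative M t) (at t within {0..t+1})"
    using assms by (intro integral_has_real_derivative M_cont_on) auto
  then show ?thesis unfolding Mhat_def[abs_def]
    using assms by (subst (asm) at_within_interior) (auto simp: interior_atLeastAtMost_real)
qed

lemma Mhat_excess_mono:
  assumes "0 \<le> x" "x \<le> y"
  shows "Mhat M x - m0 * x \<le> Mhat M y - m0 * y"
proof -
  have "integral {0..x} M + integral {x..y} M = integral {0..y} M"
    using assms by (intro Henstock_Kurzweil_Integration.integral_combine integrable_continuous_real M_cont_on) auto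
  moreover have "integral {x..y} (\<lambda>_. m0) \<le> integral {x..y} M"
    using assms M_ge by (intro Henstock_Kurzweil_Integration.integral_le integrable_continuous_real continuous_on_subset[OF M_cont]) auto
  ultimately show ?thesis using assms by (simp add: Mhat_def algebra_simps)
qed

lemma Mhat_mono: "0 \<le> x \<Longrightarrow> x \<le> y \<Longrightarrow> Mhat M x \<le> Mhat M y"
  using Mhat_excess_mono[of x y] m0_pos mult_left_mono[of x y m0] by linarith

lemma Mhat_cont: "continuous_on {0..} (Mhat M)"
proof -
  have "continuous_on {0..b} (Mhat M)" for b
    unfolding Mhat_def[abs_def]
    by (intro indefinite_integral_continuous_1 integrable_continuous_real M_cont_on)
  then have "continuous (at x within {0..}) (Mhat M)" if "x \<ge> 0" for x
  proof -
    have "continuous (at x within {0..x+1}) (Mhat M)"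
      using \<open>\<And>b. continuous_on {0..b} (Mhat M)\<close> that by (simp add: continuous_on_eq_continuous_within)
    moreover have "at x within {0..x+1} = at x within {0..}"
      by (rule at_within_nhd[of x "{..<x+1}"]) auto
    ultimately show ?thesis by simp
  qed
  then show ?thesis by (simp add: continuous_on_eq_continuous_within)
qed

text \<open>On \<open>[0, t]\<close> the graph of \<open>M\<close> lies above the segment from
  \<open>(0, m0)\<close> to \<open>(t, M t)\<close>; the left side is the area under that
  segment.\<close>

lemma Mhat_lower:
  assumes t: "t \<ge> 0"
  shows "(M t + m0) / 2 * t \<le> Mhat M t"
proof (cases "t = 0")
  case False
  then have t: "t > 0" using assms by simp
  have "((\<lambda>x. m0 * x + (M t - m0) / t * (x\<^sup>2 / 2)) has_real_derivative m0 + (M t - m0) / t * x) (at x within {0..t})" for x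
    using t by (auto intro!: derivative_eq_intros)
  then have hi: "((\<lambda>x. m0 + (M t - m0) / t * x) has_integral
      (m0 * t + (M t - m0) / t * (t\<^sup>2 / 2) - (m0 * 0 + (M t - m0) / t * (0\<^sup>2 / 2)))) {0..t}"
    using t by (intro fundamental_theorem_of_calculus) (auto simp: has_real_derivative_iff_has_vector_derivative)
  have "m0 * t + (M t - m0) / t * (t\<^sup>2 / 2) \<le> integral {0..t} M"
  proof -
    have "integral {0..t} (\<lambda>x. m0 + (M t - m0) / t * x) \<le> integral {0..t} M"
    proof (rule Henstock_Kurzweil_Integration.integral_le)
      fix x assume x: "x \<in> {0..t}"
      show "m0 + (M t - m0) / t * x \<le> M x"
      proof (cases "x = 0")
        case False
        then have "(M t - m0) / t \<le> (M x - m0) / x" using x by (intro M_ratio) auto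
        then show ?thesis using False x by (simp add: field_simps)
      qed (use M_ge[of 0] in simp)
    qed (use hi in \<open>auto intro!: integrable_continuous_real M_cont_on simp: has_integral_integrable\<close>)
    then show ?thesis using integral_unique[OF hi] by simp
  qed
  moreover have "(M t - m0) / t * (t\<^sup>2 / 2) = (M t - m0) * t / 2" using t by (simp add: power2_eq_square)
  ultimately have "m0 * t + (M t - m0) * t / 2 \<le> Mhat M t" unfolding Mhat_def by (simp only:)
  then show ?thesis by (simp add: field_simps)
qed (simp add: Mhat_def)

end

section \<open>The energy functional\<close>

text \<open>\<open>B\<close> stands for the scaled domain, the set of all \<open>x\<close> with
  \<open>\<epsilon> *\<^sub>R x\<close> in the original one. Working with it removes
  \<open>\<epsilon>\<close> from the nonlinearity.\<close>

locale kirchhoff_problem =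
  weighted_space s V \<epsilon> V0 + nonlinearity f q \<theta> V0 K a + kirchhoff_function M m0
  for s :: real and V :: "R3 \<Rightarrow> real" and \<epsilon> V0 :: real and f :: "real \<Rightarrow> real" and q \<theta> K a :: real
    and M :: "real \<Rightarrow> real" and m0 :: real +
  fixes B :: "R3 set"
  assumes q_subcritical: "q < 6 / (3 - 2 * s)"
    and B_measurable [measurable]: "B \<in> sets borel" and B_finite: "emeasure lborel B < \<infinity>"
    and K_large: "2 / m0 < K"
begin

definition \<phi> :: "R3 \<Rightarrow> real \<Rightarrow> real" where
  "\<phi> x t = (if x \<in> B then f t else ft t)"

definition \<Phi> :: "R3 \<Rightarrow> real \<Rightarrow> real" where
  "\<Phi> x t = (if x \<in> B then primitive f t else primitive ft t)"

definition J :: "(R3 \<Rightarrow> real) \<Rightarrow> real" where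
  "J u = 1/2 * Mhat M (N u) - (LBINT x. \<Phi> x (u x))"

definition dI :: "(R3 \<Rightarrow> real) \<Rightarrow> (R3 \<Rightarrow> real) \<Rightarrow> real" where
  "dI u v = (LBINT x. \<phi> x (u x) * v x)"

definition dJ :: "(R3 \<Rightarrow> real) \<Rightarrow> (R3 \<Rightarrow> real) \<Rightarrow> real" where
  "dJ u v = M (N u) * inner_eps u v - dI u v"

lemma q2: "2 \<le> q" using q4 by simp

lemma f_measurable [measurable]: "f \<in> borel_measurable borel"
  by (rule borel_measurable_continuous_onI[OF f_cont])

lemma ft_measurable [measurable]: "ft \<in> borel_measurable borel"
  by (rule borel_measurable_continuous_onI[OF ft_cont])

lemma primitive_f_cont: "continuous_on UNIV (primitive f)"
  using primitive_f_deriv DERIV_isCont by (simp add: continuous_on_eq_continuous_at) blast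

lemma primitive_ft_cont: "continuous_on UNIV (primitive ft)"
  using primitive_ft_deriv DERIV_isCont by (simp add: continuous_on_eq_continuous_at) blast

lemma primitive_measurable [measurable]:
  "primitive f \<in> borel_measurable borel" "primitive ft \<in> borel_measurable borel"
  by (rule borel_measurable_continuous_onI[OF primitive_f_cont] borel_measurable_continuous_onI[OF primitive_ft_cont])+

lemma \<phi>_measurable [measurable]:
  "u \<in> borel_measurable borel \<Longrightarrow> (\<lambda>x. \<phi> x (u x)) \<in> borel_measurable borel"
  unfolding \<phi>_def using B_measurable
  by (intro measurable_If measurable_compose[OF _ f_measurable] measurable_compose[OF _ ft_measurable]) auto

lemma \<Phi>_measurable [measurable]:
  "u \<in> borel_measurable borel \<Longrightarrow> (\<lambda>x. \<Phi> x (u x)) \<in> borel_measurable borel"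
  unfolding \<Phi>_def using B_measurable
  by (intro measurable_If measurable_compose[OF _ primitive_measurable(1)]
      measurable_compose[OF _ primitive_measurable(2)]) auto

lemma \<phi>_nonneg: "0 \<le> \<phi> x t"
  by (simp add: \<phi>_def f_nonneg ft_nonneg)

lemma \<phi>_le_f: "\<phi> x t \<le> f t"
  by (simp add: \<phi>_def ft_le_f)

lemma \<phi>_nonpos_zero: "t \<le> 0 \<Longrightarrow> \<phi> x t = 0"
  by (simp add: \<phi>_def f_nonpos_zero ft_nonpos_zero)

lemma \<phi>_cont: "isCont (\<phi> x) t"
  using f_cont ft_cont by (cases "x \<in> B") (auto simp: \<phi>_def[abs_def] continuous_on_eq_continuous_at)

lemma \<Phi>_deriv: "(\<Phi> x has_real_derivative \<phi> x t) (at t)"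
  using primitive_f_deriv primitive_ft_deriv by (cases "x \<in> B") (auto simp: \<Phi>_def[abs_def] \<phi>_def)

lemma \<Phi>_0: "\<Phi> x 0 = 0"
  by (simp add: \<Phi>_def primitive_nonpos)

lemma \<Phi>_pos_part: "\<Phi> x (max 0 t) = \<Phi> x t"
  by (cases "t \<le> 0") (auto simp: \<Phi>_def primitive_nonpos max_def)

lemma f_le_abs:
  assumes "\<bar>t\<bar> \<le> U"
  shows "f t \<le> f U"
  using assms f_mono[of t U] f_nonneg[of U] f_nonpos_zero[of t] by (cases "t > 0") auto

lemma f_majorant:
  obtains C where "C > 0" "\<And>U. 0 \<le> U \<Longrightarrow> f U * U \<le> C * (U\<^sup>2 + U powr q)"
proof -
  obtain C where C: "C > 0" "\<And>t. 0 \<le> t \<Longrightarrow> f t \<le> 1 * t + C * t powr (q - 1)"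
    using f_growth[of 1] by auto
  have "f U * U \<le> (C + 1) * (U\<^sup>2 + U powr q)" if U: "0 \<le> U" for U
  proof -
    have "f U * U \<le> (1 * U + C * U powr (q - 1)) * U" using C U by (intro mult_right_mono) auto
    also have "\<dots> = U\<^sup>2 + C * U powr q"
      using U by (cases "U = 0") (auto simp: power2_eq_square powr_diff algebra_simps)
    also have "\<dots> \<le> (C + 1) * (U\<^sup>2 + U powr q)" using C by (simp add: algebra_simps)
    finally show ?thesis .
  qed
  then show ?thesis using that[of "C + 1"] C by auto
qed

text \<open>Since \<open>f\<close> is nondecreasing, \<open>f U * U\<close> dominates the integrand
  for all arguments below \<open>U\<close> at once. With \<open>U\<close> a multiple of a sum of
  absolute values of elements of \<open>H\<close>, it is the majorant in every dominated convergence
  argument for \<open>dI\<close>.\<close>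

lemma \<phi>_dominated: "\<bar>t\<bar> \<le> U \<Longrightarrow> \<bar>w\<bar> \<le> U \<Longrightarrow> \<bar>\<phi> x t * w\<bar> \<le> f U * U"
  using \<phi>_nonneg[of x t] \<phi>_le_f[of x t] f_le_abs[of t U] f_nonneg[of U]
  by (auto simp: abs_mult intro!: mult_mono)

lemma \<Phi>_lipschitz:
  assumes "\<bar>y\<bar> \<le> U" "\<bar>z\<bar> \<le> U"
  shows "\<bar>\<Phi> x y - \<Phi> x z\<bar> \<le> f U * \<bar>y - z\<bar>"
proof -
  have "norm (\<Phi> x y - \<Phi> x z) \<le> f U * norm (y - z)"
  proof (rule field_differentiable_bound[of "{-U..U}"])
    fix t assume "t \<in> {-U..U}"
    then have "\<bar>t\<bar> \<le> U" by auto
    then show "norm (\<phi> x t) \<le> f U" using \<phi>_nonneg[of x t] \<phi>_le_f[of x t] f_le_abs[of t U] by simp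
    show "(\<Phi> x has_field_derivative \<phi> x t) (at t within {-U..U})"
      by (rule has_field_derivative_at_within[OF \<Phi>_deriv])
  qed (use assms in auto)
  then show ?thesis by simp
qed

lemma H_abs: "u \<in> H \<Longrightarrow> (\<lambda>x. \<bar>u x\<bar>) \<in> H"
  by (rule H_contraction) auto

lemma majorant_integrable:
  assumes "u \<in> H" and "\<And>x. 0 \<le> u x"
  shows "integrable lborel (\<lambda>x. f (u x) * u x)"
proof -
  note [measurable] = H_measurable[OF assms(1)]
  obtain C where C: "C > 0" "\<And>U. 0 \<le> U \<Longrightarrow> f U * U \<le> C * (U\<^sup>2 + U powr q)" by (rule f_majorant) blast
  show ?thesis
  proof (rule Bochner_Integration.integrable_bound)
    show "integrable lborel (\<lambda>x. C * ((u x)\<^sup>2 + \<bar>u x\<bar> powr q))"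
      using H_square[OF assms(1)] H_powr_integrable[OF assms(1) q2 q_subcritical] by auto
    show "AE x in lborel. norm (f (u x) * u x) \<le> norm (C * ((u x)\<^sup>2 + \<bar>u x\<bar> powr q))"
      using C(2)[OF assms(2)] assms(2) C(1) f_nonneg by (intro AE_I2) (simp add: abs_mult)
  qed measurable
qed

lemma majorant2_integrable:
  assumes "u \<in> H" "v \<in> H" "w \<in> H" "c \<ge> 0"
  shows "integrable lborel (\<lambda>x. f (c * (\<bar>u x\<bar> + \<bar>v x\<bar> + \<bar>w x\<bar>)) * (c * (\<bar>u x\<bar> + \<bar>v x\<bar> + \<bar>w x\<bar>)))"
proof (rule majorant_integrable)
  have "(\<lambda>x. 1 * \<bar>u x\<bar> + 1 * \<bar>v x\<bar>) \<in> H" using assms by (intro H_linear H_abs)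
  then have "(\<lambda>x. 1 * (1 * \<bar>u x\<bar> + 1 * \<bar>v x\<bar>) + 1 * \<bar>w x\<bar>) \<in> H" using assms by (intro H_linear H_abs)
  then have "(\<lambda>x. c * (1 * (1 * \<bar>u x\<bar> + 1 * \<bar>v x\<bar>) + 1 * \<bar>w x\<bar>)) \<in> H" by (rule H_scale)
  then show "(\<lambda>x. c * (\<bar>u x\<bar> + \<bar>v x\<bar> + \<bar>w x\<bar>)) \<in> H" by simp
qed (use assms in auto)

lemma \<phi>_integrable:
  assumes "u \<in> H" "v \<in> H"
  shows "integrable lborel (\<lambda>x. \<phi> x (u x) * v x)"
proof (rule Bochner_Integration.integrable_bound)
  note [measurable] = H_measurable[OF assms(1)] H_measurable[OF assms(2)]
  \<comment> \<open>The majorant expects three functions; \<open>v\<close> is listed twice to fill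
    the third place.\<close>
  let ?U = "\<lambda>x. 1 * (\<bar>u x\<bar> + \<bar>v x\<bar> + \<bar>v x\<bar>)"
  show "integrable lborel (\<lambda>x. f (?U x) * ?U x)" using assms by (intro majorant2_integrable) auto
  show "AE x in lborel. norm (\<phi> x (u x) * v x) \<le> norm (f (?U x) * ?U x)"
  proof (intro AE_I2)
    fix x
    have "\<bar>\<phi> x (u x) * v x\<bar> \<le> f (?U x) * ?U x" by (rule \<phi>_dominated) auto
    then show "norm (\<phi> x (u x) * v x) \<le> norm (f (?U x) * ?U x)" by simp
  qed
  show "(\<lambda>x. \<phi> x (u x) * v x) \<in> borel_measurable lborel" by measurable
qed

lemma \<Phi>_integrable:
  assumes "u \<in> H"
  shows "integrable lborel (\<lambda>x. \<Phi> x (u x))"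
proof (rule Bochner_Integration.integrable_bound)
  note [measurable] = H_measurable[OF assms]
  show "integrable lborel (\<lambda>x. f \<bar>u x\<bar> * \<bar>u x\<bar>)" using assms by (intro majorant_integrable H_abs) auto
  show "AE x in lborel. norm (\<Phi> x (u x)) \<le> norm (f \<bar>u x\<bar> * \<bar>u x\<bar>)"
  proof (intro AE_I2)
    fix x
    have "\<bar>\<Phi> x (u x) - \<Phi> x 0\<bar> \<le> f \<bar>u x\<bar> * \<bar>u x - 0\<bar>" by (rule \<Phi>_lipschitz) auto
    then show "norm (\<Phi> x (u x)) \<le> norm (f \<bar>u x\<bar> * \<bar>u x\<bar>)" by (simp add: \<Phi>_0)
  qed
  show "(\<lambda>x. \<Phi> x (u x)) \<in> borel_measurable lborel" by measurable
qed

section \<open>Continuity and differentiability of the energy\<close>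

lemma dI_sequential:
  assumes u: "u \<in> H" and v: "v \<in> H" and w: "w \<in> H" and X: "X \<longlonglongrightarrow> \<alpha>" and Y: "Y \<longlonglongrightarrow> \<beta>"
  shows "(\<lambda>n. dI (\<lambda>x. X n * u x + Y n * v x) w) \<longlonglongrightarrow> dI (\<lambda>x. \<alpha> * u x + \<beta> * v x) w"
proof -
  note [measurable] = H_measurable[OF u] H_measurable[OF v] H_measurable[OF w]
  have "Bseq X" "Bseq Y" using X Y convergentI convergent_imp_Bseq by blast+
  then obtain b c where b: "\<And>n. \<bar>X n\<bar> \<le> b" and c: "\<And>n. \<bar>Y n\<bar> \<le> c" unfolding Bseq_def by auto
  define d where "d = 1 + \<bar>b\<bar> + \<bar>c\<bar>"
  have d: "d \<ge> 1" "\<bar>X n\<bar> \<le> d" "\<bar>Y n\<bar> \<le> d" for n using b[of n] c[of n] by (auto simp: d_def)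
  let ?U = "\<lambda>x. d * (\<bar>u x\<bar> + \<bar>v x\<bar> + \<bar>w x\<bar>)"
  show ?thesis unfolding dI_def
  proof (rule integral_dominated_convergence[where w = "\<lambda>x. f (?U x) * ?U x"])
    show "integrable lborel (\<lambda>x. f (?U x) * ?U x)" using u v w d by (intro majorant2_integrable) auto
    show "AE x in lborel. norm (\<phi> x (X n * u x + Y n * v x) * w x) \<le> f (?U x) * ?U x" for n
    proof (intro AE_I2)
      fix x
      have "\<bar>X n * u x + Y n * v x\<bar> \<le> \<bar>X n\<bar> * \<bar>u x\<bar> + \<bar>Y n\<bar> * \<bar>v x\<bar>"
        using abs_triangle_ineq[of "X n * u x" "Y n * v x"] by (simp add: abs_mult)
      also have "\<dots> \<le> d * \<bar>u x\<bar> + d * \<bar>v x\<bar>" using d by (intro add_mono mult_right_mono) auto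
      also have "\<dots> \<le> ?U x" using d by (simp add: algebra_simps)
      finally have 1: "\<bar>X n * u x + Y n * v x\<bar> \<le> ?U x" .
      have "1 * \<bar>w x\<bar> \<le> d * \<bar>w x\<bar>" using d by (intro mult_right_mono) auto
      also have "\<dots> \<le> ?U x" using d by (intro mult_left_mono) auto
      finally have 2: "\<bar>w x\<bar> \<le> ?U x" by simp
      show "norm (\<phi> x (X n * u x + Y n * v x) * w x) \<le> f (?U x) * ?U x"
        using \<phi>_dominated[OF 1 2] by simp
    qed
    show "AE x in lborel. (\<lambda>n. \<phi> x (X n * u x + Y n * v x) * w x) \<longlonglongrightarrow> \<phi> x (\<alpha> * u x + \<beta> * v x) * w x"
      by (intro AE_I2 tendsto_mult_right isCont_tendsto_compose[OF \<phi>_cont] tendsto_intros X Y)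
  qed measurable
qed

text \<open>\<open>M\<close> is continuous on the nonnegative numbers only. The clamp extends it
  continuously and changes nothing at values of \<open>N\<close>.\<close>

lemma M_clamp_cont: "continuous_on UNIV (\<lambda>t. M (max 0 t))"
  by (rule continuous_on_compose2[OF M_cont]) (auto intro!: continuous_intros)

text \<open>Continuity is claimed only in the two coefficients, which reduces it to dominated
  convergence along sequences of pairs. It supports the intermediate value and neighbourhood
  arguments on planes.\<close>

lemma dJ_continuous:
  assumes u: "u \<in> H" and v: "v \<in> H" and w: "w \<in> H"
  shows "continuous_on UNIV (\<lambda>p. dJ (\<lambda>x. fst p * u x + snd p * v x) w)"
proof -
  have dI: "continuous_on UNIV (\<lambda>p. dI (\<lambda>x. fst p * u x + snd p * v x) w)"
    unfolding continuous_on_sequentially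
  proof clarsimp
    fix X :: "nat \<Rightarrow> real \<times> real" and \<alpha> \<beta> assume X: "X \<longlonglongrightarrow> (\<alpha>, \<beta>)"
    show "((\<lambda>p. dI (\<lambda>x. fst p * u x + snd p * v x) w) \<circ> X) \<longlonglongrightarrow> dI (\<lambda>x. \<alpha> * u x + \<beta> * v x) w"
      using dI_sequential[OF u v w tendsto_fst[OF X] tendsto_snd[OF X]] by (simp add: o_def)
  qed
  have "dJ (\<lambda>x. fst p * u x + snd p * v x) w =
     M (max 0 ((fst p)\<^sup>2 * N u + 2 * fst p * snd p * inner_eps u v + (snd p)\<^sup>2 * N v)) * (fst p * inner_eps u w + snd p * inner_eps v w)
     - dI (\<lambda>x. fst p * u x + snd p * v x) w" for p
    using N_nonneg[of "\<lambda>x. fst p * u x + snd p * v x"]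
    by (simp add: dJ_def inner_linear[OF u v w] N_linear[OF u v] max_absorb2)
  then show ?thesis
    by (simp only:) (intro continuous_intros dI continuous_on_compose2[OF M_clamp_cont], auto)
qed

text \<open>Along a bounded sequence of steps the Lipschitz bound of \<open>\<Phi>\<close> dominates
  all difference quotients by one \<open>f U * U\<close>, so the derivative may be taken under the
  integral.\<close>

lemma dI_deriv:
  assumes u: "u \<in> H" and v: "v \<in> H"
  shows "((\<lambda>t. LBINT x. \<Phi> x (u x + t * v x)) has_real_derivative dI u v) (at 0)"
  unfolding DERIV_def tendsto_at_iff_sequentially
proof (intro allI impI)
  fix X :: "nat \<Rightarrow> real" assume X0: "\<forall>i. X i \<in> UNIV - {0}" and X: "X \<longlonglongrightarrow> 0"
  note [measurable] = H_measurable[OF u] H_measurable[OF v]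
  have "Bseq X" using X convergentI convergent_imp_Bseq by blast
  then obtain b where b: "\<And>n. \<bar>X n\<bar> \<le> b" unfolding Bseq_def by auto
  define d where "d = 1 + \<bar>b\<bar>"
  have d: "d \<ge> 1" "\<bar>X n\<bar> \<le> d" for n using b[of n] by (auto simp: d_def)
  let ?U = "\<lambda>x. d * (\<bar>u x\<bar> + \<bar>v x\<bar> + \<bar>v x\<bar>)"
  have "(\<lambda>n. LBINT x. (\<Phi> x (u x + X n * v x) - \<Phi> x (u x)) / X n) \<longlonglongrightarrow> (LBINT x. \<phi> x (u x) * v x)"
  proof (rule integral_dominated_convergence[where w = "\<lambda>x. f (?U x) * ?U x"])
    show "integrable lborel (\<lambda>x. f (?U x) * ?U x)" using u v d by (intro majorant2_integrable) auto
    show "AE x in lborel. norm ((\<Phi> x (u x + X n * v x) - \<Phi> x (u x)) / X n) \<le> f (?U x) * ?U x" for n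
    proof (intro AE_I2)
      fix x
      have ud: "1 * \<bar>u x\<bar> \<le> d * \<bar>u x\<bar>" using d by (intro mult_right_mono) auto
      have vd: "1 * \<bar>v x\<bar> \<le> d * \<bar>v x\<bar>" using d by (intro mult_right_mono) auto
      have Xd: "\<bar>X n\<bar> * \<bar>v x\<bar> \<le> d * \<bar>v x\<bar>" using d by (intro mult_right_mono) auto
      have "\<bar>u x + X n * v x\<bar> \<le> \<bar>u x\<bar> + \<bar>X n\<bar> * \<bar>v x\<bar>"
        using abs_triangle_ineq[of "u x" "X n * v x"] by (simp add: abs_mult)
      then have 1: "\<bar>u x + X n * v x\<bar> \<le> ?U x" using ud Xd vd unfolding distrib_left by linarith
      have 2: "\<bar>u x\<bar> \<le> ?U x" using ud vd unfolding distrib_left by linarith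
      have 3: "\<bar>v x\<bar> \<le> ?U x" using ud vd unfolding distrib_left by linarith
      have "\<bar>\<Phi> x (u x + X n * v x) - \<Phi> x (u x)\<bar> \<le> f (?U x) * \<bar>(u x + X n * v x) - u x\<bar>"
        by (rule \<Phi>_lipschitz[OF 1 2])
      then have "\<bar>\<Phi> x (u x + X n * v x) - \<Phi> x (u x)\<bar> / \<bar>X n\<bar> \<le> f (?U x) * \<bar>v x\<bar>"
        using X0 by (simp add: abs_mult field_simps)
      also have "\<dots> \<le> f (?U x) * ?U x" using 3 f_nonneg by (intro mult_left_mono) auto
      finally show "norm ((\<Phi> x (u x + X n * v x) - \<Phi> x (u x)) / X n) \<le> f (?U x) * ?U x" by simp
    qed
    show "AE x in lborel. (\<lambda>n. (\<Phi> x (u x + X n * v x) - \<Phi> x (u x)) / X n) \<longlonglongrightarrow> \<phi> x (u x) * v x"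
    proof (intro AE_I2)
      fix x
      have "((\<lambda>t. \<Phi> x (u x + t * v x)) has_real_derivative \<phi> x (u x) * v x) (at 0)"
        by (rule DERIV_chain'[where f = "\<lambda>t. u x + t * v x" and g = "\<Phi> x", THEN DERIV_cong])
           (auto intro!: derivative_eq_intros \<Phi>_deriv[THEN DERIV_cong])
      then show "(\<lambda>n. (\<Phi> x (u x + X n * v x) - \<Phi> x (u x)) / X n) \<longlonglongrightarrow> \<phi> x (u x) * v x"
        unfolding DERIV_def tendsto_at_iff_sequentially using X0 X by (auto simp: o_def)
    qed
  qed measurable
  moreover have "(LBINT x. (\<Phi> x (u x + X n * v x) - \<Phi> x (u x)) / X n) =
      ((LBINT x. \<Phi> x (u x + X n * v x)) - (LBINT x. \<Phi> x (u x))) / X n" for n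
    using \<Phi>_integrable[OF H_add_scale[OF u v]] \<Phi>_integrable[OF u] by simp
  ultimately have "(\<lambda>n. ((LBINT x. \<Phi> x (u x + X n * v x)) - (LBINT x. \<Phi> x (u x))) / X n) \<longlonglongrightarrow> dI u v"
    unfolding dI_def by (simp only:)
  then show "((\<lambda>h. ((LBINT x. \<Phi> x (u x + (0 + h) * v x)) - (LBINT x. \<Phi> x (u x + 0 * v x))) / h) \<circ> X) \<longlonglongrightarrow> dI u v"
    by (simp add: o_def)
qed

lemma J_deriv0:
  assumes u: "u \<in> H" and v: "v \<in> H" and N: "N u > 0"
  shows "((\<lambda>t. J (\<lambda>x. u x + t * v x)) has_real_derivative dJ u v) (at 0)"
proof -
  have Nt: "N (\<lambda>x. u x + t * v x) = N u + 2 * t * inner_eps u v + t\<^sup>2 * N v" for t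
    using N_linear[OF u v, of 1 t] by simp
  have "((\<lambda>t. Mhat M (N u + 2 * t * inner_eps u v + t\<^sup>2 * N v)) has_real_derivative M (N u) * (2 * inner_eps u v)) (at 0)"
    by (rule DERIV_chain'[where f = "\<lambda>t. N u + 2 * t * inner_eps u v + t\<^sup>2 * N v" and g = "Mhat M", THEN DERIV_cong])
       (auto intro!: derivative_eq_intros Mhat_deriv[OF N, THEN DERIV_cong])
  then have "((\<lambda>t. 1/2 * Mhat M (N u + 2 * t * inner_eps u v + t\<^sup>2 * N v) - (LBINT x. \<Phi> x (u x + t * v x)))
      has_real_derivative 1/2 * (M (N u) * (2 * inner_eps u v)) - dI u v) (at 0)"
    by (intro derivative_intros dI_deriv u v DERIV_cmult)
  then show ?thesis by (simp add: J_def Nt dJ_def)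
qed

lemma J_deriv:
  assumes u: "u \<in> H" and v: "v \<in> H" and N: "N (\<lambda>x. u x + t * v x) > 0"
  shows "((\<lambda>t. J (\<lambda>x. u x + t * v x)) has_real_derivative dJ (\<lambda>x. u x + t * v x) v) (at t)"
proof -
  have "((\<lambda>h. J (\<lambda>x. (u x + t * v x) + h * v x)) has_real_derivative dJ (\<lambda>x. u x + t * v x) v) (at 0)"
    by (rule J_deriv0[OF H_add_scale[OF u v] v N])
  then have "((\<lambda>h. J (\<lambda>x. u x + (h + t) * v x)) has_real_derivative dJ (\<lambda>x. u x + t * v x) v) (at 0)"
    by (simp add: algebra_simps)
  then show ?thesis using DERIV_shift[of "\<lambda>t. J (\<lambda>x. u x + t * v x)" _ 0 t] by simp
qed

lemma dI_linear:
  assumes z: "z \<in> H" and u: "u \<in> H" and v: "v \<in> H"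
  shows "dI z (\<lambda>x. \<alpha> * u x + \<beta> * v x) = \<alpha> * dI z u + \<beta> * dI z v"
proof -
  have "\<phi> x (z x) * (\<alpha> * u x + \<beta> * v x) = \<alpha> * (\<phi> x (z x) * u x) + \<beta> * (\<phi> x (z x) * v x)" for x
    by (simp add: algebra_simps)
  then show ?thesis unfolding dI_def using \<phi>_integrable[OF z u] \<phi>_integrable[OF z v] by (simp only:) simp
qed

lemma dJ_linear:
  assumes z: "z \<in> H" and u: "u \<in> H" and v: "v \<in> H"
  shows "dJ z (\<lambda>x. \<alpha> * u x + \<beta> * v x) = \<alpha> * dJ z u + \<beta> * dJ z v"
  unfolding dJ_def dI_linear[OF z u v] inner_commute[of z "\<lambda>x. \<alpha> * u x + \<beta> * v x"] inner_linear[OF u v z]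
  by (simp add: inner_commute[of _ z] algebra_simps)

lemma nehari_eq: "nehari H J = {u \<in> H. N u > 0 \<and> dJ u u = 0}"
proof -
  have "J_dir_deriv J u u 0 \<longleftrightarrow> dJ u u = 0" if "u \<in> H" "N u > 0" for u
    using J_deriv0[OF that(1,1,2)] by (auto simp: J_dir_deriv_def dest: DERIV_unique)
  then show ?thesis unfolding nehari_def using nontrivial_iff by auto
qed

section \<open>The Nehari set\<close>

text \<open>This is how the size of \<open>K\<close> enters: outside \<open>B\<close> the nonlinear
  term takes at most \<open>1 / K\<close> of the potential part, which is less than
  \<open>m0 / 2\<close> of it.\<close>

lemma inverse_K: "1 / K < m0 / 2"
  using K_large m0_pos K_pos by (simp add: field_simps)

lemma dJ_ray:
  assumes u: "u \<in> H"
  shows "dJ (\<lambda>x. t * u x) u = M (t\<^sup>2 * N u) * (t * N u) - dI (\<lambda>x. t * u x) u"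
  using inner_linear[OF u u u, of t 0] by (simp add: dJ_def N_scale[OF u] N_inner[OF u])

text \<open>The quotient is a sum of four nonincreasing terms. \<open>1 / K\<close> of the potential
  part is lent to the nonlinear term, which needs it outside \<open>B\<close>; the remainder
  \<open>(m0 - 1/K) * N u / t^2\<close> is strictly decreasing.\<close>

lemma dJ_ray_decreasing:
  assumes u: "u \<in> H" and N: "N u > 0" and t: "0 < t1" "t1 < t2"
  shows "dJ (\<lambda>x. t2 * u x) u / t2 ^ 3 < dJ (\<lambda>x. t1 * u x) u / t1 ^ 3"
proof -
  define n where "n = N u"
  have n: "n > 0" using N by (simp add: n_def)
  let ?p = "\<lambda>t x. W x * (u x)\<^sup>2 / (K * t\<^sup>2) - \<phi> x (t * u x) * u x / t ^ 3"
  have int: "integrable lborel (?p t)" for t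
    using H_pot[OF u] \<phi>_integrable[OF H_scale[OF u] u, of t] by (intro Bochner_Integration.integrable_diff integrable_divide)
  have pint: "(LBINT x. ?p t x) = pot u / (K * t\<^sup>2) - dI (\<lambda>x. t * u x) u / t ^ 3" for t
    using H_pot[OF u] \<phi>_integrable[OF H_scale[OF u] u, of t] by (simp add: pot_eq(1)[OF u] dI_def)
  have "(LBINT x. ?p t2 x) \<le> (LBINT x. ?p t1 x)"
  proof (rule Bochner_Integration.integral_mono[OF int int])
    fix x
    show "?p t2 x \<le> ?p t1 x"
    proof (cases "x \<in> B")
      case True
      have "W x * (u x)\<^sup>2 / (K * t2\<^sup>2) \<le> W x * (u x)\<^sup>2 / (K * t1\<^sup>2)"
        using t K_pos W_nonneg[of x] by (intro divide_left_mono mult_left_mono power_mono) auto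
      then show ?thesis using f_ray_mono[of t1 t2 "u x"] t True by (simp add: \<phi>_def)
    next
      case False
      then show ?thesis using ft_ray_mono[of t1 t2 "W x" "u x"] t V_ge by (simp add: \<phi>_def)
    qed
  qed
  then have p: "pot u / (K * t2\<^sup>2) - dI (\<lambda>x. t2 * u x) u / t2 ^ 3 \<le> pot u / (K * t1\<^sup>2) - dI (\<lambda>x. t1 * u x) u / t1 ^ 3"
    by (simp only: pint)
  have eq: "dJ (\<lambda>x. t * u x) u / t ^ 3 = (M (t\<^sup>2 * n) - m0) / (t\<^sup>2 * n) * n\<^sup>2 + (m0 - 1/K) * n / t\<^sup>2
      + gagliardo s u / (K * t\<^sup>2) + (pot u / (K * t\<^sup>2) - dI (\<lambda>x. t * u x) u / t ^ 3)" if t: "t > 0" for t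
  proof -
    have "dJ (\<lambda>x. t * u x) u / t ^ 3 = M (t\<^sup>2 * n) * n / t\<^sup>2 - dI (\<lambda>x. t * u x) u / t ^ 3"
      using t by (simp add: dJ_ray[OF u] n_def diff_divide_distrib power2_eq_square power3_eq_cube)
    moreover have "(M (t\<^sup>2 * n) - m0) / (t\<^sup>2 * n) * n\<^sup>2 = (M (t\<^sup>2 * n) - m0) * n / t\<^sup>2"
      using t n by (simp add: power2_eq_square)
    moreover have "gagliardo s u / (K * t\<^sup>2) + pot u / (K * t\<^sup>2) = (1/K) * n / t\<^sup>2"
      by (simp add: n_def N_eq add_divide_distrib)
    moreover have "M (t\<^sup>2 * n) * n / t\<^sup>2 = (M (t\<^sup>2 * n) - m0) * n / t\<^sup>2 + (m0 - 1/K) * n / t\<^sup>2 + (1/K) * n / t\<^sup>2"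
      by (simp only: add_divide_distrib[symmetric] distrib_right[symmetric]) simp
    ultimately show ?thesis by linarith
  qed
  have t12: "t1\<^sup>2 < t2\<^sup>2" using t by (intro power_strict_mono) auto
  have "(M (t2\<^sup>2 * n) - m0) / (t2\<^sup>2 * n) * n\<^sup>2 \<le> (M (t1\<^sup>2 * n) - m0) / (t1\<^sup>2 * n) * n\<^sup>2"
    using t n t12 by (intro mult_right_mono M_ratio) auto
  moreover have "(m0 - 1/K) * n / t2\<^sup>2 < (m0 - 1/K) * n / t1\<^sup>2"
    using t n t12 inverse_K m0_pos by (intro divide_strict_left_mono mult_pos_pos) auto
  moreover have "gagliardo s u / (K * t2\<^sup>2) \<le> gagliardo s u / (K * t1\<^sup>2)"
    using t K_pos t12 gagliardo_nonneg by (intro divide_left_mono mult_left_mono) auto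
  ultimately show ?thesis using p eq[of t1] eq[of t2] t by linarith
qed

lemma dJ_ray_scale:
  assumes u: "u \<in> H"
  shows "dJ (\<lambda>x. t * u x) (\<lambda>x. t * u x) = t * dJ (\<lambda>x. t * u x) u"
  using dJ_linear[OF H_scale[OF u] u u, of t t 0] by simp

lemma J_ray_deriv:
  assumes u: "u \<in> H" and "N u > 0" "t > 0"
  shows "((\<lambda>t. J (\<lambda>x. t * u x)) has_real_derivative dJ (\<lambda>x. t * u x) u) (at t)"
  \<comment> \<open>The ray is the affine line through \<open>0 * u\<close> with direction
    \<open>u\<close>.\<close>
  using J_deriv[OF H_scale[OF u, of 0] u, of t] assms by (simp add: N_scale)

lemma dJ_ray_sign:
  assumes u: "u \<in> nehari H J"
  shows "0 < t \<Longrightarrow> t < 1 \<Longrightarrow> dJ (\<lambda>x. t * u x) u > 0" and "1 < t \<Longrightarrow> dJ (\<lambda>x. t * u x) u < 0"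
proof -
  have uH: "u \<in> H" "N u > 0" "dJ u u = 0" using u by (auto simp: nehari_eq)
  show "dJ (\<lambda>x. t * u x) u > 0" if "0 < t" "t < 1"
    using dJ_ray_decreasing[OF uH(1,2) that] uH(3) that by (simp add: zero_less_divide_iff)
  show "dJ (\<lambda>x. t * u x) u < 0" if "1 < t"
    using dJ_ray_decreasing[OF uH(1,2) _ that] uH(3) that by (simp add: divide_less_0_iff)
qed

lemma J_ray_max:
  assumes u: "u \<in> nehari H J" and t: "t > 0"
  shows "J (\<lambda>x. t * u x) \<le> J u"
proof -
  have uH: "u \<in> H" "N u > 0" "dJ u u = 0" using u by (auto simp: nehari_eq)
  let ?g = "\<lambda>t. J (\<lambda>x. t * u x)"
  have "?g t \<le> ?g 1"
  proof (cases "t \<le> 1")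
    case True
    show ?thesis
    proof (rule DERIV_nonneg_imp_nondecreasing[where f = ?g, OF True])
      fix x assume x: "t \<le> x" "x \<le> 1"
      have "0 \<le> dJ (\<lambda>y. x * u y) u"
        using dJ_ray_sign(1)[OF u, of x] uH(3) x t by (cases "x = 1") auto
      then show "\<exists>y. (?g has_real_derivative y) (at x) \<and> 0 \<le> y"
        using J_ray_deriv[OF uH(1,2), of x] x t by auto
    qed
  next
    case False
    then have "1 \<le> t" by simp
    then show ?thesis
    proof (rule DERIV_nonpos_imp_nonincreasing[where f = ?g])
      fix x assume x: "1 \<le> x" "x \<le> t"
      have "dJ (\<lambda>y. x * u y) u \<le> 0"
        using dJ_ray_sign(2)[OF u, of x] uH(3) x t by (cases "x = 1") auto
      then show "\<exists>y. (?g has_real_derivative y) (at x) \<and> y \<le> 0"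
        using J_ray_deriv[OF uH(1,2), of x] x t by auto
    qed
  qed
  then show ?thesis by simp
qed

section \<open>Lower bounds on the Nehari set\<close>

lemma f_local_integrable:
  assumes u: "u \<in> H"
  shows "integrable lborel (\<lambda>x. indicator B x * (f (u x) * u x))"
proof (rule Bochner_Integration.integrable_bound)
  note [measurable] = H_measurable[OF u]
  show "integrable lborel (\<lambda>x. f \<bar>u x\<bar> * \<bar>u x\<bar>)" using u by (intro majorant_integrable H_abs) auto
  show "AE x in lborel. norm (indicator B x * (f (u x) * u x)) \<le> norm (f \<bar>u x\<bar> * \<bar>u x\<bar>)"
  proof (intro AE_I2)
    fix x
    have "\<bar>f (u x) * u x\<bar> \<le> f \<bar>u x\<bar> * \<bar>u x\<bar>"
      using f_le_abs[of "u x" "\<bar>u x\<bar>"] f_nonneg[of "u x"] by (auto simp: abs_mult intro!: mult_right_mono)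
    then show "norm (indicator B x * (f (u x) * u x)) \<le> norm (f \<bar>u x\<bar> * \<bar>u x\<bar>)"
      by (auto simp: indicator_def)
  qed
  show "(\<lambda>x. indicator B x * (f (u x) * u x)) \<in> borel_measurable lborel"
    using B_measurable by measurable
qed

text \<open>On the Nehari set \<open>dI u u = M (N u) * N u >= m0 * N u\<close>, and the part of
  \<open>dI u u\<close> outside \<open>B\<close> is at most
  \<open>pot u / K <= m0 / 2 * N u\<close>. The rest must come from inside \<open>B\<close>; this
  later rules out a trivial limit.\<close>

lemma nehari_local_mass:
  assumes u: "u \<in> nehari H J"
  shows "m0 / 2 * N u \<le> (LBINT x. indicator B x * (f (u x) * u x))"
proof -
  have uH: "u \<in> H" "N u > 0" "dJ u u = 0" using u by (auto simp: nehari_eq)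
  have "dI u u \<le> (LBINT x. indicator B x * (f (u x) * u x) + 1/K * (W x * (u x)\<^sup>2))"
    unfolding dI_def
  proof (rule Bochner_Integration.integral_mono)
    fix x
    show "\<phi> x (u x) * u x \<le> indicator B x * (f (u x) * u x) + 1/K * (W x * (u x)\<^sup>2)"
    proof (cases "x \<in> B")
      case True
      then show ?thesis using K_pos W_nonneg[of x] by (simp add: \<phi>_def)
    next
      case False
      have "ft (u x) * u x \<le> 1/K * (W x * (u x)\<^sup>2)"
      proof (cases "u x \<le> 0")
        case True
        then show ?thesis using K_pos W_nonneg[of x] by (simp add: ft_nonpos_zero)
      next
        case False
        have "ft (u x) * u x \<le> V0 / K * u x * u x" using False ft_le_linear[of "u x"] by (intro mult_right_mono) auto
        also have "\<dots> = 1/K * (V0 * (u x)\<^sup>2)" by (simp add: power2_eq_square)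
        also have "\<dots> \<le> 1/K * (W x * (u x)\<^sup>2)" using K_pos V_ge by (intro mult_left_mono mult_right_mono) auto
        finally show ?thesis .
      qed
      then show ?thesis using False by (simp add: \<phi>_def)
    qed
  qed (use uH H_pot[OF uH(1)] f_local_integrable[OF uH(1)] \<phi>_integrable[OF uH(1) uH(1)] in auto)
  also have "\<dots> = (LBINT x. indicator B x * (f (u x) * u x)) + 1/K * pot u"
    using H_pot[OF uH(1)] f_local_integrable[OF uH(1)] by (simp add: pot_eq(1)[OF uH(1)])
  finally have 1: "dI u u \<le> (LBINT x. indicator B x * (f (u x) * u x)) + 1/K * pot u" .
  have "1/K * pot u \<le> 1/K * N u"
    using K_pos N_eq[of u] gagliardo_nonneg[of u] by (intro mult_left_mono) auto
  also have "\<dots> \<le> m0/2 * N u" using inverse_K uH by (intro mult_right_mono) auto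
  finally have 2: "1/K * pot u \<le> m0/2 * N u" .
  have "dI u u = M (N u) * N u" using uH by (simp add: dJ_def N_inner)
  moreover have "m0 * N u \<le> M (N u) * N u" using M_ge[of "N u"] uH by (intro mult_right_mono) auto
  ultimately show ?thesis using 1 2 by linarith
qed

text \<open>Estimate \<open>J u - dJ u u / 4\<close>. The segment bound gives
  \<open>Mhat M (N u) / 2 - M (N u) * N u / 4 >= m0 / 4 * N u\<close>. Inside \<open>B\<close> the
  nonlinear difference has the right sign because \<open>4 * primitive f t <= f t * t\<close>;
  outside it costs at most \<open>pot u / (2 * K)\<close>.\<close>

lemma nehari_coercive:
  assumes u: "u \<in> nehari H J"
  shows "(m0 / 4 - 1 / (2 * K)) * N u \<le> J u"
proof -
  have uH: "u \<in> H" "N u > 0" "dJ u u = 0" using u by (auto simp: nehari_eq)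
  have dI: "dI u u = M (N u) * N u" using uH by (simp add: dJ_def N_inner)
  have "(LBINT x. \<Phi> x (u x) - \<phi> x (u x) * u x / 4) \<le> (LBINT x. 1/(2 * K) * (W x * (u x)\<^sup>2))"
  proof (rule Bochner_Integration.integral_mono)
    fix x
    have 1: "0 \<le> 1/(2 * K) * (W x * (u x)\<^sup>2)" using K_pos W_nonneg[of x] by simp
    have 2: "V0 / (2 * K) * (u x)\<^sup>2 \<le> 1/(2 * K) * (W x * (u x)\<^sup>2)"
      using K_pos mult_right_mono[OF V_ge[of "\<epsilon> *\<^sub>R x"], of "(u x)\<^sup>2"] by (simp add: field_simps)
    show "\<Phi> x (u x) - \<phi> x (u x) * u x / 4 \<le> 1/(2 * K) * (W x * (u x)\<^sup>2)"
      using 1 2 primitive_f_le[of "u x"] primitive_ft_quarter[of "u x"] by (auto simp: \<Phi>_def \<phi>_def)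
  qed (use uH H_pot[OF uH(1)] \<Phi>_integrable[OF uH(1)] \<phi>_integrable[OF uH(1) uH(1)] in auto)
  then have 1: "(LBINT x. \<Phi> x (u x)) - dI u u / 4 \<le> 1/(2 * K) * pot u"
    using \<Phi>_integrable[OF uH(1)] \<phi>_integrable[OF uH(1) uH(1)] by (simp add: dI_def pot_eq(1)[OF uH(1)])
  have 2: "1/(2 * K) * pot u \<le> 1/(2 * K) * N u"
    using K_pos N_eq[of u] gagliardo_nonneg[of u] by (intro mult_left_mono) auto
  have 3: "(M (N u) + m0) / 2 * N u \<le> Mhat M (N u)" using uH by (intro Mhat_lower) auto
  have "(m0 / 4 - 1 / (2 * K)) * N u = 1/2 * ((M (N u) + m0) / 2 * N u) - M (N u) * N u / 4 - 1/(2 * K) * N u"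
    by (simp add: algebra_simps add_divide_distrib)
  also have "\<dots> \<le> 1/2 * Mhat M (N u) - (LBINT x. \<Phi> x (u x))"
    using 1 2 3 dI by linarith
  finally show ?thesis by (simp add: J_def)
qed

lemma coercivity_constant: "m0 / 4 - 1 / (2 * K) > 0"
  using inverse_K by simp

lemma f_growth_abs:
  assumes "\<delta> > 0"
  obtains C where "C > 0" "\<And>t. f t * t \<le> \<delta> * t\<^sup>2 + C * \<bar>t\<bar> powr q"
proof -
  obtain C where C: "C > 0" "\<And>t. 0 \<le> t \<Longrightarrow> f t \<le> \<delta> * t + C * t powr (q - 1)"
    using f_growth[OF assms] by blast
  have "f t * t \<le> \<delta> * t\<^sup>2 + C * \<bar>t\<bar> powr q" for t
  proof (cases "t > 0")
    case True
    have "f t * t \<le> (\<delta> * t + C * t powr (q - 1)) * t" using C True by (intro mult_right_mono) auto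
    also have "\<dots> = \<delta> * t\<^sup>2 + C * \<bar>t\<bar> powr q" using True by (simp add: power2_eq_square powr_diff algebra_simps)
    finally show ?thesis .
  next
    case False
    then show ?thesis using C assms by (simp add: f_nonpos_zero)
  qed
  then show ?thesis using that C by blast
qed

text \<open>Normalizing to \<open>N w = 1\<close> turns the bound on a fixed ball into
  \<open>D * N u powr (q / 2)\<close> for the power integral. As \<open>q / 2 > 1\<close>, the
  linear lower bound \<open>m0 / 2 * N u\<close> on the local mass cannot hold for small
  \<open>N u\<close>.\<close>

lemma nehari_bounded_below:
  obtains \<rho> where "\<rho> > 0" "\<And>u. u \<in> nehari H J \<Longrightarrow> \<rho> \<le> N u"
proof -
  \<comment> \<open>As coefficient of \<open>t^2\<close> this spends half of the available
    \<open>m0 / 2 * N u\<close>, because \<open>V0\<close> times the square integral is at most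
    \<open>N u\<close>.\<close>
  have "V0 * (m0 / 4) > 0" using V0 m0_pos by simp
  then obtain C where C: "C > 0" "\<And>t. f t * t \<le> V0 * (m0 / 4) * t\<^sup>2 + C * \<bar>t\<bar> powr q"
    using f_growth_abs by blast
  have "1 + 1 / V0 > 0" using V0 by (simp add: add_pos_pos)
  then obtain D where D: "D > 0" "\<And>u. u \<in> sobolev_ball s (1 + 1 / V0) \<Longrightarrow> (\<integral>\<^sup>+ x. ennreal (\<bar>u x\<bar> powr q) \<partial>lborel) \<le> ennreal D"
    using sobolev_ball_powr_bound[OF s0 s1 _ q2 q_subcritical] by blast
  define \<rho> where "\<rho> = (m0 / (4 * C * D)) powr (1 / (q / 2 - 1))"
  have q2': "q / 2 - 1 > 0" using q4 by simp
  have "\<rho> \<le> N u" if u: "u \<in> nehari H J" for u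
  proof -
    have uH: "u \<in> H" "N u > 0" "dJ u u = 0" using u by (auto simp: nehari_eq)
    note [measurable] = H_measurable[OF uH(1)]
    define n where "n = N u"
    have n: "n > 0" using uH by (simp add: n_def)
    define w where "w = (\<lambda>x. (1 / sqrt n) * u x)"
    have wH: "w \<in> H" unfolding w_def by (rule H_scale[OF uH(1)])
    have "N w = 1" using n unfolding w_def N_scale[OF uH(1)] by (simp add: power_divide n_def[symmetric])
    then have "w \<in> sobolev_ball s (1 + 1 / V0)" using H_sobolev_ball[OF wH, of 1] by simp
    then have "(\<integral>\<^sup>+ x. ennreal (\<bar>w x\<bar> powr q) \<partial>lborel) \<le> ennreal D" by (rule D)
    then have wq: "(LBINT x. \<bar>w x\<bar> powr q) \<le> D"
      using D(1) H_measurable[OF wH] by (subst integral_eq_nn_integral) (auto intro!: enn2real_leI)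
    have "\<bar>u x\<bar> powr q = n powr (q / 2) * \<bar>w x\<bar> powr q" for x
    proof -
      have "\<bar>u x\<bar> = sqrt n * \<bar>w x\<bar>" using n by (simp add: w_def abs_mult)
      then show ?thesis using n by (simp add: powr_mult powr_half_sqrt[symmetric] powr_powr)
    qed
    then have "(LBINT x. \<bar>u x\<bar> powr q) = n powr (q / 2) * (LBINT x. \<bar>w x\<bar> powr q)" by (simp only:) simp
    also have "\<dots> \<le> n powr (q / 2) * D" using wq by (intro mult_left_mono) auto
    finally have uq: "(LBINT x. \<bar>u x\<bar> powr q) \<le> n powr (q / 2) * D" .
    have "m0 / 2 * n \<le> (LBINT x. indicator B x * (f (u x) * u x))" using nehari_local_mass[OF u] by (simp add: n_def)
    also have "\<dots> \<le> (LBINT x. V0 * (m0 / 4) * (u x)\<^sup>2 + C * \<bar>u x\<bar> powr q)"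
    proof (rule Bochner_Integration.integral_mono[OF f_local_integrable[OF uH(1)]])
      show "integrable lborel (\<lambda>x. V0 * (m0 / 4) * (u x)\<^sup>2 + C * \<bar>u x\<bar> powr q)"
        using H_square[OF uH(1)] H_powr_integrable[OF uH(1) q2 q_subcritical] by auto
      fix x
      have "0 \<le> f (u x) * u x" using f_nonneg[of "u x"] f_nonpos_zero[of "u x"] by (cases "u x \<le> 0") auto
      then show "indicator B x * (f (u x) * u x) \<le> V0 * (m0 / 4) * (u x)\<^sup>2 + C * \<bar>u x\<bar> powr q"
        using C(2)[of "u x"] by (auto simp: indicator_def)
    qed
    also have "\<dots> = m0 / 4 * (V0 * (LBINT x. (u x)\<^sup>2)) + C * (LBINT x. \<bar>u x\<bar> powr q)"
      using H_square[OF uH(1)] H_powr_integrable[OF uH(1) q2 q_subcritical] by simp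
    also have "\<dots> \<le> m0 / 4 * n + C * (n powr (q / 2) * D)"
      using square_le_pot[OF uH(1)] N_eq[of u] gagliardo_nonneg[of u] uq C m0_pos
      by (intro add_mono mult_left_mono) (auto simp: n_def)
    finally have "m0 / 4 * n \<le> C * D * n powr (q / 2)" by (simp add: algebra_simps)
    also have "n powr (q / 2) = n * n powr (q / 2 - 1)" using n by (simp add: powr_diff)
    finally have "m0 / 4 * n \<le> (C * D * n powr (q / 2 - 1)) * n" by (simp add: mult_ac)
    then have "m0 / 4 \<le> C * D * n powr (q / 2 - 1)" using n by (simp only: mult_le_cancel_right_pos)
    then have le: "m0 / (4 * C * D) \<le> n powr (q / 2 - 1)" using C D by (simp add: field_simps)
    have "\<rho> \<le> (n powr (q / 2 - 1)) powr (1 / (q / 2 - 1))"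
      unfolding \<rho>_def using le q2' C D m0_pos by (intro powr_mono2) auto
    also have "\<dots> = n" using n q2' by (simp add: powr_powr)
    finally show ?thesis by (simp add: n_def)
  qed
  moreover have "\<rho> > 0" using C D m0_pos by (simp add: \<rho>_def)
  ultimately show ?thesis using that by blast
qed

section \<open>Projection to the Nehari set\<close>

lemma dJ_ray_pos_small:
  assumes u: "u \<in> H" and N: "N u > 0"
  obtains t where "t > 0" "dJ (\<lambda>x. t * u x) u > 0"
proof -
  have "V0 * (m0 / 2) > 0" using V0 m0_pos by simp
  then obtain C where C: "C > 0" "\<And>t. f t * t \<le> V0 * (m0 / 2) * t\<^sup>2 + C * \<bar>t\<bar> powr q"
    using f_growth_abs by blast
  define Q where "Q = (LBINT x. \<bar>u x\<bar> powr q)"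
  have Q: "Q \<ge> 0" unfolding Q_def by (intro Bochner_Integration.integral_nonneg) auto
  define n where "n = N u"
  have n: "n > 0" using N by (simp add: n_def)
  \<comment> \<open>Chosen so that \<open>C * Q * t powr (q - 2)\<close> stays below
    \<open>m0 / 2 * n\<close>; the added 1 covers \<open>Q = 0\<close>.\<close>
  define t where "t = (m0 * n / (4 * (C * Q + 1))) powr (1 / (q - 2))"
  have CQ: "C * Q + 1 > 0" using C Q by (simp add: add_nonneg_pos)
  have t: "t > 0" using m0_pos n CQ by (simp add: t_def)
  have tq: "t powr (q - 2) = m0 * n / (4 * (C * Q + 1))" using q4 m0_pos n CQ by (simp add: t_def powr_powr)
  have "C * Q * t powr (q - 2) \<le> (C * Q + 1) * t powr (q - 2)" by (intro mult_right_mono) auto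
  also have "\<dots> = m0 * n / 4"
  proof -
    have "d * (m0 * n / (4 * d)) = m0 * n / 4" if "d > 0" for d using that by simp
    from this[OF CQ] show ?thesis unfolding tq .
  qed
  also have "\<dots> < m0 / 2 * n" using m0_pos n by simp
  finally have small: "C * Q * t powr (q - 2) < m0 / 2 * n" .
  have "t * dI (\<lambda>x. t * u x) u = (LBINT x. t * (\<phi> x (t * u x) * u x))"
    by (simp add: dI_def)
  also have "\<dots> \<le> (LBINT x. V0 * (m0 / 2) * t\<^sup>2 * (u x)\<^sup>2 + C * t powr q * \<bar>u x\<bar> powr q)"
  proof (rule Bochner_Integration.integral_mono)
    show "integrable lborel (\<lambda>x. t * (\<phi> x (t * u x) * u x))"
      using \<phi>_integrable[OF H_scale[OF u] u, of t] by auto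
    show "integrable lborel (\<lambda>x. V0 * (m0 / 2) * t\<^sup>2 * (u x)\<^sup>2 + C * t powr q * \<bar>u x\<bar> powr q)"
      using H_square[OF u] H_powr_integrable[OF u q2 q_subcritical] by auto
    fix x
    have "t * (\<phi> x (t * u x) * u x) \<le> f (t * u x) * (t * u x)"
    proof (cases "u x \<le> 0")
      case True
      then have "t * u x \<le> 0" using t by (simp add: mult_le_0_iff)
      then show ?thesis by (simp add: \<phi>_nonpos_zero f_nonpos_zero)
    next
      case False
      have "\<phi> x (t * u x) * (t * u x) \<le> f (t * u x) * (t * u x)" using False t by (intro mult_right_mono \<phi>_le_f) auto
      then show ?thesis by (simp add: mult_ac)
    qed
    also have "\<dots> \<le> V0 * (m0 / 2) * (t * u x)\<^sup>2 + C * \<bar>t * u x\<bar> powr q" by (rule C)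
    also have "\<dots> = V0 * (m0 / 2) * t\<^sup>2 * (u x)\<^sup>2 + C * t powr q * \<bar>u x\<bar> powr q"
      using t by (simp add: power_mult_distrib abs_mult powr_mult)
    finally show "t * (\<phi> x (t * u x) * u x) \<le> V0 * (m0 / 2) * t\<^sup>2 * (u x)\<^sup>2 + C * t powr q * \<bar>u x\<bar> powr q" .
  qed
  also have "\<dots> = m0 / 2 * t\<^sup>2 * (V0 * (LBINT x. (u x)\<^sup>2)) + C * t powr q * Q"
    using H_square[OF u] H_powr_integrable[OF u q2 q_subcritical] by (simp add: Q_def)
  also have "\<dots> \<le> m0 / 2 * t\<^sup>2 * n + C * t powr q * Q"
    using square_le_pot[OF u] N_eq[of u] gagliardo_nonneg[of u] m0_pos
    by (intro add_right_mono mult_left_mono) (auto simp: n_def)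
  also have "\<dots> = t\<^sup>2 * (m0 / 2 * n + C * Q * t powr (q - 2))"
    using t by (simp add: powr_diff algebra_simps)
  also have "\<dots> < t\<^sup>2 * (m0 / 2 * n + m0 / 2 * n)" using small t by (intro mult_strict_left_mono) auto
  also have "\<dots> = t * (m0 * (t * n))" by (simp add: power2_eq_square)
  also have "\<dots> \<le> t * (M (t\<^sup>2 * n) * (t * n))" using t n M_ge[of "t\<^sup>2 * n"] by (intro mult_left_mono mult_right_mono) auto
  finally have "dI (\<lambda>x. t * u x) u < M (t\<^sup>2 * n) * (t * n)" using t by simp
  then show ?thesis using that[OF t] by (simp add: dJ_ray[OF u] n_def)
qed

text \<open>By \<open>M_ratio\<close>, \<open>M (t^2 * n) <= t^2 * M n\<close> for
  \<open>t >= 1\<close>, so the Kirchhoff term grows at most like \<open>t^3\<close>. On a subset of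
  \<open>B\<close> of positive measure \<open>u\<close> exceeds some \<open>\<delta> > 0\<close>;
  there \<open>f (t * u x) / t^3\<close> tends to infinity, and the nonlinear term wins.\<close>

lemma dJ_ray_neg_large:
  assumes u: "u \<in> H" and N: "N u > 0" and pos: "\<not> (AE x in lborel. x \<in> B \<longrightarrow> u x \<le> 0)"
  obtains t where "t > 0" "dJ (\<lambda>x. t * u x) u < 0"
proof -
  note [measurable] = H_measurable[OF u] B_measurable
  \<comment> \<open>Positivity on \<open>B\<close> is made quantitative: if all these sets were
    null, so would be their union.\<close>
  have "\<exists>k. emeasure lborel {x \<in> B. u x > 1 / real (Suc k)} \<noteq> 0"
  proof (rule ccontr)
    assume "\<nexists>k. emeasure lborel {x \<in> B. u x > 1 / real (Suc k)} \<noteq> 0"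
    then have "AE x in lborel. x \<notin> {x \<in> B. u x > 1 / real (Suc k)}" for k
      by (intro AE_not_in) (auto simp: null_sets_def)
    then have "AE x in lborel. \<forall>k. x \<notin> {x \<in> B. u x > 1 / real (Suc k)}"
      by (subst AE_all_countable) blast
    then have "AE x in lborel. x \<in> B \<longrightarrow> u x \<le> 0"
    proof (eventually_elim, intro impI)
      fix x assume x: "\<forall>k. x \<notin> {x \<in> B. u x > 1 / real (Suc k)}" "x \<in> B"
      show "u x \<le> 0"
      proof (rule ccontr)
        assume "\<not> u x \<le> 0"
        then obtain k where "inverse (real (Suc k)) < u x" using reals_Archimedean[of "u x"] by auto
        then show False using x by (auto simp: inverse_eq_divide)
      qed
    qed
    then show False using pos by blast
  qed
  then obtain k where k: "emeasure lborel {x \<in> B. u x > 1 / real (Suc k)} \<noteq> 0" by blast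
  define \<delta> where "\<delta> = 1 / real (Suc k)"
  have \<delta>: "\<delta> > 0" by (simp add: \<delta>_def)
  define E where "E = {x \<in> B. u x > \<delta>}"
  have [measurable]: "E \<in> sets borel" unfolding E_def by measurable
  have Efin: "emeasure lborel E < \<infinity>"
    using emeasure_mono[of E B lborel] B_finite by (auto simp: E_def)
  define \<mu> where "\<mu> = measure lborel E"
  have "emeasure lborel E = ennreal \<mu>" using Efin by (simp add: \<mu>_def emeasure_eq_ennreal_measure top.not_eq_extremum)
  then have \<mu>: "\<mu> > 0" using k by (auto simp: E_def \<delta>_def \<mu>_def zero_less_measure_iff)
  define n where "n = N u"
  have n: "n > 0" using N by (simp add: n_def)
  \<comment> \<open>With this \<open>L\<close> the set \<open>E\<close> alone contributes at least
    \<open>t^3 * (M n * n + 1)\<close>, which exceeds the cubic bound on the Kirchhoff term.\<close>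
  define L where "L = (M n * n + 1) / (\<delta> ^ 4 * \<mu>)"
  obtain T where T: "T > 0" "\<And>t. t \<ge> T \<Longrightarrow> f t / t ^ 3 \<ge> L" by (rule f_superlinear) blast
  define t where "t = max 1 (T / \<delta>)"
  have t: "t \<ge> 1" by (simp add: t_def)
  have "t * \<delta> \<ge> T" using \<delta> by (simp add: t_def field_simps max_def)
  then have fL: "L \<le> f (t * \<delta>) / (t * \<delta>) ^ 3" by (rule T)
  have "f (t * \<delta>) * \<delta> * \<mu> = (LBINT x. f (t * \<delta>) * \<delta> * indicator E x)"
    by (simp add: \<mu>_def)
  also have "\<dots> \<le> dI (\<lambda>x. t * u x) u" unfolding dI_def
  proof (rule Bochner_Integration.integral_mono)
    show "integrable lborel (\<lambda>x. f (t * \<delta>) * \<delta> * indicator E x)"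
      using Efin by (intro integrable_mult_right) (simp add: integrable_indicator_iff)
    show "integrable lborel (\<lambda>x. \<phi> x (t * u x) * u x)" by (rule \<phi>_integrable[OF H_scale[OF u] u])
    fix x
    show "f (t * \<delta>) * \<delta> * indicator E x \<le> \<phi> x (t * u x) * u x"
    proof (cases "x \<in> E")
      case True
      then have x: "x \<in> B" "\<delta> < u x" by (auto simp: E_def)
      have "f (t * \<delta>) \<le> f (t * u x)" using x t \<delta> by (intro f_mono) auto
      then have "f (t * \<delta>) * \<delta> \<le> f (t * u x) * u x" using x \<delta> f_nonneg by (intro mult_mono) auto
      then show ?thesis using True x by (simp add: \<phi>_def)
    next
      case False
      have "0 \<le> \<phi> x (t * u x) * u x"
      proof (cases "u x \<le> 0")
        case True
        then have "t * u x \<le> 0" using t by (simp add: mult_le_0_iff)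
        then show ?thesis by (simp add: \<phi>_nonpos_zero)
      qed (simp add: \<phi>_nonneg)
      then show ?thesis using False by simp
    qed
  qed
  finally have dI: "f (t * \<delta>) * \<delta> * \<mu> \<le> dI (\<lambda>x. t * u x) u" .
  have "f (t * \<delta>) * \<delta> * \<mu> = t ^ 3 * (f (t * \<delta>) / (t * \<delta>) ^ 3 * (\<delta> ^ 4 * \<mu>))"
    using t \<delta> by (simp add: power_mult_distrib power_eq_if)
  also have "\<dots> \<ge> t ^ 3 * (L * (\<delta> ^ 4 * \<mu>))" using t \<delta> \<mu> fL by (intro mult_left_mono mult_right_mono) auto
  also have "L * (\<delta> ^ 4 * \<mu>) = M n * n + 1" using \<delta> \<mu> by (simp add: L_def)
  finally have low: "t ^ 3 * (M n * n + 1) \<le> dI (\<lambda>x. t * u x) u" using dI by linarith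
  have "(M (t\<^sup>2 * n) - m0) / (t\<^sup>2 * n) \<le> (M n - m0) / n" using t n by (intro M_ratio) auto
  then have "M (t\<^sup>2 * n) - m0 \<le> (M n - m0) / n * (t\<^sup>2 * n)" using t n by (subst (asm) pos_divide_le_eq) auto
  also have "\<dots> = t\<^sup>2 * (M n - m0)" using n by simp
  finally have "M (t\<^sup>2 * n) \<le> t\<^sup>2 * (M n - m0) + m0" by simp
  also have "\<dots> \<le> t\<^sup>2 * (M n - m0) + t\<^sup>2 * m0" using t m0_pos by simp
  also have "\<dots> = t\<^sup>2 * M n" by (simp add: algebra_simps)
  finally have "M (t\<^sup>2 * n) * (t * n) \<le> t\<^sup>2 * M n * (t * n)" using t n by (intro mult_right_mono) auto
  also have "\<dots> = t ^ 3 * (M n * n)" by (simp add: power2_eq_square power3_eq_cube)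
  also have "\<dots> < t ^ 3 * (M n * n + 1)" using t by (intro mult_strict_left_mono) auto
  also note low
  finally have "dJ (\<lambda>x. t * u x) u < 0" by (simp add: dJ_ray[OF u] n_def)
  then show ?thesis using that t by (meson less_le_trans zero_less_one)
qed

lemma nehari_projection:
  assumes u: "u \<in> H" and pos: "\<not> (AE x in lborel. x \<in> B \<longrightarrow> u x \<le> 0)"
  obtains t where "t > 0" "(\<lambda>x. t * u x) \<in> nehari H J"
proof -
  have N: "N u > 0"
  proof -
    have "nontrivial u" unfolding nontrivial_def
    proof
      assume "AE x in lborel. u x = 0"
      then have "AE x in lborel. x \<in> B \<longrightarrow> u x \<le> 0" by eventually_elim auto
      then show False using pos by simp
    qed
    then show ?thesis using nontrivial_iff[OF u] by simp
  qed
  obtain t1 where t1: "t1 > 0" "dJ (\<lambda>x. t1 * u x) u > 0" using dJ_ray_pos_small[OF u N] by blast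
  obtain t2 where t2: "t2 > 0" "dJ (\<lambda>x. t2 * u x) u < 0" using dJ_ray_neg_large[OF u N pos] by blast
  \<comment> \<open>The order of \<open>t1\<close> and \<open>t2\<close> does not come from their
    construction; it follows from the monotonicity of the quotient by \<open>t^3\<close>.\<close>
  have t12: "t1 < t2"
  proof (rule ccontr)
    assume "\<not> t1 < t2"
    moreover have "t1 \<noteq> t2" using t1 t2 by auto
    ultimately have "dJ (\<lambda>x. t1 * u x) u / t1 ^ 3 < dJ (\<lambda>x. t2 * u x) u / t2 ^ 3"
      using t2 by (intro dJ_ray_decreasing[OF u N]) auto
    moreover have "dJ (\<lambda>x. t1 * u x) u / t1 ^ 3 > 0" "dJ (\<lambda>x. t2 * u x) u / t2 ^ 3 < 0"
      using t1 t2 by (auto simp: divide_less_0_iff)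
    ultimately show False by linarith
  qed
  have "continuous_on UNIV (\<lambda>t. dJ (\<lambda>x. fst (t, 0::real) * u x + snd (t, 0::real) * u x) u)"
    by (rule continuous_on_compose2[OF dJ_continuous[OF u u u]]) (auto intro!: continuous_intros)
  then have c: "continuous_on UNIV (\<lambda>t. dJ (\<lambda>x. t * u x) u)" by simp
  obtain t where t: "t1 \<le> t" "dJ (\<lambda>x. t * u x) u = 0"
    using IVT2'[of "\<lambda>t. dJ (\<lambda>x. t * u x) u" t2 0 t1] t1 t2 t12 continuous_on_subset[OF c] by auto
  have "(\<lambda>x. t * u x) \<in> nehari H J"
    unfolding nehari_eq using t t1 N by (auto simp: H_scale[OF u] N_scale[OF u] dJ_ray_scale[OF u])
  then show ?thesis using that t t1 by (meson less_le_trans)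
qed

section \<open>Existence of a ground state\<close>

text \<open>A bump centred in \<open>B\<close> is positive on a nonempty open subset of
  \<open>B\<close>, and such a set is not null.\<close>

lemma nehari_nonempty:
  assumes "open B" "B \<noteq> {}"
  shows "nehari H J \<noteq> {}"
proof -
  obtain x0 where x0: "x0 \<in> B" using assms by blast
  define u where "u = (\<lambda>x. max 0 (1 - norm (x - x0)))"
  have u: "u \<in> H" unfolding u_def by (rule H_bump)
  have "\<not> (AE x in lborel. x \<in> B \<longrightarrow> u x \<le> 0)"
  proof
    assume ae: "AE x in lborel. x \<in> B \<longrightarrow> u x \<le> 0"
    define S where "S = B \<inter> ball x0 1"
    have S: "open S" "S \<noteq> {}" using assms x0 by (auto simp: S_def)
    have "AE x in lborel. x \<notin> S"
      using ae by eventually_elim (auto simp: S_def u_def dist_norm norm_minus_commute)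
    then have "S \<in> null_sets lborel" using S by (subst AE_iff_null_sets) auto
    then have "S \<in> null_sets lebesgue" by (rule null_sets_completionI)
    then show False using open_not_negligible[OF S] by (simp add: negligible_iff_null_sets)
  qed
  then show ?thesis using nehari_projection[OF u] by blast
qed

lemma f_ball_growth:
  obtains C where "\<And>t. \<bar>f t * t\<bar> \<le> C * (1 + \<bar>t\<bar> powr q)"
proof -
  obtain C where C: "C > 0" "\<And>U. 0 \<le> U \<Longrightarrow> f U * U \<le> C * (U\<^sup>2 + U powr q)" by (rule f_majorant) blast
  have "\<bar>f t * t\<bar> \<le> (2 * C) * (1 + \<bar>t\<bar> powr q)" for t
  proof -
    have "\<bar>f t * t\<bar> \<le> f \<bar>t\<bar> * \<bar>t\<bar>"
      using f_le_abs[of t "\<bar>t\<bar>"] f_nonneg[of t] by (auto simp: abs_mult intro!: mult_right_mono)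
    also have "\<dots> \<le> C * (\<bar>t\<bar>\<^sup>2 + \<bar>t\<bar> powr q)" by (rule C) simp
    also have "\<dots> \<le> C * (2 * (1 + \<bar>t\<bar> powr q))"
    proof (rule mult_left_mono)
      have "\<bar>t\<bar>\<^sup>2 \<le> 1 + \<bar>t\<bar> powr q"
      proof (cases "\<bar>t\<bar> \<le> 1")
        case True
        then have "\<bar>t\<bar>\<^sup>2 \<le> 1" by (simp add: abs_square_le_1)
        then show ?thesis by (simp add: add_increasing2)
      next
        case False
        then have "\<bar>t\<bar> powr 2 \<le> \<bar>t\<bar> powr q" using q2 by (intro powr_mono) auto
        then show ?thesis using False by simp
      qed
      then show "\<bar>t\<bar>\<^sup>2 + \<bar>t\<bar> powr q \<le> 2 * (1 + \<bar>t\<bar> powr q)" by (simp add: add_increasing2)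
    qed (use C in simp)
    finally show ?thesis by (simp add: algebra_simps)
  qed
  then show ?thesis using that by blast
qed

lemma local_mass_convergence:
  assumes v: "\<And>n. v n \<in> H" "\<And>n. N (v n) \<le> R" and w: "w \<in> H" "N w \<le> R" and R: "R > 0"
    and conv: "AE x in lborel. (\<lambda>n. v n x) \<longlonglongrightarrow> w x"
  shows "(\<lambda>n. LBINT x. indicator B x * (f (v n x) * v n x)) \<longlonglongrightarrow> (LBINT x. indicator B x * (f (w x) * w x))"
    and "(\<lambda>n. LBINT x. indicator B x * primitive f (v n x)) \<longlonglongrightarrow> (LBINT x. indicator B x * primitive f (w x))"
proof -
  have R': "R + R / V0 > 0" using R V0 by (simp add: add_pos_pos)
  obtain C where C: "\<And>t. \<bar>f t * t\<bar> \<le> C * (1 + \<bar>t\<bar> powr q)" by (rule f_ball_growth) blast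
  have P: "\<bar>primitive f t\<bar> \<le> C * (1 + \<bar>t\<bar> powr q)" for t
    using C[of t] primitive_f_le[of t] primitive_f_nonneg[of t] by linarith
  note * = subcritical_integral_convergence[OF s0 s1 R' q2 q_subcritical B_measurable B_finite _ _
      H_sobolev_ball[OF v] H_sobolev_ball[OF w] conv]
  show "(\<lambda>n. LBINT x. indicator B x * (f (v n x) * v n x)) \<longlonglongrightarrow> (LBINT x. indicator B x * (f (w x) * w x))"
    using C by (intro *[where \<Psi> = "\<lambda>t. f t * t"] continuous_intros f_cont) auto
  show "(\<lambda>n. LBINT x. indicator B x * primitive f (v n x)) \<longlonglongrightarrow> (LBINT x. indicator B x * primitive f (w x))"
    using P by (intro *[where \<Psi> = "primitive f"] primitive_f_cont)
qed

text \<open>Splitting \<open>m\<^sub>0 t\<close> off \<open>Mhat M t\<close> makes the part of the functional outside \<open>B\<close> nonnegative,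
  so that Fatou's lemma applies to it although there is no compactness there.\<close>

definition outer :: "(R3 \<Rightarrow> real) \<Rightarrow> R3 \<Rightarrow> real" where
  "outer u x = m0 / 2 * (W x * (u x)\<^sup>2) - indicator (- B) x * primitive ft (u x)"

lemma outer_nonneg: "0 \<le> outer u x"
proof -
  have "indicator (- B) x * primitive ft (u x) \<le> primitive ft (u x)"
    using primitive_ft_nonneg by (auto simp: indicator_def)
  also have "\<dots> \<le> V0 / (2 * K) * (u x)\<^sup>2" by (rule primitive_ft_le)
  also have "\<dots> = (1 / K) / 2 * (V0 * (u x)\<^sup>2)" by simp
  also have "\<dots> \<le> m0 / 2 * (W x * (u x)\<^sup>2)"
    using inverse_K m0_pos V_ge V0 K_pos W_nonneg by (intro mult_mono) auto
  finally show ?thesis by (simp add: outer_def)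
qed

text \<open>The decomposition sorts the terms by their behaviour along bounded, almost everywhere
  convergent sequences: the first three can only drop in the limit, the last converges because
  \<open>B\<close> has finite measure and \<open>q\<close> is subcritical.\<close>

lemma J_split:
  assumes u: "u \<in> H"
  shows "integrable lborel (outer u)"
    and "J u = 1/2 * (Mhat M (N u) - m0 * N u) + m0 / 2 * gagliardo s u + (LBINT x. outer u x)
      - (LBINT x. indicator B x * primitive f (u x))"
proof -
  note [measurable] = H_measurable[OF u] B_measurable
  have iB: "integrable lborel (\<lambda>x. indicator B x * primitive f (u x))"
    by (rule Bochner_Integration.integrable_bound[OF \<Phi>_integrable[OF u]]) (auto simp: indicator_def \<Phi>_def)
  have iC: "integrable lborel (\<lambda>x. indicator (- B) x * primitive ft (u x))"
    by (rule Bochner_Integration.integrable_bound[OF \<Phi>_integrable[OF u]]) (auto simp: indicator_def \<Phi>_def)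
  show "integrable lborel (outer u)" unfolding outer_def[abs_def] using iC H_pot[OF u] by auto
  have "(LBINT x. \<Phi> x (u x)) = (LBINT x. indicator B x * primitive f (u x) + indicator (- B) x * primitive ft (u x))"
    by (intro Bochner_Integration.integral_cong) (auto simp: \<Phi>_def)
  also have "\<dots> = (LBINT x. indicator B x * primitive f (u x)) + (LBINT x. indicator (- B) x * primitive ft (u x))"
    using iB iC by simp
  finally have 1: "(LBINT x. \<Phi> x (u x)) = (LBINT x. indicator B x * primitive f (u x)) + (LBINT x. indicator (- B) x * primitive ft (u x))" .
  have 2: "(LBINT x. outer u x) = m0 / 2 * pot u - (LBINT x. indicator (- B) x * primitive ft (u x))"
    unfolding outer_def using iC H_pot[OF u] by (simp add: pot_eq(1)[OF u])
  show "J u = 1/2 * (Mhat M (N u) - m0 * N u) + m0 / 2 * gagliardo s u + (LBINT x. outer u x)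
      - (LBINT x. indicator B x * primitive f (u x))"
    unfolding J_def 1 2 N_eq by (simp add: algebra_simps)
qed

text \<open>\<open>g\<close> and \<open>p\<close> may exceed the two parts of the norm of
  \<open>w\<close>, so \<open>w\<close> need not satisfy the Nehari identity. The bound for every
  \<open>t\<close> starts from \<open>J_ray_max\<close>, solved for the outer integral and passed to
  the limit by Fatou's lemma; the loss in the norm has the favourable sign.\<close>

lemma nehari_limit:
  assumes v: "\<And>n. v n \<in> nehari H J" and Jv: "(\<lambda>n. J (v n)) \<longlonglongrightarrow> c"
    and w: "w \<in> borel_measurable borel" and conv: "AE x in lborel. (\<lambda>n. v n x) \<longlonglongrightarrow> w x"
    and g: "(\<lambda>n. gagliardo s (v n)) \<longlonglongrightarrow> g" and p: "(\<lambda>n. pot (v n)) \<longlonglongrightarrow> p"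
  shows "w \<in> H" and "\<not> (AE x in lborel. x \<in> B \<longrightarrow> w x \<le> 0)"
    and "t > 0 \<Longrightarrow> J (\<lambda>x. t * w x) \<le> c"
proof -
  have vH: "v n \<in> H" for n using v by (auto simp: nehari_eq)
  note [measurable] = w H_measurable[OF vH] B_measurable
  show wH: "w \<in> H" by (rule H_fatou(1)[OF vH w conv g p])
  have gw: "gagliardo s w \<le> g" by (rule H_fatou(2)[OF vH w conv g p])
  have pw: "pot w \<le> p" by (rule H_fatou(3)[OF vH w conv g p])
  have Nv: "(\<lambda>n. N (v n)) \<longlonglongrightarrow> g + p" unfolding N_eq by (intro tendsto_add g p)
  have "Bseq (\<lambda>n. N (v n))" using Nv convergentI convergent_imp_Bseq by blast
  then obtain R0 where R0: "\<And>n. \<bar>N (v n)\<bar> \<le> R0" unfolding Bseq_def by auto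
  define R where "R = \<bar>R0\<bar> + N w + 1"
  have R: "R > 0" "N (v n) \<le> R" "N w \<le> R" for n using R0[of n] N_nonneg[of w] by (auto simp: R_def)
  obtain \<rho> where \<rho>: "\<rho> > 0" "\<And>u. u \<in> nehari H J \<Longrightarrow> \<rho> \<le> N u" using nehari_bounded_below by blast
  have mass: "m0 / 2 * \<rho> \<le> (LBINT x. indicator B x * (f (w x) * w x))"
  proof (rule LIMSEQ_le_const[OF local_mass_convergence(1)[OF vH R(2) wH R(3,1) conv]], intro exI allI impI)
    fix n
    have "m0 / 2 * \<rho> \<le> m0 / 2 * N (v n)" using \<rho>(2)[OF v] m0_pos by (intro mult_left_mono) auto
    then show "m0 / 2 * \<rho> \<le> (LBINT x. indicator B x * (f (v n x) * v n x))"
      using nehari_local_mass[OF v[of n]] by linarith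
  qed
  show "\<not> (AE x in lborel. x \<in> B \<longrightarrow> w x \<le> 0)"
  proof
    assume "AE x in lborel. x \<in> B \<longrightarrow> w x \<le> 0"
    then have "AE x in lborel. indicator B x * (f (w x) * w x) = 0"
      by eventually_elim (auto simp: indicator_def f_nonpos_zero)
    then have "(LBINT x. indicator B x * (f (w x) * w x)) = 0" by (rule integral_eq_zero_AE)
    then show False using mass \<rho> m0_pos mult_pos_pos[of "m0/2" \<rho>] by linarith
  qed
  assume t: "t > 0"
  have tvH: "(\<lambda>x. t * v n x) \<in> H" for n by (rule H_scale[OF vH])
  have twH: "(\<lambda>x. t * w x) \<in> H" by (rule H_scale[OF wH])
  have tconv: "AE x in lborel. (\<lambda>n. t * v n x) \<longlonglongrightarrow> t * w x"
    using conv by eventually_elim (intro tendsto_intros)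
  let ?P = "\<lambda>\<tau>. Mhat M \<tau> - m0 * \<tau>"
  define F where "F u = (LBINT x. indicator B x * primitive f (u x))" for u
  \<comment> \<open>The upper bound for the outer integral of \<open>t * v n\<close> that results
    from \<open>J_split\<close> and \<open>J_ray_max\<close>. This bound, rather than the integral,
    is known to converge.\<close>
  define e where "e = (\<lambda>n. J (v n) - 1/2 * ?P (t\<^sup>2 * N (v n)) - m0 / 2 * (t\<^sup>2 * gagliardo s (v n)) + F (\<lambda>x. t * v n x))"
  define e0 where "e0 = c - 1/2 * ?P (t\<^sup>2 * (g + p)) - m0 / 2 * (t\<^sup>2 * g) + F (\<lambda>x. t * w x)"
  have gp: "0 \<le> g + p" using Nv N_nonneg by (intro LIMSEQ_le_const) auto
  have e: "e \<longlonglongrightarrow> e0"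
  proof -
    have "(\<lambda>n. t\<^sup>2 * N (v n)) \<longlonglongrightarrow> t\<^sup>2 * (g + p)" by (intro tendsto_intros Nv)
    then have "(\<lambda>n. Mhat M (t\<^sup>2 * N (v n))) \<longlonglongrightarrow> Mhat M (t\<^sup>2 * (g + p))"
      using gp N_nonneg by (intro continuous_on_tendsto_compose[OF Mhat_cont]) auto
    moreover have "(\<lambda>n. F (\<lambda>x. t * v n x)) \<longlonglongrightarrow> F (\<lambda>x. t * w x)"
      unfolding F_def
    proof (rule local_mass_convergence(2)[OF tvH _ twH _ _ tconv])
      show "N (\<lambda>x. t * v n x) \<le> t\<^sup>2 * R" for n using R(2)[of n] by (simp add: N_scale[OF vH] mult_left_mono)
      show "N (\<lambda>x. t * w x) \<le> t\<^sup>2 * R" using R(3) by (simp add: N_scale[OF wH] mult_left_mono)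
      show "0 < t\<^sup>2 * R" using R(1) t by simp
    qed
    ultimately show ?thesis unfolding e_def e0_def by (intro tendsto_intros Jv Nv g)
  qed
  have oe: "(LBINT x. outer (\<lambda>x. t * v n x) x) \<le> e n" for n
    using J_ray_max[OF v[of n] t] J_split(2)[OF tvH[of n]]
    by (simp add: e_def F_def N_scale[OF vH] gagliardo_scale[OF vH])
  have oe0: "0 \<le> e n" for n
    using oe[of n] Bochner_Integration.integral_nonneg[of lborel "outer (\<lambda>x. t * v n x)"] outer_nonneg
    by (meson order_trans)
  have e00: "0 \<le> e0" using e oe0 by (intro LIMSEQ_le_const) auto
  have "(\<integral>\<^sup>+ x. ennreal (outer (\<lambda>x. t * w x) x) \<partial>lborel) \<le> ennreal e0"
  proof (rule nn_integral_fatou_le[of "\<lambda>n. outer (\<lambda>x. t * v n x)", OF _ _ _ e])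
    show "outer (\<lambda>x. t * v n x) \<in> borel_measurable lborel" for n
      using J_split(1)[OF tvH[of n]] by auto
    have "isCont (primitive ft) y" for y using primitive_ft_cont by (simp add: continuous_on_eq_continuous_at)
    then show "AE x in lborel. (\<lambda>n. outer (\<lambda>x. t * v n x) x) \<longlonglongrightarrow> outer (\<lambda>x. t * w x) x"
      using tconv unfolding outer_def
      by (auto elim!: eventually_mono intro!: tendsto_intros isCont_tendsto_compose[where g = "primitive ft"])
    show "(\<integral>\<^sup>+ x. ennreal (outer (\<lambda>x. t * v n x) x) \<partial>lborel) \<le> ennreal (e n)" for n
      using oe[of n] J_split(1)[OF tvH[of n]]
      by (subst nn_integral_eq_integral) (auto simp: outer_nonneg ennreal_leI)
  qed
  then have "ennreal (LBINT x. outer (\<lambda>x. t * w x) x) \<le> ennreal e0"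
    using J_split(1)[OF twH] by (subst (asm) nn_integral_eq_integral) (auto simp: outer_nonneg)
  then have ow: "(LBINT x. outer (\<lambda>x. t * w x) x) \<le> e0" using e00 by (simp add: ennreal_le_iff)
  \<comment> \<open>The terms of the splitting are abstracted to plain reals; the final estimate is
    then linear arithmetic.\<close>
  have combine: "j \<le> c" if "p1 \<le> p2" "g1 \<le> g2" "j = 1/2 * p1 + g1 + o1 - f1" "o1 \<le> c - 1/2 * p2 - g2 + f1"
    for j p1 p2 g1 g2 o1 f1 :: real using that by linarith
  show "J (\<lambda>x. t * w x) \<le> c"
  proof (rule combine[OF _ _ _ ow[unfolded e0_def]])
    show "?P (t\<^sup>2 * N w) \<le> ?P (t\<^sup>2 * (g + p))"
      using gw pw N_nonneg[of w] by (intro Mhat_excess_mono) (auto simp: N_eq intro!: mult_left_mono)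
    show "m0 / 2 * (t\<^sup>2 * gagliardo s w) \<le> m0 / 2 * (t\<^sup>2 * g)"
      using gw m0_pos by (intro mult_left_mono) auto
    show "J (\<lambda>x. t * w x) = 1/2 * ?P (t\<^sup>2 * N w) + m0 / 2 * (t\<^sup>2 * gagliardo s w)
        + (LBINT x. outer (\<lambda>x. t * w x) x) - F (\<lambda>x. t * w x)"
      using J_split(2)[OF twH] by (simp add: F_def N_scale[OF wH] gagliardo_scale[OF wH])
  qed
qed

lemma nehari_minimizer:
  assumes "open B" "B \<noteq> {}"
  obtains z where "z \<in> nehari H J" "\<And>x. 0 \<le> z x" "J z = Inf (J ` nehari H J)"
    "\<And>y. y \<in> nehari H J \<Longrightarrow> J z \<le> J y"
proof -
  define c where "c = Inf (J ` nehari H J)"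
  have bdd: "bdd_below (J ` nehari H J)"
  proof (rule bdd_belowI2)
    fix u assume u: "u \<in> nehari H J"
    have "0 \<le> (m0 / 4 - 1 / (2 * K)) * N u" using coercivity_constant N_nonneg by (intro mult_nonneg_nonneg) auto
    then show "0 \<le> J u" using nehari_coercive[OF u] by linarith
  qed
  have ne: "J ` nehari H J \<noteq> {}" using nehari_nonempty[OF assms] by simp
  have "\<exists>u. u \<in> nehari H J \<and> J u < c + 1 / real (Suc n)" for n
  proof -
    have "Inf (J ` nehari H J) < c + 1 / real (Suc n)" by (simp add: c_def)
    then show ?thesis using cInf_lessD[OF ne] by blast
  qed
  then obtain u where u: "\<And>n. u n \<in> nehari H J" "\<And>n. J (u n) < c + 1 / real (Suc n)" by metis
  have cle: "c \<le> J y" if "y \<in> nehari H J" for y unfolding c_def using that bdd by (intro cInf_lower) auto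
  have Ju: "(\<lambda>n. J (u n)) \<longlonglongrightarrow> c"
  proof (rule tendsto_sandwich[of "\<lambda>_. c" _ _ "\<lambda>n. c + 1 / real (Suc n)"])
    have "(\<lambda>n. c + inverse (real (Suc n))) \<longlonglongrightarrow> c + 0" by (intro tendsto_intros LIMSEQ_inverse_real_of_nat)
    then show "(\<lambda>n. c + 1 / real (Suc n)) \<longlonglongrightarrow> c" by (simp add: inverse_eq_divide)
  qed (use u cle in \<open>auto intro!: always_eventually less_imp_le\<close>)
  have uH: "u n \<in> H" for n using u by (auto simp: nehari_eq)
  define R where "R = (\<bar>c\<bar> + 1) / (m0 / 4 - 1 / (2 * K))"
  have R: "R > 0" unfolding R_def using coercivity_constant by (intro divide_pos_pos) auto
  have NR: "N (u n) \<le> R" for n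
  proof -
    have "1 / real (Suc n) \<le> 1" by simp
    then have "J (u n) \<le> \<bar>c\<bar> + 1" using u(2)[of n] by linarith
    then have "(m0 / 4 - 1 / (2 * K)) * N (u n) \<le> \<bar>c\<bar> + 1" using nehari_coercive[OF u(1)[of n]] by linarith
    then show ?thesis using coercivity_constant unfolding R_def by (subst pos_le_divide_eq) (auto simp: mult.commute)
  qed
  have R': "R + R / V0 > 0" using R V0 by (simp add: add_pos_pos)
  obtain \<rho> w where \<rho>: "strict_mono \<rho>" and w: "w \<in> sobolev_ball s (R + R / V0)"
    and conv: "AE x in lborel. (\<lambda>n. u (\<rho> n) x) \<longlonglongrightarrow> w x"
    using sobolev_ball_ae_compact[OF s0 R', of u] H_sobolev_ball[OF uH NR] by blast
  \<comment> \<open>Pairing the two parts of the norm as a point of the plane yields one subsequence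
    along which both converge.\<close>
  define X where "X n = (gagliardo s (u (\<rho> n)), pot (u (\<rho> n)))" for n
  have "bounded (range X)"
  proof (rule boundedI)
    fix y assume "y \<in> range X"
    then obtain n where y: "y = X n" by blast
    have "norm y \<le> \<bar>gagliardo s (u (\<rho> n))\<bar> + \<bar>pot (u (\<rho> n))\<bar>"
      unfolding y X_def using norm_Pair_le[of "gagliardo s (u (\<rho> n))" "pot (u (\<rho> n))"] by simp
    also have "\<dots> = N (u (\<rho> n))" using gagliardo_nonneg pot_nonneg by (simp add: N_eq)
    finally show "norm y \<le> R" using NR[of "\<rho> n"] by linarith
  qed
  then obtain l r where r: "strict_mono (r :: nat \<Rightarrow> nat)" and l: "(X \<circ> r) \<longlonglongrightarrow> l"
    using bounded_imp_convergent_subsequence by blast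
  define v where "v n = u (\<rho> (r n))" for n
  have Jv: "(\<lambda>n. J (v n)) \<longlonglongrightarrow> c"
    using LIMSEQ_subseq_LIMSEQ[OF LIMSEQ_subseq_LIMSEQ[OF Ju \<rho>] r] by (simp add: v_def o_def)
  have vconv: "AE x in lborel. (\<lambda>n. v n x) \<longlonglongrightarrow> w x"
    using conv
  proof eventually_elim
    fix x assume "(\<lambda>n. u (\<rho> n) x) \<longlonglongrightarrow> w x"
    from LIMSEQ_subseq_LIMSEQ[OF this r] show "(\<lambda>n. v n x) \<longlonglongrightarrow> w x" by (simp add: v_def o_def)
  qed
  have vg: "(\<lambda>n. gagliardo s (v n)) \<longlonglongrightarrow> fst l" using tendsto_fst[OF l] by (simp add: v_def X_def o_def)
  have vp: "(\<lambda>n. pot (v n)) \<longlonglongrightarrow> snd l" using tendsto_snd[OF l] by (simp add: v_def X_def o_def)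
  have vN: "v n \<in> nehari H J" for n using u by (simp add: v_def)
  note lim = nehari_limit[OF vN Jv sobolev_ball_measurable[OF w] vconv vg vp]
  define w' where "w' = (\<lambda>x. max 0 (w x))"
  have w'H: "w' \<in> H" and Nw': "N w' \<le> N w"
    unfolding w'_def by (rule H_contraction[OF lim(1)]; auto simp: max_def)+
  have "\<not> (AE x in lborel. x \<in> B \<longrightarrow> w' x \<le> 0)" using lim(2) by (simp add: w'_def)
  then obtain t where t: "t > 0" and zN: "(\<lambda>x. t * w' x) \<in> nehari H J" using nehari_projection[OF w'H] by blast
  \<comment> \<open>\<open>t\<close> was chosen for \<open>w'\<close>, not for \<open>w\<close>;
    this is harmless because the limit bound holds for all positive multiples of \<open>w\<close>.
    The positive part has the same nonlinear integral and no larger \<open>N\<close>.\<close>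
  have "J (\<lambda>x. t * w' x) \<le> J (\<lambda>x. t * w x)"
  proof -
    have "t * w' x = max 0 (t * w x)" for x using t by (simp add: w'_def max_def mult_le_0_iff zero_le_mult_iff)
    then have "(LBINT x. \<Phi> x (t * w' x)) = (LBINT x. \<Phi> x (t * w x))" by (simp add: \<Phi>_pos_part)
    moreover have "Mhat M (N (\<lambda>x. t * w' x)) \<le> Mhat M (N (\<lambda>x. t * w x))"
      using Nw' N_nonneg by (intro Mhat_mono) (auto simp: N_scale[OF w'H] N_scale[OF lim(1)] mult_left_mono)
    ultimately show ?thesis by (simp add: J_def)
  qed
  also have "\<dots> \<le> c" by (rule lim(3)[OF t])
  finally have "J (\<lambda>x. t * w' x) \<le> c" .
  then have Jz: "J (\<lambda>x. t * w' x) = c" using cle[OF zN] by simp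
  show ?thesis
    using that[OF zN] t cle Jz by (simp add: c_def w'_def)
qed

text \<open>On the ray through \<open>z\<close> the derivative changes sign from plus to minus at
  \<open>z\<close>. A small displacement \<open>\<beta>\<close> along \<open>v\<close> preserves the
  two signs, so some \<open>\<alpha> * z + \<beta> * v\<close> is again in the Nehari set; its
  energy is below that of \<open>\<alpha> * z\<close>, which is at most \<open>J z\<close>.\<close>

lemma nehari_minimizer_critical:
  assumes z: "z \<in> nehari H J" and min: "\<And>y. y \<in> nehari H J \<Longrightarrow> J z \<le> J y" and v: "v \<in> H"
  shows "\<not> dJ z v < 0"
proof
  assume neg: "dJ z v < 0"
  have zH: "z \<in> H" "N z > 0" "dJ z z = 0" using z by (auto simp: nehari_eq)
  define c where "c p = (\<lambda>x. fst p * z x + snd p * v x)" for p :: "real \<times> real"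
  have cH: "c p \<in> H" for p unfolding c_def by (rule H_linear[OF zH(1) v])
  have c1: "c (1, 0) = z" by (simp add: c_def)
  have dv: "continuous_on UNIV (\<lambda>p. dJ (c p) v)" unfolding c_def by (rule dJ_continuous[OF zH(1) v v])
  have dz: "continuous_on UNIV (\<lambda>p. dJ (c p) z)" unfolding c_def by (rule dJ_continuous[OF zH(1) v zH(1)])
  have Nc: "continuous_on UNIV (\<lambda>p. N (c p))" unfolding c_def N_linear[OF zH(1) v] by (intro continuous_intros)
  define S where "S p = dJ (c p) (c p)" for p
  have S_eq: "S p = fst p * dJ (c p) z + snd p * dJ (c p) v" for p
    unfolding S_def using dJ_linear[OF cH zH(1) v] by (simp add: c_def)
  have Scont: "continuous_on UNIV S" unfolding S_eq[abs_def] by (intro continuous_intros dv dz)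
  have "open ({p. dJ (c p) v < 0} \<inter> {p. 0 < N (c p)})"
    by (intro open_Int open_Collect_less dv Nc continuous_on_const)
  moreover have "(1, 0) \<in> {p. dJ (c p) v < 0} \<inter> {p. 0 < N (c p)}" using neg zH(2) by (simp add: c1)
  ultimately obtain d where d: "d > 0" "\<And>p. dist p (1, 0) < d \<Longrightarrow> dJ (c p) v < 0 \<and> N (c p) > 0"
    unfolding open_dist by blast
  \<comment> \<open>\<open>1/2\<close> keeps \<open>\<alpha>\<close> positive; \<open>d/3\<close>
    keeps \<open>|\<alpha> - 1| + |\<beta>|\<close> below \<open>d\<close>.\<close>
  define \<eta> where "\<eta> = min (1/2) (d/3)"
  have \<eta>: "\<eta> > 0" "\<eta> \<le> 1/2" "\<eta> \<le> d/3" using d by (auto simp: \<eta>_def)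
  have near: "dJ (c (\<alpha>, \<beta>)) v < 0" "N (c (\<alpha>, \<beta>)) > 0" if "\<bar>\<alpha> - 1\<bar> \<le> \<eta>" "\<bar>\<beta>\<bar> \<le> \<eta>" for \<alpha> \<beta>
  proof -
    have "dist (\<alpha>, \<beta>) (1, 0) = norm (\<alpha> - 1, \<beta>)" by (simp add: dist_norm)
    also have "\<dots> \<le> \<bar>\<alpha> - 1\<bar> + \<bar>\<beta>\<bar>" using norm_Pair_le[of "\<alpha> - 1" \<beta>] by simp
    also have "\<dots> < d" using that \<eta> d(1) by linarith
    finally show "dJ (c (\<alpha>, \<beta>)) v < 0" "N (c (\<alpha>, \<beta>)) > 0" using d(2) by auto
  qed
  have Sray: "S (\<alpha>, 0) = \<alpha> * dJ (\<lambda>x. \<alpha> * z x) z" for \<alpha> by (simp add: S_eq c_def)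
  have S1: "S (1 - \<eta>, 0) > 0" using dJ_ray_sign(1)[OF z, of "1 - \<eta>"] \<eta> by (simp add: Sray)
  have S2: "S (1 + \<eta>, 0) < 0" using dJ_ray_sign(2)[OF z, of "1 + \<eta>"] \<eta> by (simp add: Sray mult_pos_neg)
  have Sb: "continuous_on UNIV (\<lambda>\<beta>. S (\<alpha>, \<beta>))" for \<alpha>
    by (rule continuous_on_compose2[OF Scont]) (auto intro!: continuous_intros)
  have "open ({\<beta>. 0 < S (1 - \<eta>, \<beta>)} \<inter> {\<beta>. S (1 + \<eta>, \<beta>) < 0})"
    by (intro open_Int open_Collect_less Sb continuous_on_const)
  moreover have "0 \<in> {\<beta>. 0 < S (1 - \<eta>, \<beta>)} \<inter> {\<beta>. S (1 + \<eta>, \<beta>) < 0}" using S1 S2 by simp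
  ultimately obtain d' where d': "d' > 0" "\<And>\<beta>. dist \<beta> 0 < d' \<Longrightarrow> S (1 - \<eta>, \<beta>) > 0 \<and> S (1 + \<eta>, \<beta>) < 0"
    unfolding open_dist by blast
  \<comment> \<open>\<open>\<eta>\<close> is fixed before \<open>\<beta>\<close>, since
    \<open>d'\<close> depends on it. The bound \<open>\<beta> <= \<eta>\<close> keeps the derivative
    in direction \<open>v\<close> negative on the whole segment that starts at
    \<open>\<alpha> * z\<close>.\<close>
  define \<beta> where "\<beta> = min \<eta> (d'/2)"
  have \<beta>: "\<beta> > 0" "\<beta> \<le> \<eta>" "\<beta> < d'" using \<eta> d' by (auto simp: \<beta>_def)
  have Sa: "continuous_on {1 - \<eta>..1 + \<eta>} (\<lambda>\<alpha>. S (\<alpha>, \<beta>))"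
    by (rule continuous_on_compose2[OF Scont]) (auto intro!: continuous_intros)
  have "S (1 - \<eta>, \<beta>) > 0 \<and> S (1 + \<eta>, \<beta>) < 0" using \<beta> by (intro d') (simp add: dist_real_def)
  then obtain \<alpha> where \<alpha>: "1 - \<eta> \<le> \<alpha>" "\<alpha> \<le> 1 + \<eta>" "S (\<alpha>, \<beta>) = 0"
    using IVT2'[of "\<lambda>\<alpha>. S (\<alpha>, \<beta>)" "1 + \<eta>" 0 "1 - \<eta>"] Sa \<eta> by auto
  have \<alpha>0: "\<alpha> > 0" "\<bar>\<alpha> - 1\<bar> \<le> \<eta>" using \<alpha> \<eta> by auto
  have "c (\<alpha>, \<beta>) \<in> nehari H J"
    unfolding nehari_eq using cH near(2)[OF \<alpha>0(2)] \<beta> \<alpha>(3) by (simp add: S_def)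
  then have "J z \<le> J (c (\<alpha>, \<beta>))" by (rule min)
  also have "J (c (\<alpha>, \<beta>)) < J (c (\<alpha>, 0))"
  proof -
    let ?g = "\<lambda>b. J (\<lambda>x. \<alpha> * z x + b * v x)"
    have "?g \<beta> < ?g 0"
    proof (rule DERIV_neg_imp_decreasing[where f = ?g, OF \<beta>(1)])
      fix b assume b: "0 \<le> b" "b \<le> \<beta>"
      have nb: "dJ (c (\<alpha>, b)) v < 0" "N (c (\<alpha>, b)) > 0" using near[OF \<alpha>0(2), of b] b \<beta> by auto
      then have "(?g has_real_derivative dJ (c (\<alpha>, b)) v) (at b)"
        using J_deriv[OF H_scale[OF zH(1), of \<alpha>] v, of b] by (simp add: c_def)
      then show "\<exists>y. (?g has_real_derivative y) (at b) \<and> y < 0" using nb by blast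
    qed
    then show ?thesis by (simp add: c_def)
  qed
  also have "J (c (\<alpha>, 0)) \<le> J z" using J_ray_max[OF z \<alpha>0(1)] by (simp add: c_def)
  finally show False by simp
qed

lemma ground_state_exists:
  assumes "open B" "B \<noteq> {}"
  shows "\<exists>u. ground_state H J u \<and> (AE x in lborel. u x \<ge> 0)"
proof -
  obtain z where z: "z \<in> nehari H J" "\<And>x. 0 \<le> z x" "J z = Inf (J ` nehari H J)"
    and min: "\<And>y. y \<in> nehari H J \<Longrightarrow> J z \<le> J y" using nehari_minimizer[OF assms] by blast
  have zH: "z \<in> H" "N z > 0" using z by (auto simp: nehari_eq)
  have crit: "dJ z v = 0" if v: "v \<in> H" for v
  proof -
    \<comment> \<open>Minimality gives a one-sided inequality; applied to \<open>v\<close> and to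
      its negative it gives equality. The summand \<open>0 * v x\<close> brings the negative into
      the form of a linear combination.\<close>
    have "dJ z (\<lambda>x. (- 1) * v x + 0 * v x) = - dJ z v" using dJ_linear[OF zH(1) v v, of "-1" 0] by simp
    moreover have "\<not> dJ z (\<lambda>x. (- 1) * v x + 0 * v x) < 0"
      by (rule nehari_minimizer_critical[OF z(1) min H_linear[OF v v]])
    moreover have "\<not> dJ z v < 0" by (rule nehari_minimizer_critical[OF z(1) min v])
    ultimately show ?thesis by linarith
  qed
  have "critical_point H J z"
    unfolding critical_point_def J_dir_deriv_def using J_deriv0[OF zH(1) _ zH(2)] crit zH(1) by auto
  moreover have "nontrivial z" using nontrivial_iff[OF zH(1)] zH(2) by simp
  ultimately show ?thesis using z by (auto simp: ground_state_def)
qed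

end

section \<open>From the scaled domain back to the original problem\<close>

theorem theorem3p1:
  fixes s m0 V0 K a :: real and M f :: "real \<Rightarrow> real" and V :: "R3 \<Rightarrow> real"
    and \<Omega> :: "R3 set"
  assumes s: "3/4 < s" "s < 1"
    and M_cont: "continuous_on {0..} M"
    and M1: "m0 > 0" "\<forall>t\<ge>0. M t \<ge> m0"
    and M2: "mono_on {0..} M"
    and M3: "\<forall>t1 t2. t1 \<ge> t2 \<and> t2 > 0 \<longrightarrow> M t1 / t1 - M t2 / t2 \<le> m0 * (1/t1 - 1/t2)"
    and V_cont: "continuous_on UNIV V"
    and V_bdd: "bdd_below (range V)"
    and V0_def: "V0 = Inf (range V)"
    and V0_pos: "V0 > 0"
    and f_cont: "continuous_on UNIV f"
    and f_neg: "\<forall>t<0. f t = 0"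
    and f1: "((\<lambda>t. f t / t ^ 3) \<longlongrightarrow> 0) (at_right 0)"
    and f2: "\<exists>q. 4 < q \<and> q < 6 / (3 - 2 * s) \<and> ((\<lambda>t. f t / t powr (q - 1)) \<longlongrightarrow> 0) at_top"
    and f3: "\<exists>\<theta>. 4 < \<theta> \<and> \<theta> < 6 / (3 - 2 * s) \<and>
               (\<forall>t>0. 0 < \<theta> * primitive f t \<and> \<theta> * primitive f t \<le> f t * t)"
    and f4: "mono_on {0<..} (\<lambda>t. f t / t ^ 3)"
    and \<Omega>_dom: "lipschitz_domain \<Omega>" "bounded \<Omega>"
    and \<Omega>_bdry: "\<forall>x\<in>frontier \<Omega>. V0 < V x"
    and \<Omega>_min: "{x \<in> \<Omega>. V x = V0} \<noteq> {}"
    and K: "K > 2 / m0"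
    and a: "a > 0" "f a = V0 / K * a"
  shows "\<forall>\<epsilon>>0. \<exists>u. ground_state (H_eps s V \<epsilon>)
                      (J_eps M s V \<epsilon> (G_pen \<Omega> f V0 K a)) u
                 \<and> (AE x in lborel. u x \<ge> 0)"
proof (intro allI impI)
  fix \<epsilon> :: real assume \<epsilon>: "\<epsilon> > 0"
  obtain q where q: "4 < q" "q < 6 / (3 - 2 * s)" "((\<lambda>t. f t / t powr (q - 1)) \<longlongrightarrow> 0) at_top" using f2 by blast
  obtain \<theta> where \<theta>: "4 < \<theta>" "\<And>t. t > 0 \<Longrightarrow> 0 < \<theta> * primitive f t" "\<And>t. t > 0 \<Longrightarrow> \<theta> * primitive f t \<le> f t * t"
    using f3 by blast
  define B where "B = {x. \<epsilon> *\<^sub>R x \<in> \<Omega>}"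
  have \<Omega>: "open \<Omega>" "\<Omega> \<noteq> {}" using \<Omega>_dom by (auto simp: lipschitz_domain_def)
  have "open ((\<lambda>x. \<epsilon> *\<^sub>R x) -` \<Omega>)" using \<Omega>(1) by (intro open_vimage continuous_intros)
  then have B_open: "open B" by (simp add: B_def vimage_def)
  \<comment> \<open>As an image of \<open>\<Omega>\<close> under a dilation, \<open>B\<close> is
    seen to be bounded and nonempty.\<close>
  have B_image: "B = (\<lambda>x. (1/\<epsilon>) *\<^sub>R x) ` \<Omega>"
  proof
    show "B \<subseteq> (\<lambda>x. (1/\<epsilon>) *\<^sub>R x) ` \<Omega>"
    proof
      fix x assume "x \<in> B"
      then have "\<epsilon> *\<^sub>R x \<in> \<Omega>" by (simp add: B_def)
      moreover have "x = (1/\<epsilon>) *\<^sub>R (\<epsilon> *\<^sub>R x)" using \<epsilon> by simp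
      ultimately show "x \<in> (\<lambda>x. (1/\<epsilon>) *\<^sub>R x) ` \<Omega>" by blast
    qed
  qed (use \<epsilon> in \<open>auto simp: B_def\<close>)
  have "bounded B" unfolding B_image by (rule bounded_scaling[OF \<Omega>_dom(2)])
  then have B_fin: "emeasure lborel B < \<infinity>" by (rule emeasure_bounded_finite)
  have "K > 0" using K M1(1) by (meson divide_pos_pos less_trans zero_less_numeral)
  interpret kirchhoff_problem s V \<epsilon> V0 f q \<theta> K a M m0 B
  proof
    show "V0 \<le> V x" for x unfolding V0_def by (rule cInf_lower[OF _ V_bdd]) simp
    show "B \<in> sets borel" using B_open by simp
  qed (use assms q \<theta> B_fin \<open>K > 0\<close> in auto)
  have "G_pen \<Omega> f V0 K a (\<epsilon> *\<^sub>R x) t = \<Phi> x t" for x t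
  proof -
    have "g_pen \<Omega> f V0 K a (\<epsilon> *\<^sub>R x) = (if x \<in> B then f else f_tilde f V0 K a)"
      by (auto simp: g_pen_def B_def)
    then show ?thesis by (simp add: G_pen_def \<Phi>_def primitive_def)
  qed
  then have "J_eps M s V \<epsilon> (G_pen \<Omega> f V0 K a) = J" by (intro ext) (simp add: J_eps_def J_def)
  moreover have "B \<noteq> {}" using \<Omega>(2) by (simp add: B_image)
  ultimately show "\<exists>u. ground_state (H_eps s V \<epsilon>) (J_eps M s V \<epsilon> (G_pen \<Omega> f V0 K a)) u \<and> (AE x in lborel. u x \<ge> 0)"
    using ground_state_exists[OF B_open] by simp
qed

end
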